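(* Let $\xi\in X_1$, $x_0\in\mathbb{R}^2$, and $\theta_0\in\mathbb{R}$. Then the system of ordinary differential equations (the equations of motion) $$\dot x(t)=R(t)v(t),\qquad \dot\theta(t)=\omega(t),\qquad R(t)=\begin{pmatrix}\cos\theta(t)&-\sin\theta(t)\\ \sin\theta(t)&\cos\theta(t)\end{pmatrix},$$ with initial conditions $x(0)=x_0$ and $\theta(0)=\theta_0$, where $v$ and $\omega$ are determined by $\xi$ as in the context, has a unique absolutely continuous solution $t\mapsto(x(t),\theta(t))$ defined in $[0,T]$ with values in $\mathbb{R}^2\times\mathbb{R}$. This solution actually belongs to $H^1(0,T)$. In other words, there exists a unique rigid motion $t\mapsto r(t)$, given by a translation vector $x(t)\in\mathbb{R}^2$ and a rotation $R(t)\in\mathbb{R}^{2\times2}$, such that the function $$\chi(s,t)=x(t)+R(t)\xi(s,t)$$ belongs to $X_1$, satisfies the force and torque balance $$\int_0^L K_\chi(s,t)\dot\chi(s,t)\,ds=0,\qquad \int_0^L\langle K_\chi(s,t)\dot\chi(s,t),J\chi(s,t)\rangle\,ds=0\qquad\text{for a.e. }t\in[0,T],$$ and satisfies the initial conditions $x(0)=x_0$ and $R(0)=R_{\theta_0}$, the rotation of angle $\theta_0$.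
   Context: $L>0$, $T>0$ and the constants $C_\tau>0$, $C_\nu>0$ are fixed. A prime denotes $\partial/\partial s$ and a dot denotes the (distributional) derivative $\partial/\partial t$. $J=\begin{pmatrix}0&-1\\1&0\end{pmatrix}$ is the counter-clockwise rotation by $\pi/2$, and $(a\otimes b)_{ij}=a_ib_j$. $X$ is the space of functions $\chi:[0,L]\times[0,T]\to\mathbb{R}^2$ with $\chi\in L^\infty(0,T;H^2(0,L))$ and $\dot\chi\in L^2(0,T;L^2(0,L))$. Each $\chi\in X$ belongs to $H^1(0,T;L^2(0,L))$ and is always identified with its representative for which $t\mapsto\chi(\cdot,t)$ is continuous from $[0,T]$ into $L^2(0,L)$; with this convention $\chi$ and $\chi'$ are continuous on $[0,L]\times[0,T]$. $X_1:=\{\chi\in X: |\chi'|=1 \text{ in }[0,L]\times[0,T]\}$. For $\eta\in X_1$ set $$K_\eta(s,t):=C_\tau\,\eta'(s,t)\otimes\eta'(s,t)+C_\nu\,(J\eta'(s,t))\otimes(J\eta'(s,t)).$$ For $\xi\in X_1$ define $$A(t):=\int_0^L K_\xi(s,t)\,ds,\quad b(t):=\int_0^L K_\xi(s,t)J\xi(s,t)\,ds,\quad c(t):=\int_0^L\langle J\xi(s,t),K_\xi(s,t)J\xi(s,t)\rangle\,ds,$$ the grand resistance matrix $\mathcal{R}(t)=\begin{pmatrix}A(t)&b(t)\\ b^\top(t)&c(t)\end{pmatrix}\in\mathbb{R}^{3\times3}$, and let $\bar A(t)$, $\bar b(t)$, $\bar c(t)$ be the blocks of its inverse, $\mathcal{R}^{-1}(t)=\begin{pmatrix}\bar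 A(t)&\bar b(t)\\ \bar b^\top(t)&\bar c(t)\end{pmatrix}$. Further, $$F^{\mathrm{sh}}(t):=-\int_0^L K_\xi(s,t)\dot\xi(s,t)\,ds,\qquad M^{\mathrm{sh}}(t):=-\int_0^L\langle J\xi(s,t),K_\xi(s,t)\dot\xi(s,t)\rangle\,ds,$$ $$v(t):=\bar A(t)F^{\mathrm{sh}}(t)+\bar b(t)M^{\mathrm{sh}}(t),\qquad \omega(t):=\bar b^\top(t)F^{\mathrm{sh}}(t)+\bar c(t)M^{\mathrm{sh}}(t).$$ The differential equations are understood for a.e. $t\in[0,T]$. *)

theory Defs
  imports "HOL-Analysis.Analysis"
begin

section \<open>Lebesgue and Sobolev classes\<close>

definition L2_on :: "'a::euclidean_space set \<Rightarrow> ('a \<Rightarrow> 'b::euclidean_space) \<Rightarrow> bool" where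
  "L2_on S f \<longleftrightarrow> f \<in> borel_measurable (lebesgue_on S) \<and>
     integrable (lebesgue_on S) (\<lambda>x. (norm (f x))\<^sup>2)"

text \<open>The support is compact because it is a closed subset of a bounded interval.\<close>

definition test_function :: "real \<Rightarrow> real \<Rightarrow> (real \<Rightarrow> real) \<Rightarrow> bool" where
  "test_function a b \<phi> \<longleftrightarrow> (\<forall>n x. (deriv ^^ n) \<phi> differentiable at x) \<and>
     closure {x. \<phi> x \<noteq> 0} \<subseteq> {a<..<b}"

definition has_weak_derivative ::
    "real \<Rightarrow> real \<Rightarrow> (real \<Rightarrow> 'b::euclidean_space) \<Rightarrow> (real \<Rightarrow> 'b) \<Rightarrow> bool" where
  "has_weak_derivative a b u g \<longleftrightarrow> (\<forall>\<phi>. test_function a b \<phi> \<longrightarrow>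
     (LINT x|lebesgue_on {a..b}. deriv \<phi> x *\<^sub>R u x) = - (LINT x|lebesgue_on {a..b}. \<phi> x *\<^sub>R g x))"

definition H1_on :: "real \<Rightarrow> real \<Rightarrow> (real \<Rightarrow> 'b::euclidean_space) \<Rightarrow> bool" where
  "H1_on a b u \<longleftrightarrow> L2_on {a..b} u \<and> (\<exists>g. L2_on {a..b} g \<and> has_weak_derivative a b u g)"

text \<open>The usual \<open>\<epsilon>\<close>-\<open>\<delta>\<close> definition; a finite family of non-overlapping closed subintervals of
  \<open>[a, b]\<close> is a division of its union.\<close>

definition abs_continuous :: "real \<Rightarrow> real \<Rightarrow> (real \<Rightarrow> 'b::euclidean_space) \<Rightarrow> bool" where
  "abs_continuous a b f \<longleftrightarrow> (\<forall>\<epsilon>>0. \<exists>\<delta>>0. \<forall>\<D> S. \<D> division_of S \<and> S \<subseteq> {a..b} \<and>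
     (\<Sum>I\<in>\<D>. Sup I - Inf I) < \<delta> \<longrightarrow> (\<Sum>I\<in>\<D>. norm (f (Sup I) - f (Inf I))) < \<epsilon>)"


section \<open>The spaces \<open>X\<close> and \<open>X\<^sub>1\<close>\<close>

text \<open>Functions on \<open>[0, L] \<times> [0, T]\<close> are written in curried form \<open>\<eta> s t\<close>; values
  outside the rectangle are irrelevant.

  Membership in \<open>L\<^sup>\<infinity>(0, T; H\<^sup>2(0, L))\<close>: \<open>\<eta>1\<close> and \<open>\<eta>2\<close> are the first and second weak
  derivatives in the space variable. As \<open>H\<^sup>2(0, L)\<close> is separable and embeds isometrically in
  \<open>L\<^sup>2(0, L)\<^sup>3\<close> through \<open>u \<mapsto> (u, u', u'')\<close>, strong measurability of \<open>t \<mapsto> \<eta>(\<cdot>, t)\<close> is joint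
  measurability of these three functions (up to null sets). The integrals add up to the square
  of the \<open>H\<^sup>2\<close> norm.\<close>

definition Linf_H2 :: "real \<Rightarrow> real \<Rightarrow> (real \<Rightarrow> real \<Rightarrow> real^2) \<Rightarrow> bool" where
  "Linf_H2 L T \<eta> \<longleftrightarrow> (\<exists>\<eta>1 \<eta>2.
     (\<lambda>(s, t). \<eta> s t) \<in> borel_measurable (lebesgue_on ({0..L} \<times> {0..T})) \<and>
     (\<lambda>(s, t). \<eta>1 s t) \<in> borel_measurable (lebesgue_on ({0..L} \<times> {0..T})) \<and>
     (\<lambda>(s, t). \<eta>2 s t) \<in> borel_measurable (lebesgue_on ({0..L} \<times> {0..T})) \<and>
     (\<exists>M. AE t in lebesgue_on {0..T}.
        L2_on {0..L} (\<lambda>s. \<eta> s t) \<and> L2_on {0..L} (\<lambda>s. \<eta>1 s t) \<and> L2_on {0..L} (\<lambda>s. \<eta>2 s t) \<and>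
        has_weak_derivative 0 L (\<lambda>s. \<eta> s t) (\<lambda>s. \<eta>1 s t) \<and>
        has_weak_derivative 0 L (\<lambda>s. \<eta>1 s t) (\<lambda>s. \<eta>2 s t) \<and>
        (LINT s|lebesgue_on {0..L}. (norm (\<eta> s t))\<^sup>2)
          + (LINT s|lebesgue_on {0..L}. (norm (\<eta>1 s t))\<^sup>2)
          + (LINT s|lebesgue_on {0..L}. (norm (\<eta>2 s t))\<^sup>2) \<le> M))"

text \<open>\<open>g\<close> is the distributional time derivative of \<open>\<eta>\<close> and belongs to
  \<open>L\<^sup>2(0, T; L\<^sup>2(0, L)) = L\<^sup>2((0, L) \<times> (0, T))\<close>. The identity between the integrals over time is
  one of elements of \<open>L\<^sup>2(0, L)\<close>, hence is required for almost every \<open>s\<close>.\<close>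

definition is_time_derivative ::
    "real \<Rightarrow> real \<Rightarrow> (real \<Rightarrow> real \<Rightarrow> real^2) \<Rightarrow> (real \<Rightarrow> real \<Rightarrow> real^2) \<Rightarrow> bool" where
  "is_time_derivative L T \<eta> g \<longleftrightarrow> L2_on ({0..L} \<times> {0..T}) (\<lambda>(s, t). g s t) \<and>
     (\<forall>\<phi>. test_function 0 T \<phi> \<longrightarrow> (AE s in lebesgue_on {0..L}.
        (LINT t|lebesgue_on {0..T}. deriv \<phi> t *\<^sub>R \<eta> s t)
          = - (LINT t|lebesgue_on {0..T}. \<phi> t *\<^sub>R g s t)))"

text \<open>The continuity clause selects the representative with which elements of \<open>X\<close> are identified:
  the one continuous in time with values in \<open>L\<^sup>2(0, L)\<close> is the continuous one.\<close>

definition space_X :: "real \<Rightarrow> real \<Rightarrow> (real \<Rightarrow> real \<Rightarrow> real^2) set" where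
  "space_X L T = {\<eta>. Linf_H2 L T \<eta> \<and> (\<exists>g. is_time_derivative L T \<eta> g) \<and>
     continuous_on ({0..L} \<times> {0..T}) (\<lambda>(s, t). \<eta> s t)}"

text \<open>The time derivative is determined up to a null set of the rectangle; everything below uses it
  only inside integrals over \<open>s\<close>, for almost every \<open>t\<close>, so the choice made here is immaterial.\<close>

definition time_derivative ::
    "real \<Rightarrow> real \<Rightarrow> (real \<Rightarrow> real \<Rightarrow> real^2) \<Rightarrow> real \<Rightarrow> real \<Rightarrow> real^2" where
  "time_derivative L T \<eta> = (SOME g. is_time_derivative L T \<eta> g)"

text \<open>One-sided at the end points. For \<open>\<eta> \<in> X\<close> it exists at every point of the rectangle,
  since \<open>H\<^sup>2(0, L)\<close> embeds in \<open>C\<^sup>1([0, L])\<close>.\<close>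

definition space_derivative ::
    "real \<Rightarrow> (real \<Rightarrow> real \<Rightarrow> real^2) \<Rightarrow> real \<Rightarrow> real \<Rightarrow> real^2" where
  "space_derivative L \<eta> s t = vector_derivative (\<lambda>\<sigma>. \<eta> \<sigma> t) (at s within {0..L})"

definition space_X1 :: "real \<Rightarrow> real \<Rightarrow> (real \<Rightarrow> real \<Rightarrow> real^2) set" where
  "space_X1 L T = {\<eta> \<in> space_X L T. \<forall>s\<in>{0..L}. \<forall>t\<in>{0..T}. norm (space_derivative L \<eta> s t) = 1}"


section \<open>Resistance matrices and the equations of motion\<close>

definition J :: "real^2^2" where
  "J = vector [vector [0, -1], vector [1, 0]]"

definition rot :: "real \<Rightarrow> real^2^2" where
  "rot \<theta> = vector [vector [cos \<theta>, - sin \<theta>], vector [sin \<theta>, cos \<theta>]]"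

definition outer :: "real^2 \<Rightarrow> real^2 \<Rightarrow> real^2^2" where
  "outer a b = (\<chi> i j. a $ i * b $ j)"

definition K :: "real \<Rightarrow> real \<Rightarrow> real \<Rightarrow> (real \<Rightarrow> real \<Rightarrow> real^2) \<Rightarrow> real \<Rightarrow> real \<Rightarrow> real^2^2" where
  "K C\<^sub>\<tau> C\<^sub>\<nu> L \<eta> s t =
     (let p = space_derivative L \<eta> s t
      in C\<^sub>\<tau> *\<^sub>R outer p p + C\<^sub>\<nu> *\<^sub>R outer (J *v p) (J *v p))"

definition A_mat :: "real \<Rightarrow> real \<Rightarrow> real \<Rightarrow> (real \<Rightarrow> real \<Rightarrow> real^2) \<Rightarrow> real \<Rightarrow> real^2^2" where
  "A_mat C\<^sub>\<tau> C\<^sub>\<nu> L \<xi> t = (LINT s|lebesgue_on {0..L}. K C\<^sub>\<tau> C\<^sub>\<nu> L \<xi> s t)"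

definition b_vec :: "real \<Rightarrow> real \<Rightarrow> real \<Rightarrow> (real \<Rightarrow> real \<Rightarrow> real^2) \<Rightarrow> real \<Rightarrow> real^2" where
  "b_vec C\<^sub>\<tau> C\<^sub>\<nu> L \<xi> t = (LINT s|lebesgue_on {0..L}. K C\<^sub>\<tau> C\<^sub>\<nu> L \<xi> s t *v (J *v \<xi> s t))"

definition c_scal :: "real \<Rightarrow> real \<Rightarrow> real \<Rightarrow> (real \<Rightarrow> real \<Rightarrow> real^2) \<Rightarrow> real \<Rightarrow> real" where
  "c_scal C\<^sub>\<tau> C\<^sub>\<nu> L \<xi> t =
     (LINT s|lebesgue_on {0..L}. (J *v \<xi> s t) \<bullet> (K C\<^sub>\<tau> C\<^sub>\<nu> L \<xi> s t *v (J *v \<xi> s t)))"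

definition grand_resistance ::
    "real \<Rightarrow> real \<Rightarrow> real \<Rightarrow> (real \<Rightarrow> real \<Rightarrow> real^2) \<Rightarrow> real \<Rightarrow> real^3^3" where
  "grand_resistance C\<^sub>\<tau> C\<^sub>\<nu> L \<xi> t =
     (let A = A_mat C\<^sub>\<tau> C\<^sub>\<nu> L \<xi> t; b = b_vec C\<^sub>\<tau> C\<^sub>\<nu> L \<xi> t; c = c_scal C\<^sub>\<tau> C\<^sub>\<nu> L \<xi> t
      in vector [vector [A $ 1 $ 1, A $ 1 $ 2, b $ 1],
                 vector [A $ 2 $ 1, A $ 2 $ 2, b $ 2],
                 vector [b $ 1, b $ 2, c]])"

definition Abar :: "real \<Rightarrow> real \<Rightarrow> real \<Rightarrow> (real \<Rightarrow> real \<Rightarrow> real^2) \<Rightarrow> real \<Rightarrow> real^2^2" where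
  "Abar C\<^sub>\<tau> C\<^sub>\<nu> L \<xi> t =
     (let N = matrix_inv (grand_resistance C\<^sub>\<tau> C\<^sub>\<nu> L \<xi> t)
      in vector [vector [N $ 1 $ 1, N $ 1 $ 2], vector [N $ 2 $ 1, N $ 2 $ 2]])"

definition bbar :: "real \<Rightarrow> real \<Rightarrow> real \<Rightarrow> (real \<Rightarrow> real \<Rightarrow> real^2) \<Rightarrow> real \<Rightarrow> real^2" where
  "bbar C\<^sub>\<tau> C\<^sub>\<nu> L \<xi> t =
     (let N = matrix_inv (grand_resistance C\<^sub>\<tau> C\<^sub>\<nu> L \<xi> t) in vector [N $ 1 $ 3, N $ 2 $ 3])"

definition cbar :: "real \<Rightarrow> real \<Rightarrow> real \<Rightarrow> (real \<Rightarrow> real \<Rightarrow> real^2) \<Rightarrow> real \<Rightarrow> real" where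
  "cbar C\<^sub>\<tau> C\<^sub>\<nu> L \<xi> t = matrix_inv (grand_resistance C\<^sub>\<tau> C\<^sub>\<nu> L \<xi> t) $ 3 $ 3"

definition F_sh :: "real \<Rightarrow> real \<Rightarrow> real \<Rightarrow> real \<Rightarrow> (real \<Rightarrow> real \<Rightarrow> real^2) \<Rightarrow> real \<Rightarrow> real^2" where
  "F_sh C\<^sub>\<tau> C\<^sub>\<nu> L T \<xi> t =
     - (LINT s|lebesgue_on {0..L}. K C\<^sub>\<tau> C\<^sub>\<nu> L \<xi> s t *v time_derivative L T \<xi> s t)"

definition M_sh :: "real \<Rightarrow> real \<Rightarrow> real \<Rightarrow> real \<Rightarrow> (real \<Rightarrow> real \<Rightarrow> real^2) \<Rightarrow> real \<Rightarrow> real" where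
  "M_sh C\<^sub>\<tau> C\<^sub>\<nu> L T \<xi> t =
     - (LINT s|lebesgue_on {0..L}.
          (J *v \<xi> s t) \<bullet> (K C\<^sub>\<tau> C\<^sub>\<nu> L \<xi> s t *v time_derivative L T \<xi> s t))"

definition vel :: "real \<Rightarrow> real \<Rightarrow> real \<Rightarrow> real \<Rightarrow> (real \<Rightarrow> real \<Rightarrow> real^2) \<Rightarrow> real \<Rightarrow> real^2" where
  "vel C\<^sub>\<tau> C\<^sub>\<nu> L T \<xi> t =
     Abar C\<^sub>\<tau> C\<^sub>\<nu> L \<xi> t *v F_sh C\<^sub>\<tau> C\<^sub>\<nu> L T \<xi> t + M_sh C\<^sub>\<tau> C\<^sub>\<nu> L T \<xi> t *\<^sub>R bbar C\<^sub>\<tau> C\<^sub>\<nu> L \<xi> t"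

definition ang_vel :: "real \<Rightarrow> real \<Rightarrow> real \<Rightarrow> real \<Rightarrow> (real \<Rightarrow> real \<Rightarrow> real^2) \<Rightarrow> real \<Rightarrow> real" where
  "ang_vel C\<^sub>\<tau> C\<^sub>\<nu> L T \<xi> t =
     bbar C\<^sub>\<tau> C\<^sub>\<nu> L \<xi> t \<bullet> F_sh C\<^sub>\<tau> C\<^sub>\<nu> L T \<xi> t + cbar C\<^sub>\<tau> C\<^sub>\<nu> L \<xi> t * M_sh C\<^sub>\<tau> C\<^sub>\<nu> L T \<xi> t"

definition solves_eom :: "real \<Rightarrow> real \<Rightarrow> real \<Rightarrow> real \<Rightarrow> (real \<Rightarrow> real \<Rightarrow> real^2) \<Rightarrow> real^2 \<Rightarrow> real \<Rightarrow>
    (real \<Rightarrow> real^2) \<Rightarrow> (real \<Rightarrow> real) \<Rightarrow> bool" where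
  "solves_eom C\<^sub>\<tau> C\<^sub>\<nu> L T \<xi> x\<^sub>0 \<theta>\<^sub>0 x \<theta> \<longleftrightarrow>
     abs_continuous 0 T (\<lambda>t. (x t, \<theta> t)) \<and>
     (AE t in lebesgue_on {0..T}.
        (x has_vector_derivative rot (\<theta> t) *v vel C\<^sub>\<tau> C\<^sub>\<nu> L T \<xi> t) (at t within {0..T}) \<and>
        (\<theta> has_real_derivative ang_vel C\<^sub>\<tau> C\<^sub>\<nu> L T \<xi> t) (at t within {0..T})) \<and>
     x 0 = x\<^sub>0 \<and> \<theta> 0 = \<theta>\<^sub>0"

definition force_torque_balance ::
    "real \<Rightarrow> real \<Rightarrow> real \<Rightarrow> real \<Rightarrow> (real \<Rightarrow> real \<Rightarrow> real^2) \<Rightarrow> bool" where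
  "force_torque_balance C\<^sub>\<tau> C\<^sub>\<nu> L T \<eta> \<longleftrightarrow> (AE t in lebesgue_on {0..T}.
     (LINT s|lebesgue_on {0..L}. K C\<^sub>\<tau> C\<^sub>\<nu> L \<eta> s t *v time_derivative L T \<eta> s t) = 0 \<and>
     (LINT s|lebesgue_on {0..L}.
        (K C\<^sub>\<tau> C\<^sub>\<nu> L \<eta> s t *v time_derivative L T \<eta> s t) \<bullet> (J *v \<eta> s t)) = 0)"

text \<open>No regularity of \<open>x\<close> and \<open>R\<close> in time is assumed beyond what the requirement
  \<open>x + R \<xi> \<in> X\<^sub>1\<close> entails.\<close>

definition balanced_rigid_motion ::
    "real \<Rightarrow> real \<Rightarrow> real \<Rightarrow> real \<Rightarrow> (real \<Rightarrow> real \<Rightarrow> real^2) \<Rightarrow> real^2 \<Rightarrow> real \<Rightarrow>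
     (real \<Rightarrow> real^2) \<Rightarrow> (real \<Rightarrow> real^2^2) \<Rightarrow> bool" where
  "balanced_rigid_motion C\<^sub>\<tau> C\<^sub>\<nu> L T \<xi> x\<^sub>0 \<theta>\<^sub>0 x R \<longleftrightarrow>
     (\<forall>t\<in>{0..T}. rotation_matrix (R t)) \<and>
     (\<lambda>s t. x t + R t *v \<xi> s t) \<in> space_X1 L T \<and>
     force_torque_balance C\<^sub>\<tau> C\<^sub>\<nu> L T (\<lambda>s t. x t + R t *v \<xi> s t) \<and>
     x 0 = x\<^sub>0 \<and> R 0 = rot \<theta>\<^sub>0"

end

theory Submission
  imports Defs
begin

text \<open>The weighted drag form \<open>w \<mapsto> \<integral> \<langle>w, K w\<rangle>\<close> is positive definite on the fields
  \<open>v + \<omega> J\<xi>\<close>, because \<open>\<xi>(\<cdot>, t)\<close> has unit speed and so is not constant. Hence the grand resistance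
  matrix is invertible and \<open>(v, \<omega>)\<close> is the unique rigid velocity for which
  \<open>v + \<omega> J\<xi> + \<partial>\<^sub>t\<xi>\<close> exerts no force and no torque. It depends on \<open>t\<close> in an \<open>L\<^sup>2\<close> fashion, the inverse
  matrix being continuous, and the equations of motion are solved by two quadratures: first \<open>\<theta>\<close>, then \<open>x\<close>.

  For \<open>\<chi> = x + R \<xi>\<close> one has \<open>\<partial>\<^sub>t\<chi> = R (v + \<omega> J\<xi> + \<partial>\<^sub>t\<xi>)\<close> with \<open>v = R\<^sup>T \<partial>\<^sub>tx\<close> and \<open>\<partial>\<^sub>tR = \<omega> J R\<close>, and
  \<open>K\<close> is conjugated by \<open>R\<close>, so balance is equivalent to the equations of motion. Conversely, a rigid motion
  with \<open>\<chi> \<in> X\<^sub>1\<close> is not known beforehand to be regular in time: \<open>R\<close> and \<open>x\<close> are recovered from the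
  integrals over \<open>s\<close> of \<open>\<chi>\<close>, \<open>\<xi>\<close>, \<open>\<langle>\<chi>, \<xi>\<rangle>\<close>, \<open>\<langle>\<chi>, J\<xi>\<rangle>\<close> and \<open>|\<xi>|\<^sup>2\<close>, all of which are absolutely
  continuous.\<close>

section \<open>Absolute continuity and indefinite integrals\<close>

text \<open>Henstock's lemma bounds the total error of the balls around the points where the difference
  quotients stay away from \<open>f\<close>; disjoint balls carrying most of the measure come from Vitali's theorem.\<close>

lemma negligible_not_differentiable_indefinite_integral:
  fixes f :: "real \<Rightarrow> 'a::euclidean_space"
  assumes f: "f integrable_on {a..b}"
  shows "negligible {x \<in> {a..b}.
    \<not> ((\<lambda>t. integral {a..t} f) has_vector_derivative f x) (at x within {a..b})}"
proof -
  define F where "F = (\<lambda>t. integral {a..t} f)"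
  define bad where "bad c x y \<longleftrightarrow> y \<in> {a..b} \<and> y \<noteq> x \<and> norm (F y - F x - (y - x) *\<^sub>R f x) > c * \<bar>y - x\<bar>" for c x y
  define E where "E c = {x \<in> {a..b}. \<forall>d>0. \<exists>y. bad c x y \<and> \<bar>y - x\<bar> < d}" for c
  have Fdiff: "F y - F x = integral {x..y} f" if "a \<le> x" "x \<le> y" "y \<le> b" for x y
  proof -
    have "f integrable_on {a..y}" using f that integrable_subinterval_real by fastforce
    then show ?thesis unfolding F_def using Henstock_Kurzweil_Integration.integral_combine[OF _ _ \<open>f integrable_on {a..y}\<close>, of x] that by (simp add: algebra_simps)
  qed
  have *: "negligible (E c)" if c: "c > 0" for c
    unfolding negligible_outer_le
  proof (intro allI impI)
    fix e :: real assume e: "e > 0"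
    obtain \<gamma> where \<gamma>: "gauge \<gamma>" and hen: "\<And>p. \<lbrakk>p tagged_partial_division_of (cbox a b); \<gamma> fine p\<rbrakk> \<Longrightarrow>
             sum (\<lambda>(x,k). norm(measure lborel k *\<^sub>R f x - integral k f)) p < c * e / 2"
      by (rule Henstock_lemma[of f a b "c * e / 2"]) (use f c e in auto)
    define K where "K = {(x, y). x \<in> {a..b} \<and> bad c x y \<and> cball x \<bar>y - x\<bar> \<subseteq> \<gamma> x}"
    have cov: "\<exists>i. i \<in> K \<and> x \<in> cball (fst i) \<bar>snd i - fst i\<bar> \<and> \<bar>snd i - fst i\<bar> < d" if xd: "x \<in> E c" "d > 0" for x d
    proof -
      have xb: "x \<in> {a..b}" using xd(1) by (simp add: E_def)
      have "open (\<gamma> x)" "x \<in> \<gamma> x" using \<gamma> by (auto simp: gauge_def)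
      then obtain r where r: "r > 0" "cball x r \<subseteq> \<gamma> x" using open_contains_cball by blast
      moreover have "\<forall>d>0. \<exists>y. bad c x y \<and> \<bar>y - x\<bar> < d" using xd(1) by (simp add: E_def)
      ultimately obtain y where y: "bad c x y" "\<bar>y - x\<bar> < min d r"
        using xd(2) by (meson min_less_iff_conj)
      then have "cball x \<bar>y - x\<bar> \<subseteq> \<gamma> x" using r by force
      then show ?thesis using y xb by (intro exI[of _ "(x,y)"]) (simp add: K_def)
    qed
    have Kpos: "0 < \<bar>snd i - fst i\<bar>" if "i \<in> K" for i using that by (auto simp: K_def bad_def)
    obtain C where C: "countable C" "C \<subseteq> K"
      and disj: "pairwise (\<lambda>i j. disjnt (cball (fst i) \<bar>snd i - fst i\<bar>) (cball (fst j) \<bar>snd j - fst j\<bar>)) C"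
      and neg: "negligible (E c - (\<Union>i \<in> C. cball (fst i) \<bar>snd i - fst i\<bar>))"
      by (rule Vitali_covering_theorem_cballs[of K "\<lambda>i. \<bar>snd i - fst i\<bar>" "E c" fst, OF Kpos cov])
    define I where "I i = {min (fst i) (snd i)..max (fst i) (snd i)}" for i :: "real \<times> real"
    let ?B = "\<lambda>i. cball (fst i) \<bar>snd i - fst i\<bar> :: real set"
    have IB: "I i \<subseteq> ?B i" for i unfolding I_def by (auto simp: dist_real_def min_def max_def split: if_splits)
    have fin: "measure lebesgue (\<Union>i\<in>C0. ?B i) \<le> e" if C0: "C0 \<subseteq> C" "finite C0" for C0
    proof -
      have inj: "inj_on (\<lambda>i. (fst i, I i)) C0"
      proof (rule inj_onI)
        fix i j assume ij: "i \<in> C0" "j \<in> C0" "(fst i, I i) = (fst j, I j)"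
        have "fst i \<in> ?B i" "fst i \<in> ?B j" using ij by auto
        then show "i = j" using disj C0 ij unfolding pairwise_def disjnt_def by blast
      qed
      define p where "p = (\<lambda>i. (fst i, I i)) ` C0"
      have p1: "p tagged_partial_division_of (cbox a b)"
        unfolding tagged_partial_division_of_def
      proof (intro conjI allI impI; (elim conjE)?)
        show "finite p" using C0 by (simp add: p_def)
        fix x k assume "(x, k) \<in> p"
        then obtain i where i: "i \<in> C0" "x = fst i" "k = I i" by (auto simp: p_def)
        then have "i \<in> K" using C0 C by auto
        then show "x \<in> k" "k \<subseteq> cbox a b" "\<exists>a b. k = cbox a b"
          using i by (auto simp: I_def K_def bad_def)
      next
        fix x1 K1 x2 K2 assume "(x1, K1) \<in> p" "(x2, K2) \<in> p" "(x1, K1) \<noteq> (x2, K2)"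
        then obtain i j where ij: "i \<in> C0" "K1 = I i" "j \<in> C0" "K2 = I j" "i \<noteq> j" by (auto simp: p_def)
        then have "disjnt (?B i) (?B j)" using disj C0 unfolding pairwise_def by blast
        then have "K1 \<inter> K2 = {}" using ij IB by (force simp: disjnt_def)
        then show "interior K1 \<inter> interior K2 = {}" using interior_subset by fast
      qed
      have p2: "\<gamma> fine p"
        using IB C0 C by (force simp: fine_def p_def K_def)
      have "(\<Sum>i\<in>C0. c * \<bar>snd i - fst i\<bar>) \<le> (\<Sum>i\<in>C0. norm (measure lborel (I i) *\<^sub>R f (fst i) - integral (I i) f))"
      proof (rule sum_mono)
        fix i assume "i \<in> C0"
        then have iK: "i \<in> K" using C0 C by auto
        obtain x y where xy: "i = (x, y)" by force
        have b: "bad c x y" "x \<in> {a..b}" using iK by (auto simp: K_def xy)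
        show "c * \<bar>snd i - fst i\<bar> \<le> norm (measure lborel (I i) *\<^sub>R f (fst i) - integral (I i) f)"
        proof (cases "x \<le> y")
          case True
          then have "norm (integral {x..y} f - (y - x) *\<^sub>R f x) > c * \<bar>y - x\<bar>"
            using b Fdiff[of x y] by (auto simp: bad_def)
          then show ?thesis using True by (simp add: xy I_def norm_minus_commute)
        next
          case False
          then have "F y - F x - (y - x) *\<^sub>R f x = (x - y) *\<^sub>R f x - integral {y..x} f"
            using b Fdiff[of y x] by (auto simp: bad_def algebra_simps)
          then show ?thesis using False b by (simp add: xy I_def bad_def)
        qed
      qed
      also have "\<dots> = sum (\<lambda>(x,k). norm(measure lborel k *\<^sub>R f x - integral k f)) p"
        unfolding p_def by (subst sum.reindex[OF inj]) (simp add: o_def)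
      also have "\<dots> < c * e / 2" by (rule hen[OF p1 p2])
      finally have "c * (\<Sum>i\<in>C0. \<bar>snd i - fst i\<bar>) < c * (e / 2)" by (simp add: sum_distrib_left)
      then have s: "(\<Sum>i\<in>C0. \<bar>snd i - fst i\<bar>) < e / 2" using c by simp
      have "measure lebesgue (\<Union>i\<in>C0. ?B i) \<le> (\<Sum>i\<in>C0. measure lebesgue (?B i))"
        by (rule measure_UNION_le) (use C0 in auto)
      also have "\<dots> = (\<Sum>i\<in>C0. 2 * \<bar>snd i - fst i\<bar>)"
        by (rule sum.cong) (auto simp: cball_eq_atLeastAtMost)
      also have "\<dots> \<le> e" using s by (simp add: sum_distrib_left[symmetric])
      finally show ?thesis .
    qed
    have U: "(\<Union>i\<in>C. ?B i) \<in> lmeasurable" "measure lebesgue (\<Union>i\<in>C. ?B i) \<le> e"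
      using fmeasurable_UN_bound[of C ?B lebesgue e] measure_UN_bound[of C ?B lebesgue e] C fin by auto
    show "\<exists>T. E c \<subseteq> T \<and> T \<in> lmeasurable \<and> measure lebesgue T \<le> e"
    proof (intro exI conjI)
      let ?N = "E c - (\<Union>i\<in>C. ?B i)" let ?U = "\<Union>i\<in>C. ?B i"
      show "E c \<subseteq> ?U \<union> ?N" by auto
      have N: "?N \<in> lmeasurable" "measure lebesgue ?N = 0"
        using neg negligible_imp_measurable negligible_imp_measure0 by auto
      then show "?U \<union> ?N \<in> lmeasurable" using U by (intro fmeasurable.Un) auto
      have "measure lebesgue (?U \<union> ?N) \<le> measure lebesgue ?U + measure lebesgue ?N"
        using U N by (intro measure_Un_le) auto
      then show "measure lebesgue (?U \<union> ?N) \<le> e" using U N by simp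
    qed
  qed
  have "{x \<in> {a..b}. \<not> (F has_vector_derivative f x) (at x within {a..b})} \<subseteq> (\<Union>n. E (1 / Suc n))"
  proof
    fix x assume x: "x \<in> {x \<in> {a..b}. \<not> (F has_vector_derivative f x) (at x within {a..b})}"
    then have "\<not> (\<forall>e>0. \<exists>d>0. \<forall>y\<in>{a..b}. norm(y - x) < d \<longrightarrow> norm (F y - F x - (y - x) *\<^sub>R f x) \<le> e * norm (y - x))"
      by (simp add: has_vector_derivative_def has_derivative_within_alt bounded_linear_scaleR_left)
    then obtain e where e: "e > 0" and
      ey: "\<And>d. d > 0 \<Longrightarrow> \<exists>y\<in>{a..b}. norm(y - x) < d \<and> norm (F y - F x - (y - x) *\<^sub>R f x) > e * norm (y - x)"
      by (meson not_less)
    obtain n where n: "1 / Suc n < e" using e nat_approx_posE by blast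
    have "x \<in> E (1 / Suc n)"
      unfolding E_def
    proof (intro CollectI conjI allI impI)
      show "x \<in> {a..b}" using x by simp
      fix d :: real assume "d > 0"
      then obtain y where y: "y \<in> {a..b}" "norm(y - x) < d" "norm (F y - F x - (y - x) *\<^sub>R f x) > e * norm (y - x)"
        using ey by blast
      have "y \<noteq> x" using y by auto
      moreover have "(1 / Suc n) * \<bar>y - x\<bar> \<le> e * \<bar>y - x\<bar>" using n by (intro mult_right_mono) auto
      ultimately have "bad (1 / Suc n) x y" using y unfolding bad_def by auto
      then show "\<exists>y. bad (1 / Suc n) x y \<and> \<bar>y - x\<bar> < d" using y by auto
    qed
    then show "x \<in> (\<Union>n. E (1 / Suc n))" by blast
  qed
  moreover have "negligible (\<Union>n. E (1 / Suc n))"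
    by (intro negligible_countable_Union) (auto intro!: *)
  ultimately show ?thesis using negligible_subset unfolding F_def by blast
qed

lemma sum_interval_lengths_eq_measure:
  assumes "\<D> division_of S"
  shows "(\<Sum>I\<in>\<D>. Sup I - Inf I) = measure lebesgue (S::real set)"
proof -
  have "(\<Sum>I\<in>\<D>. Sup I - Inf I) = (\<Sum>I\<in>\<D>. measure lebesgue I)"
  proof (rule sum.cong)
    fix I assume "I \<in> \<D>"
    then obtain c d where "I = cbox c d" "I \<noteq> {}" using division_ofD(3,4)[OF assms] by metis
    then show "Sup I - Inf I = measure lebesgue I" by auto
  qed simp
  also have "\<dots> = measure lebesgue S" using content_division[OF assms] by simp
  finally show ?thesis .
qed

lemma abs_continuous_constant_if_derivative_zero_ae:
  fixes u :: "real \<Rightarrow> 'a::euclidean_space"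
  assumes ac: "abs_continuous a b u" and N: "negligible N"
    and der: "\<And>t. t \<in> {a..b} - N \<Longrightarrow> (u has_vector_derivative 0) (at t within {a..b})"
    and c: "c \<in> {a..b}"
  shows "u c = u a"
proof -
  have "norm (u c - u a) \<le> e" if e: "e > 0" for e
  proof -
    define e1 where "e1 = e / 2 / (1 + (c - a))"
    have e1: "e1 > 0" "e1 * (c - a) \<le> e / 2" using e c
      by (auto simp: e1_def field_simps intro!: divide_pos_pos)
    obtain \<delta> where \<delta>: "\<delta> > 0" and ac': "\<And>\<D> S. \<lbrakk>\<D> division_of S; S \<subseteq> {a..b};
        (\<Sum>I\<in>\<D>. Sup I - Inf I) < \<delta>\<rbrakk> \<Longrightarrow> (\<Sum>I\<in>\<D>. norm (u (Sup I) - u (Inf I))) < e / 2"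
      using ac e unfolding abs_continuous_def by (metis half_gt_zero)
    obtain U where U: "open U" "N \<subseteq> U" "U - N \<in> lmeasurable" "emeasure lebesgue (U - N) < ennreal \<delta>"
      using sets_lebesgue_outer_open[of N \<delta>] N \<delta> negligible_imp_sets by metis
    have mU: "U \<in> lmeasurable" "measure lebesgue U < \<delta>"
    proof -
      have "U = (U - N) \<union> N" using U by auto
      moreover have "(U - N) \<union> N \<in> lmeasurable" using U N negligible_imp_measurable by (intro fmeasurable.Un) auto
      moreover have "measure lebesgue ((U - N) \<union> N) \<le> measure lebesgue (U - N) + measure lebesgue N"
        using U N negligible_imp_measurable by (intro measure_Un_le) auto
      moreover have "measure lebesgue (U - N) < \<delta>"
        using U \<delta> by (simp add: emeasure_eq_measure2 ennreal_less_iff)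
      ultimately show "U \<in> lmeasurable" "measure lebesgue U < \<delta>" using negligible_imp_measure0[OF N] by auto
    qed
    have "\<exists>d>0. \<forall>y\<in>{a..b}. norm (y - t) < d \<longrightarrow> norm (u y - u t) \<le> e1 * norm (y - t)"
      if "t \<in> {a..b} - N" for t
      using der[OF that] e1 by (auto simp: has_vector_derivative_def has_derivative_within_alt)
    then obtain d where d: "\<And>t. t \<in> {a..b} - N \<Longrightarrow> d t > 0"
      "\<And>t y. t \<in> {a..b} - N \<Longrightarrow> y \<in> {a..b} \<Longrightarrow> norm (y - t) < d t \<Longrightarrow> norm (u y - u t) \<le> e1 * norm (y - t)"
      by metis
    define \<gamma> where "\<gamma> t = (if t \<in> N then U else if t \<in> {a..b} then ball t (d t) else UNIV)" for t
    have "gauge \<gamma>" unfolding gauge_def \<gamma>_def using U d by auto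
    then obtain p where p: "p tagged_division_of {a..c}" "\<gamma> fine p" using fine_division_exists_real by blast
    let ?h = "\<lambda>K. u (Sup K) - u (Inf K)"
    define pN where "pN = {(x, K) \<in> p. x \<in> N}"
    note pD = tagged_division_ofD[OF p(1)]
    have pNp: "pN tagged_partial_division_of {a..c}"
      using p unfolding pN_def tagged_division_of_def by (auto intro: tagged_partial_division_subset)
    have A: "(\<Sum>(x,K)\<in>pN. norm (?h K)) \<le> e / 2"
    proof -
      have tg: "pN tagged_division_of (\<Union>(snd ` pN))" by (rule tagged_partial_division_of_Union_self[OF pNp])
      have dv: "snd ` pN division_of \<Union>(snd ` pN)" by (rule division_of_tagged_division[OF tg])
      have sub: "\<Union>(snd ` pN) \<subseteq> U" using p(2) unfolding pN_def fine_def \<gamma>_def by fastforce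
      have sub2: "\<Union>(snd ` pN) \<subseteq> {a..b}" using pNp c by (fastforce dest: tagged_partial_division_ofD)
      have "measure lebesgue (\<Union>(snd ` pN)) \<le> measure lebesgue U"
        by (rule measure_mono_fmeasurable[OF sub _ mU(1)]) (use dv lmeasurable_division in blast)
      then have "(\<Sum>I\<in>snd ` pN. norm (u (Sup I) - u (Inf I))) < e / 2"
        using ac'[OF dv sub2] mU sum_interval_lengths_eq_measure[OF dv] by simp
      moreover have "(\<Sum>(x,K)\<in>pN. norm (?h K)) = (\<Sum>I\<in>snd ` pN. norm (?h I))"
      proof -
        let ?n = "\<lambda>K. if K = {} then 0 else norm (?h K)"
        have "(\<Sum>(x,K)\<in>pN. norm (?h K)) = (\<Sum>(x,K)\<in>pN. ?n K)"
          using tagged_partial_division_ofD(2)[OF pNp] by (intro sum.cong) fastforce+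
        also have "\<dots> = (\<Sum>I\<in>snd ` pN. ?n I)"
          by (rule sum.over_tagged_division_lemma[OF tg]) (auto simp: box_eq_empty)
        also have "\<dots> = (\<Sum>I\<in>snd ` pN. norm (?h I))"
          using tagged_partial_division_ofD(2)[OF pNp] by (intro sum.cong) fastforce+
        finally show ?thesis .
      qed
      ultimately show ?thesis by simp
    qed
    have B: "(\<Sum>(x,K)\<in>p - pN. norm (?h K)) \<le> e / 2"
    proof -
      have "(\<Sum>(x,K)\<in>p - pN. norm (?h K)) \<le> (\<Sum>(x,K)\<in>p - pN. e1 * measure lborel K)"
      proof (rule sum_mono, clarify)
        fix x K assume xK: "(x, K) \<in> p" "(x, K) \<notin> pN"
        obtain l r where K: "K = {l..r}" using pD(4)[OF xK(1)] by auto
        have x: "x \<in> K" "K \<subseteq> {a..c}" "x \<notin> N" using pD xK by (auto simp: pN_def)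
        then have Kb: "K \<subseteq> ball x (d x)" using p(2) xK c unfolding fine_def \<gamma>_def by fastforce
        have "l \<in> K" "r \<in> K" using x K by auto
        then have lb: "l \<in> ball x (d x)" "r \<in> ball x (d x)" using Kb by (blast, blast)
        have lr: "l \<in> {a..b}" "r \<in> {a..b}" "x \<in> {a..b}" "l \<le> x" "x \<le> r"
          using x K c by auto
        have "norm (u r - u l) \<le> norm (u r - u x) + norm (u l - u x)"
          by (metis norm_triangle_ineq4 diff_add_cancel add_diff_eq diff_diff_eq2)
        also have "\<dots> \<le> e1 * norm (r - x) + e1 * norm (l - x)"
          using lr lb x by (intro add_mono d) (auto simp: dist_real_def)
        also have "\<dots> = e1 * measure lborel K" using lr K by (simp add: algebra_simps)
        finally show "norm (?h K) \<le> e1 * measure lborel K" using lr K by simp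
      qed
      also have "\<dots> \<le> (\<Sum>(x,K)\<in>p. e1 * measure lborel K)"
        by (rule sum_mono2) (use pD e1 in auto)
      also have "\<dots> = e1 * (\<Sum>(x,K)\<in>p. measure lborel K)" by (simp add: sum_distrib_left split_def)
      also have "\<dots> = e1 * (c - a)" using additive_content_tagged_division[of p a c] p c by simp
      finally show ?thesis using e1 by simp
    qed
    have "u c - u a = (\<Sum>(x,K)\<in>p. ?h K)" using additive_tagged_division_1[of a c p u] p c by simp
    then have "norm (u c - u a) \<le> (\<Sum>(x,K)\<in>p. norm (?h K))" by (simp add: split_def sum_norm_le)
    also have "\<dots> = (\<Sum>(x,K)\<in>p - pN. norm (?h K)) + (\<Sum>(x,K)\<in>pN. norm (?h K))"
      by (rule sum.subset_diff) (auto simp: pN_def pD)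
    finally show ?thesis using A B by simp
  qed
  then show ?thesis by (metis eq_iff_diff_eq_0 field_le_epsilon add_0 norm_le_zero_iff)
qed

lemma abs_continuous_dominated:
  fixes f :: "real \<Rightarrow> 'a::euclidean_space" and g :: "real \<Rightarrow> 'b::euclidean_space"
    and h :: "real \<Rightarrow> 'c::euclidean_space"
  assumes f: "abs_continuous a b f" and g: "abs_continuous a b g"
    and le: "\<And>s t. s \<in> {a..b} \<Longrightarrow> t \<in> {a..b} \<Longrightarrow>
      norm (h t - h s) \<le> C * (norm (f t - f s) + norm (g t - g s))"
  shows "abs_continuous a b h"
  unfolding abs_continuous_def
proof (intro allI impI)
  fix \<epsilon> :: real assume e: "\<epsilon> > 0"
  define D where "D = \<bar>C\<bar> + 1"
  have D: "D > 0" "C \<le> D" by (auto simp: D_def)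
  have e2: "\<epsilon> / (2 * D) > 0" using e D by simp
  obtain d1 where d1: "d1 > 0" "\<And>\<D> S. \<D> division_of S \<and> S \<subseteq> {a..b} \<and>
     (\<Sum>I\<in>\<D>. Sup I - Inf I) < d1 \<Longrightarrow> (\<Sum>I\<in>\<D>. norm (f (Sup I) - f (Inf I))) < \<epsilon> / (2 * D)"
    using f e2 unfolding abs_continuous_def by meson
  obtain d2 where d2: "d2 > 0" "\<And>\<D> S. \<D> division_of S \<and> S \<subseteq> {a..b} \<and>
     (\<Sum>I\<in>\<D>. Sup I - Inf I) < d2 \<Longrightarrow> (\<Sum>I\<in>\<D>. norm (g (Sup I) - g (Inf I))) < \<epsilon> / (2 * D)"
    using g e2 unfolding abs_continuous_def by meson
  have "(\<Sum>I\<in>\<D>. norm (h (Sup I) - h (Inf I))) < \<epsilon>"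
    if "\<D> division_of S" "S \<subseteq> {a..b}" "(\<Sum>I\<in>\<D>. Sup I - Inf I) < min d1 d2" for \<D> S
  proof -
    have "(\<Sum>I\<in>\<D>. norm (h (Sup I) - h (Inf I)))
        \<le> (\<Sum>I\<in>\<D>. D * (norm (f (Sup I) - f (Inf I)) + norm (g (Sup I) - g (Inf I))))"
    proof (rule sum_mono)
      fix I assume I: "I \<in> \<D>"
      from division_ofD(4)[OF that(1) I] obtain c d where cd: "I = cbox c d" by (elim exE)
      moreover have "I \<noteq> {}" "I \<subseteq> {a..b}" using division_ofD(2,3)[OF that(1) I] that(2) by auto
      ultimately have "Sup I \<in> {a..b}" "Inf I \<in> {a..b}" by auto
      then have "norm (h (Sup I) - h (Inf I)) \<le> C * (norm (f (Sup I) - f (Inf I)) + norm (g (Sup I) - g (Inf I)))"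
        by (intro le) auto
      also have "\<dots> \<le> D * (norm (f (Sup I) - f (Inf I)) + norm (g (Sup I) - g (Inf I)))"
        using D by (intro mult_right_mono) auto
      finally show "norm (h (Sup I) - h (Inf I))
        \<le> D * (norm (f (Sup I) - f (Inf I)) + norm (g (Sup I) - g (Inf I)))" .
    qed
    also have "\<dots> = D * ((\<Sum>I\<in>\<D>. norm (f (Sup I) - f (Inf I))) + (\<Sum>I\<in>\<D>. norm (g (Sup I) - g (Inf I))))"
      by (simp add: sum_distrib_left sum.distrib distrib_left)
    also have "\<dots> < D * (\<epsilon> / (2 * D) + \<epsilon> / (2 * D))"
      using that d1(2)[of \<D> S] d2(2)[of \<D> S] D by (intro mult_strict_left_mono add_strict_mono) auto
    also have "\<dots> = \<epsilon>" using D by (simp add: field_simps)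
    finally show ?thesis .
  qed
  then show "\<exists>\<delta>>0. \<forall>\<D> S. \<D> division_of S \<and> S \<subseteq> {a..b} \<and> (\<Sum>I\<in>\<D>. Sup I - Inf I) < \<delta> \<longrightarrow>
      (\<Sum>I\<in>\<D>. norm (h (Sup I) - h (Inf I))) < \<epsilon>"
    using d1(1) d2(1) by (intro exI[of _ "min d1 d2"]) auto
qed

lemma abs_continuous_imp_continuous_on:
  assumes "abs_continuous a b f"
  shows "continuous_on {a..b} f"
  unfolding continuous_on_iff
proof (intro ballI allI impI)
  fix x e assume x: "x \<in> {a..b}" and "e > (0::real)"
  then obtain d where d: "d > 0" "\<And>\<D> S. \<D> division_of S \<and> S \<subseteq> {a..b} \<and>
     (\<Sum>I\<in>\<D>. Sup I - Inf I) < d \<Longrightarrow> (\<Sum>I\<in>\<D>. norm (f (Sup I) - f (Inf I))) < e"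
    using assms unfolding abs_continuous_def by meson
  have *: "norm (f y - f z) < e" if "z \<le> y" "z \<in> {a..b}" "y \<in> {a..b}" "y - z < d" for y z
  proof -
    have "{{z..y}} division_of {z..y}" using division_of_self[of z y] that by auto
    then show ?thesis using d(2)[of "{{z..y}}" "{z..y}"] that by auto
  qed
  have "dist (f y) (f x) < e" if "y \<in> {a..b}" "dist y x < d" for y
    using *[of x y] *[of y x] that x by (cases "x \<le> y") (auto simp: dist_norm dist_real_def norm_minus_commute)
  then show "\<exists>d>0. \<forall>x'\<in>{a..b}. dist x' x < d \<longrightarrow> dist (f x') (f x) < e"
    using d(1) by blast
qed

lemma abs_continuous_Lipschitz:
  fixes h :: "real \<Rightarrow> 'c::euclidean_space"
  assumes "abs_continuous a b f"
    and "\<And>s t. s \<in> {a..b} \<Longrightarrow> t \<in> {a..b} \<Longrightarrow> norm (h t - h s) \<le> C * norm (f t - f s)"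
  shows "abs_continuous a b h"
proof (rule abs_continuous_dominated[OF assms(1) assms(1), of h "C/2"])
qed (use assms(2) in simp)

lemma abs_continuous_bilinear:
  fixes f :: "real \<Rightarrow> 'a::euclidean_space" and g :: "real \<Rightarrow> 'b::euclidean_space"
    and h :: "'a \<Rightarrow> 'b \<Rightarrow> 'c::euclidean_space"
  assumes h: "bounded_bilinear h" and f: "abs_continuous a b f" and g: "abs_continuous a b g"
  shows "abs_continuous a b (\<lambda>t. h (f t) (g t))"
proof -
  obtain B where B: "B > 0" "\<And>x y. norm (h x y) \<le> norm x * norm y * B"
    using bounded_bilinear.pos_bounded[OF h] by blast
  have "bounded (f ` {a..b})" "bounded (g ` {a..b})"
    using abs_continuous_imp_continuous_on[OF f] abs_continuous_imp_continuous_on[OF g]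
    by (auto intro!: compact_imp_bounded compact_continuous_image)
  then obtain C D where C: "C > 0" "\<And>t. t \<in> {a..b} \<Longrightarrow> norm (f t) \<le> C"
    and D: "D > 0" "\<And>t. t \<in> {a..b} \<Longrightarrow> norm (g t) \<le> D"
    unfolding bounded_pos by auto
  show ?thesis
  proof (rule abs_continuous_dominated[OF f g, of _ "B * (C + D)"])
    fix s t assume st: "s \<in> {a..b}" "t \<in> {a..b}"
    have "h (f t) (g t) - h (f s) (g s) = h (f t - f s) (g t) + h (f s) (g t - g s)"
      by (simp add: bounded_bilinear.diff_left[OF h] bounded_bilinear.diff_right[OF h])
    also have "norm \<dots> \<le> norm (f t - f s) * norm (g t) * B + norm (f s) * norm (g t - g s) * B"
      by (rule norm_triangle_le) (intro add_mono B)
    also have "\<dots> \<le> norm (f t - f s) * D * B + C * norm (g t - g s) * B"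
      using C D B st by (intro add_mono mult_right_mono mult_left_mono) auto
    also have "\<dots> \<le> B * (C + D) * (norm (f t - f s) + norm (g t - g s))"
    proof -
      have "0 \<le> norm (f t - f s) * C * B + D * norm (g t - g s) * B" using B C D by simp
      then show ?thesis by (simp add: algebra_simps)
    qed
    finally show "norm (h (f t) (g t) - h (f s) (g s)) \<le> B * (C + D) * (norm (f t - f s) + norm (g t - g s))" .
  qed
qed

lemma abs_continuous_Pair:
  assumes "abs_continuous a b f" "abs_continuous a b g"
  shows "abs_continuous a b (\<lambda>t. (f t, g t))"
  by (rule abs_continuous_dominated[OF assms, of _ 1]) (simp add: norm_Pair_le)

lemma abs_continuous_add:
  assumes "abs_continuous a b f" "abs_continuous a b g"
  shows "abs_continuous a b (\<lambda>t. f t + g t)"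
  by (rule abs_continuous_dominated[OF assms, of _ 1]) (simp add: add_diff_add norm_triangle_ineq)

lemma abs_continuous_diff:
  assumes "abs_continuous a b f" "abs_continuous a b g"
  shows "abs_continuous a b (\<lambda>t. f t - g t)"
proof (rule abs_continuous_dominated[OF assms, of _ 1])
  fix s t
  have "(f t - g t) - (f s - g s) = (f t - f s) - (g t - g s)" by simp
  then show "norm ((f t - g t) - (f s - g s)) \<le> 1 * (norm (f t - f s) + norm (g t - g s))"
    using norm_triangle_ineq4[of "f t - f s" "g t - g s"] by (simp only: mult_1)
qed

lemma abs_continuous_inverse:
  fixes f :: "real \<Rightarrow> real"
  assumes f: "abs_continuous a b f" and nz: "\<And>t. t \<in> {a..b} \<Longrightarrow> f t \<noteq> 0"
  shows "abs_continuous a b (\<lambda>t. inverse (f t))"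
proof -
  have "continuous_on {a..b} (\<lambda>t. inverse (f t))"
    using abs_continuous_imp_continuous_on[OF f] nz by (intro continuous_intros) auto
  then have "bounded ((\<lambda>t. inverse (f t)) ` {a..b})"
    by (auto intro!: compact_imp_bounded compact_continuous_image)
  then obtain C where C: "C > 0" "\<And>t. t \<in> {a..b} \<Longrightarrow> norm (inverse (f t)) \<le> C"
    unfolding bounded_pos by auto
  show ?thesis
  proof (rule abs_continuous_Lipschitz[OF f, of _ "C * C"])
    fix s t assume st: "s \<in> {a..b}" "t \<in> {a..b}"
    have "norm (inverse (f t) - inverse (f s)) = norm (inverse (f t)) * norm (inverse (f s)) * norm (f t - f s)"
      using st nz by (simp add: inverse_diff_inverse norm_mult abs_mult)
    also have "\<dots> \<le> C * C * norm (f t - f s)"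
      using C st by (intro mult_right_mono mult_mono) auto
    finally show "norm (inverse (f t) - inverse (f s)) \<le> C * C * norm (f t - f s)" .
  qed
qed

lemma abs_continuous_indefinite_integral:
  fixes g :: "real \<Rightarrow> 'a::euclidean_space"
  assumes g: "g absolutely_integrable_on {a..b}"
  shows "abs_continuous a b (\<lambda>t. integral {a..t} g)"
  unfolding abs_continuous_def
proof (intro allI impI)
  fix \<epsilon> :: real assume e: "\<epsilon> > 0"
  define m where "m n t = min (norm (g t)) (real n)" for n t
  have ng: "(\<lambda>t. norm (g t)) absolutely_integrable_on {a..b}" using absolutely_integrable_norm[OF g] by (simp add: o_def)
  have m: "m n absolutely_integrable_on {a..b}" for n
    unfolding m_def by (intro absolutely_integrable_min_1 ng) auto
  have "(\<lambda>n. integral {a..b} (m n)) \<longlonglongrightarrow> integral {a..b} (\<lambda>t. norm (g t))"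
  proof (rule dominated_convergence(2)[where h="\<lambda>t. norm (g t)"])
    show "m n integrable_on {a..b}" for n using m set_lebesgue_integral_eq_integral(1) by blast
    show "(\<lambda>t. norm (g t)) integrable_on {a..b}" using ng set_lebesgue_integral_eq_integral(1) by blast
    fix t
    show "(\<lambda>n. m n t) \<longlonglongrightarrow> norm (g t)"
    proof (rule tendsto_eventually)
      obtain N where "norm (g t) \<le> real N" using real_arch_simple by blast
      then show "\<forall>\<^sub>F n in sequentially. m n t = norm (g t)"
        unfolding eventually_sequentially m_def by (intro exI[of _ N]) (auto simp: min_def)
    qed
  qed (auto simp: m_def)
  then have "\<forall>\<^sub>F n in sequentially. dist (integral {a..b} (m n)) (integral {a..b} (\<lambda>t. norm (g t))) < \<epsilon> / 2"
    by (rule tendstoD) (use e in auto)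
  then obtain n where n: "dist (integral {a..b} (m n)) (integral {a..b} (\<lambda>t. norm (g t))) < \<epsilon> / 2"
    by (auto simp: eventually_sequentially)
  define k where "k t = norm (g t) - m n t" for t
  have k: "k absolutely_integrable_on {a..b}" unfolding k_def by (intro set_integral_diff ng m)
  have k0: "k t \<ge> 0" for t by (simp add: k_def m_def)
  have kint: "integral {a..b} k < \<epsilon> / 2"
  proof -
    have "integral {a..b} k = integral {a..b} (\<lambda>t. norm (g t)) - integral {a..b} (m n)"
      unfolding k_def using ng m by (intro integral_diff set_lebesgue_integral_eq_integral(1))
    then show ?thesis using n unfolding dist_real_def by linarith
  qed
  define d where "d = \<epsilon> / (2 * (real n + 1))"
  have d: "d > 0" "real n * d \<le> \<epsilon> / 2" using e by (auto simp: d_def field_simps)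
  have "(\<Sum>I\<in>\<D>. norm (integral {a..Sup I} g - integral {a..Inf I} g)) < \<epsilon>"
    if D: "\<D> division_of S" "S \<subseteq> {a..b}" and sm: "(\<Sum>I\<in>\<D>. Sup I - Inf I) < d" for \<D> S
  proof -
    have sub: "I \<subseteq> {a..b}" if "I \<in> \<D>" for I using division_ofD(2)[OF D(1) that] D(2) by auto
    have ab: "\<exists>c d. I = {c..d} \<and> c \<le> d" if "I \<in> \<D>" for I
      using division_ofD(3,4)[OF D(1) that] by fastforce
    have kI: "k integrable_on I" and gI: "g absolutely_integrable_on I" if "I \<in> \<D>" for I
    proof -
      from ab[OF that] obtain c d where I: "I = {c..d}" by blast
      have "k integrable_on {a..b}" using k set_lebesgue_integral_eq_integral(1) by blast
      then show "k integrable_on I" using integrable_on_subinterval[of k "{a..b}" c d] sub[OF that] I by auto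
      show "g absolutely_integrable_on I" using absolutely_integrable_on_subinterval[OF g, of c d] sub[OF that] I by auto
    qed
    have kS: "k integrable_on S" using integrable_combine_division[OF D(1) kI] .
    have "(\<Sum>I\<in>\<D>. norm (integral {a..Sup I} g - integral {a..Inf I} g)) \<le> (\<Sum>I\<in>\<D>. integral I k + n * (Sup I - Inf I))"
    proof (rule sum_mono)
      fix I assume I: "I \<in> \<D>"
      obtain c d where cd: "I = {c..d}" "c \<le> d" using ab[OF I] by blast
      have ac: "a \<le> c" "d \<le> b" using sub[OF I] cd by auto
      have "g integrable_on {a..b}" using g set_lebesgue_integral_eq_integral(1) by blast
      then have gi: "g integrable_on {a..d}" using integrable_on_subinterval[of g "{a..b}" a d] ac by auto
      have "integral {a..Sup I} g - integral {a..Inf I} g = integral I g"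
        using Henstock_Kurzweil_Integration.integral_combine[OF _ _ gi, of c] cd ac by (simp add: algebra_simps)
      moreover have "norm (integral I g) \<le> integral I (\<lambda>t. k t + n)"
      proof (rule integral_norm_bound_integral)
        show "g integrable_on I" using gI[OF I] set_lebesgue_integral_eq_integral(1) by blast
        show "(\<lambda>t. k t + real n) integrable_on I" using kI[OF I] cd by (intro integrable_add) auto
      qed (auto simp: k_def m_def)
      moreover have "integral I (\<lambda>t. k t + n) = integral I k + n * (Sup I - Inf I)"
        using kI[OF I] cd by (subst integral_add) (auto simp: algebra_simps)
      ultimately show "norm (integral {a..Sup I} g - integral {a..Inf I} g) \<le> integral I k + n * (Sup I - Inf I)"
        by simp
    qed
    also have "\<dots> = integral S k + n * (\<Sum>I\<in>\<D>. Sup I - Inf I)"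
      using integral_combine_division_topdown[OF kS D(1)] by (simp add: sum.distrib sum_distrib_left)
    also have "\<dots> \<le> integral {a..b} k + n * d"
      using sm k0 kS k D(2) by (intro add_mono integral_subset_le mult_left_mono)
        (auto dest: set_lebesgue_integral_eq_integral(1))
    finally show ?thesis using kint d by simp
  qed
  then show "\<exists>\<delta>>0. \<forall>\<D> S. \<D> division_of S \<and> S \<subseteq> {a..b} \<and> (\<Sum>I\<in>\<D>. Sup I - Inf I) < \<delta> \<longrightarrow>
      (\<Sum>I\<in>\<D>. norm (integral {a..Sup I} g - integral {a..Inf I} g)) < \<epsilon>"
    using d(1) by blast
qed

lemma abs_continuous_const: "abs_continuous a b (\<lambda>t. c)"
  unfolding abs_continuous_def using zero_less_one by force

lemma indefinite_integral_if_abs_continuous: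
  fixes u :: "real \<Rightarrow> 'a::euclidean_space"
  assumes u: "abs_continuous a b u" and g: "g absolutely_integrable_on {a..b}"
    and N: "negligible N"
    and der: "\<And>t. t \<in> {a..b} - N \<Longrightarrow> (u has_vector_derivative g t) (at t within {a..b})"
    and t: "t \<in> {a..b}"
  shows "u t = u a + integral {a..t} g"
proof -
  have gi: "g integrable_on {a..b}" using g set_lebesgue_integral_eq_integral(1) by blast
  let ?N = "N \<union> {x \<in> {a..b}. \<not> ((\<lambda>t. integral {a..t} g) has_vector_derivative g x) (at x within {a..b})}"
  have "u t - integral {a..t} g = u a - integral {a..a} g"
  proof (rule abs_continuous_constant_if_derivative_zero_ae[OF _ _ _ t, where N="?N"])
    show "abs_continuous a b (\<lambda>t. u t - integral {a..t} g)"
      by (intro abs_continuous_diff u abs_continuous_indefinite_integral g)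
    show "negligible ?N" using N negligible_not_differentiable_indefinite_integral[OF gi] by (rule negligible_Un)
    fix x assume "x \<in> {a..b} - ?N"
    then show "((\<lambda>t. u t - integral {a..t} g) has_vector_derivative 0) (at x within {a..b})"
      using has_vector_derivative_diff[OF der[of x], of "\<lambda>t. integral {a..t} g" "g x"] by auto
  qed
  then show ?thesis by (simp add: algebra_simps)
qed

lemma AE_lebesgue_on_iff_negligible:
  assumes "S \<in> sets lebesgue"
  shows "(AE x in lebesgue_on S. P x) \<longleftrightarrow> negligible {x \<in> S. \<not> P x}"
proof -
  have "(AE x in lebesgue_on S. P x) \<longleftrightarrow> (AE x in lebesgue. x \<in> S \<longrightarrow> P x)"
    using assms by (intro AE_restrict_space_iff) auto
  also have "\<dots> \<longleftrightarrow> negligible {x \<in> S. \<not> P x}"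
    unfolding eventually_ae_filter_negligible by (auto intro: negligible_subset)
  finally show ?thesis .
qed

lemma abs_continuous_if_indefinite_integral:
  fixes g :: "real \<Rightarrow> 'a::euclidean_space"
  assumes g: "g absolutely_integrable_on {a..b}"
    and u: "\<And>t. t \<in> {a..b} \<Longrightarrow> u t = u a + integral {a..t} g"
  shows "abs_continuous a b u"
proof -
  have ac: "abs_continuous a b (\<lambda>t. u a + integral {a..t} g)"
    by (intro abs_continuous_add abs_continuous_const abs_continuous_indefinite_integral g)
  show ?thesis
    by (rule abs_continuous_Lipschitz[OF ac, of _ 1]) (simp add: u[symmetric])
qed

lemma AE_derivative_if_indefinite_integral:
  fixes g :: "real \<Rightarrow> 'a::euclidean_space"
  assumes g: "g absolutely_integrable_on {a..b}"
    and u: "\<And>t. t \<in> {a..b} \<Longrightarrow> u t = u a + integral {a..t} g"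
  shows "AE t in lebesgue_on {a..b}. (u has_vector_derivative g t) (at t within {a..b})"
proof -
  have gi: "g integrable_on {a..b}" using g set_lebesgue_integral_eq_integral(1) by blast
  have "(u has_vector_derivative g t) (at t within {a..b})" if t: "t \<in> {a..b}"
    and d: "((\<lambda>t. integral {a..t} g) has_vector_derivative g t) (at t within {a..b})" for t
  proof -
    from has_vector_derivative_add[OF has_vector_derivative_const[of "u a"] d]
    have "((\<lambda>t. u a + integral {a..t} g) has_vector_derivative g t) (at t within {a..b})" by simp
    then show ?thesis
      by (rule has_vector_derivative_transform[OF t u, rotated]) simp
  qed
  then have "{t \<in> {a..b}. \<not> (u has_vector_derivative g t) (at t within {a..b})} \<subseteq>
      {t \<in> {a..b}. \<not> ((\<lambda>t. integral {a..t} g) has_vector_derivative g t) (at t within {a..b})}"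
    by blast
  then show ?thesis
    using negligible_subset[OF negligible_not_differentiable_indefinite_integral[OF gi]]
    by (subst AE_lebesgue_on_iff_negligible) auto
qed

lemma indefinite_integral_if_AE_derivative:
  fixes u :: "real \<Rightarrow> 'a::euclidean_space"
  assumes u: "abs_continuous a b u" and g: "g absolutely_integrable_on {a..b}"
    and der: "AE t in lebesgue_on {a..b}. (u has_vector_derivative g t) (at t within {a..b})"
    and t: "t \<in> {a..b}"
  shows "u t = u a + integral {a..t} g"
proof (rule indefinite_integral_if_abs_continuous[OF u g _ _ t])
  show "negligible {t \<in> {a..b}. \<not> (u has_vector_derivative g t) (at t within {a..b})}"
    using der by (subst (asm) AE_lebesgue_on_iff_negligible) auto
qed blast

lemma test_functionD:
  assumes "test_function a b \<phi>"
  shows "(\<phi> has_real_derivative deriv \<phi> x) (at x)" "continuous_on S \<phi>" "continuous_on S (deriv \<phi>)"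
    and "x \<notin> {a<..<b} \<Longrightarrow> \<phi> x = 0"
proof -
  have d: "(deriv ^^ n) \<phi> differentiable at x" for n x
    using assms by (simp add: test_function_def)
  show "(\<phi> has_real_derivative deriv \<phi> x) (at x)"
    using d[of 0 x] by (simp add: DERIV_deriv_iff_real_differentiable)
  have "continuous_on UNIV \<phi>" "continuous_on UNIV (deriv \<phi>)"
    using d[of 0] d[of 1]
    by (auto simp: continuous_on_eq_continuous_within intro!: differentiable_imp_continuous_within)
  then show "continuous_on S \<phi>" "continuous_on S (deriv \<phi>)"
    using continuous_on_subset by blast+
  show "\<phi> x = 0" if "x \<notin> {a<..<b}"
    using assms that closure_subset[of "{x. \<phi> x \<noteq> 0}"] unfolding test_function_def by blast
qed

lemma absolutely_integrable_continuous_scaleR: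
  fixes g :: "real \<Rightarrow> 'a::euclidean_space"
  assumes "continuous_on {a..b} \<phi>" "g absolutely_integrable_on {a..b}"
  shows "(\<lambda>t. \<phi> t *\<^sub>R g t) absolutely_integrable_on {a..b}"
proof (rule absolutely_integrable_bounded_measurable_product[where h="(*\<^sub>R)", OF _ _ _ _ assms(2)])
  show "bilinear ((*\<^sub>R) :: real \<Rightarrow> 'a \<Rightarrow> 'a)"
    using bilinear_conv_bounded_bilinear bounded_bilinear_scaleR by blast
  show "\<phi> \<in> borel_measurable (lebesgue_on {a..b})"
    by (simp add: assms(1) continuous_imp_measurable_on_sets_lebesgue)
  show "bounded (\<phi> ` {a..b})"
    using assms(1) by (intro compact_imp_bounded compact_continuous_image) auto
qed auto

lemma LINT_eq_integral:
  fixes f :: "real \<Rightarrow> 'a::euclidean_space"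
  assumes "f absolutely_integrable_on {a..b}"
  shows "(LINT t|lebesgue_on {a..b}. f t) = integral {a..b} f"
  by (intro lebesgue_integral_eq_integral absolutely_integrable_imp_integrable assms) auto

lemma has_weak_derivative_indefinite_integral:
  fixes g :: "real \<Rightarrow> 'a::euclidean_space"
  assumes g: "g absolutely_integrable_on {a..b}"
    and u: "\<And>t. t \<in> {a..b} \<Longrightarrow> u t = u a + integral {a..t} g"
  shows "has_weak_derivative a b u g"
  unfolding has_weak_derivative_def
proof (intro allI impI)
  fix \<phi> assume \<phi>: "test_function a b \<phi>"
  show "(LINT x|lebesgue_on {a..b}. deriv \<phi> x *\<^sub>R u x) = - (LINT x|lebesgue_on {a..b}. \<phi> x *\<^sub>R g x)"
  proof (cases "a \<le> b")
    case True
    let ?N = "{t \<in> {a..b}. \<not> (u has_vector_derivative g t) (at t within {a..b})}"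
    have N: "negligible ?N"
      by (rule AE_lebesgue_on_iff_negligible[THEN iffD1]) (simp, rule AE_derivative_if_indefinite_integral[OF g u])
    have acu: "abs_continuous a b u" by (rule abs_continuous_if_indefinite_integral[OF g u])
    have cu: "continuous_on {a..b} u" by (rule abs_continuous_imp_continuous_on[OF acu])
    have d\<phi>: "deriv \<phi> absolutely_integrable_on {a..b}"
      by (intro absolutely_integrable_continuous_real test_functionD[OF \<phi>])
    have \<phi>t: "\<phi> t = \<phi> a + integral {a..t} (deriv \<phi>)" if "t \<in> {a..b}" for t
    proof -
      have "(deriv \<phi> has_integral \<phi> t - \<phi> a) {a..t}"
        using that test_functionD(1)[OF \<phi>, unfolded has_real_derivative_iff_has_vector_derivative]
        by (intro fundamental_theorem_of_calculus) (auto intro: has_vector_derivative_at_within)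
      then show ?thesis by (simp add: integral_unique)
    qed
    have ac\<phi>: "abs_continuous a b \<phi>" by (rule abs_continuous_if_indefinite_integral[OF d\<phi> \<phi>t])
    have i1: "(\<lambda>t. deriv \<phi> t *\<^sub>R u t) absolutely_integrable_on {a..b}"
      by (intro absolutely_integrable_continuous_real continuous_on_scaleR test_functionD[OF \<phi>] cu)
    have i2: "(\<lambda>t. \<phi> t *\<^sub>R g t) absolutely_integrable_on {a..b}"
      by (intro absolutely_integrable_continuous_scaleR test_functionD[OF \<phi>] g)
    have "\<phi> b *\<^sub>R u b = \<phi> a *\<^sub>R u a + integral {a..b} (\<lambda>t. deriv \<phi> t *\<^sub>R u t + \<phi> t *\<^sub>R g t)"
    proof (rule indefinite_integral_if_abs_continuous[where u="\<lambda>t. \<phi> t *\<^sub>R u t", OF _ _ N])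
      show "abs_continuous a b (\<lambda>t. \<phi> t *\<^sub>R u t)"
        by (rule abs_continuous_bilinear[OF bounded_bilinear_scaleR ac\<phi> acu])
      show "(\<lambda>t. deriv \<phi> t *\<^sub>R u t + \<phi> t *\<^sub>R g t) absolutely_integrable_on {a..b}"
        by (intro set_integral_add i1 i2)
      fix t assume t: "t \<in> {a..b} - ?N"
      then have "(u has_vector_derivative g t) (at t within {a..b})" by blast
      from has_vector_derivative_scaleR[OF DERIV_subset[OF test_functionD(1)[OF \<phi>, of t]] this]
      show "((\<lambda>t. \<phi> t *\<^sub>R u t) has_vector_derivative deriv \<phi> t *\<^sub>R u t + \<phi> t *\<^sub>R g t) (at t within {a..b})"
        by (simp add: add.commute)
    qed (use True in auto)
    moreover have "\<phi> a = 0" "\<phi> b = 0" using test_functionD(4)[OF \<phi>] by auto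
    moreover have "integral {a..b} (\<lambda>t. deriv \<phi> t *\<^sub>R u t + \<phi> t *\<^sub>R g t)
      = integral {a..b} (\<lambda>t. deriv \<phi> t *\<^sub>R u t) + integral {a..b} (\<lambda>t. \<phi> t *\<^sub>R g t)"
      using i1 i2 by (intro integral_add set_lebesgue_integral_eq_integral(1))
    ultimately have "integral {a..b} (\<lambda>t. deriv \<phi> t *\<^sub>R u t) + integral {a..b} (\<lambda>t. \<phi> t *\<^sub>R g t) = 0"
      by simp
    then show ?thesis
      unfolding LINT_eq_integral[OF i1] LINT_eq_integral[OF i2] by (simp only: eq_neg_iff_add_eq_0)
  next
    case False
    then have "{a..b} = {}" by simp
    then show ?thesis by simp
  qed
qed

section \<open>Smooth steps as test functions\<close>

definition smooth :: "(real \<Rightarrow> real) \<Rightarrow> bool" where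
  "smooth f \<longleftrightarrow> (\<forall>n x. (deriv ^^ n) f differentiable at x)"

lemma smooth_coinduct:
  assumes "f \<in> S" and S: "\<And>f. f \<in> S \<Longrightarrow> \<exists>g\<in>S. \<forall>x. (f has_real_derivative g x) (at x)"
  shows "smooth f"
  unfolding smooth_def
proof (intro allI)
  have *: "(deriv ^^ n) f \<in> S" for n
  proof (induction n)
    case (Suc n)
    from S[OF this] obtain g where g: "g \<in> S" "\<forall>x. ((deriv ^^ n) f has_real_derivative g x) (at x)" by blast
    then have "deriv ((deriv ^^ n) f) = g" using DERIV_imp_deriv by blast
    then show ?case using g by simp
  qed (simp add: assms)
  fix n x
  from S[OF *[of n]] show "(deriv ^^ n) f differentiable at x"
    using real_differentiable_def by blast
qed

lemma smooth_deriv: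
  assumes "smooth f" shows "(f has_real_derivative deriv f x) (at x)" "smooth (deriv f)"
proof -
  show "(f has_real_derivative deriv f x) (at x)"
    using assms[unfolded smooth_def, rule_format, of 0 x] by (simp add: DERIV_deriv_iff_real_differentiable)
  show "smooth (deriv f)"
    using assms unfolding smooth_def by (metis funpow_Suc_right o_apply)
qed

lemma smooth_antiderivative:
  assumes "smooth f" "\<And>x. (F has_real_derivative f x) (at x)"
  shows "smooth F"
proof (rule smooth_coinduct)
  show "F \<in> insert F (Collect smooth)" by simp
  fix h assume "h \<in> insert F (Collect smooth)"
  then show "\<exists>g\<in>insert F (Collect smooth). \<forall>x. (h has_real_derivative g x) (at x)"
    using assms smooth_deriv[of h] by (cases "h = F") (blast, force)
qed

lemma smooth_affine_combination:
  assumes "smooth f" "smooth g"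
  shows "smooth (\<lambda>x. c * f (k * x + d) + c' * g (k' * x + d'))"
proof (rule smooth_coinduct)
  let ?S = "{\<lambda>x. c * f (k * x + d) + c' * g (k' * x + d') | c c' f g. smooth f \<and> smooth g}"
  show "(\<lambda>x. c * f (k * x + d) + c' * g (k' * x + d')) \<in> ?S" using assms by blast
  fix h assume "h \<in> ?S"
  then obtain c c' f g where h: "h = (\<lambda>x. c * f (k * x + d) + c' * g (k' * x + d'))" "smooth f" "smooth g" by blast
  have "(h has_real_derivative (c * k) * deriv f (k * x + d) + (c' * k') * deriv g (k' * x + d')) (at x)" for x
    unfolding h(1)
    by (rule derivative_eq_intros DERIV_chain2[OF smooth_deriv(1)] h(2,3) refl | simp)+
  moreover have "(\<lambda>x. (c * k) * deriv f (k * x + d) + (c' * k') * deriv g (k' * x + d')) \<in> ?S"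
    using smooth_deriv(2) h by blast
  ultimately show "\<exists>g\<in>?S. \<forall>x. (h has_real_derivative g x) (at x)" by (intro bexI allI)
qed

text \<open>The exponential bump on \<open>[0, 1]\<close> alone is not closed under differentiation; with these polynomial and
  polar factors it is, which makes smoothness a coinduction.\<close>

definition bump_term :: "real poly \<Rightarrow> nat \<Rightarrow> real \<Rightarrow> real" where
  "bump_term p k t = (if 0 < t \<and> t < 1 then poly p t / (t * (1 - t)) ^ k * exp (- 1 / (t * (1 - t))) else 0)"

lemma exp_minus_inverse_le:
  assumes "w > (0::real)"
  shows "exp (- 1 / w) \<le> fact m * w ^ m"
proof -
  let ?x = "1 / w"
  have "(\<Sum>n\<in>{m}. ?x ^ n /\<^sub>R fact n) \<le> (\<Sum>n. ?x ^ n /\<^sub>R fact n)"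
    by (rule sum_le_suminf) (use assms summable_exp_generic[of ?x] in auto)
  then have "?x ^ m / fact m \<le> exp ?x"
    by (simp add: exp_def divide_inverse mult.commute)
  then have "inverse (exp ?x) \<le> inverse (?x ^ m / fact m)"
    using assms by (intro le_imp_inverse_le) auto
  then show ?thesis by (simp add: exp_minus power_one_over field_simps)
qed

lemma bump_term_bound:
  obtains C where "\<And>t. \<bar>bump_term p k t\<bar> \<le> C * t\<^sup>2" "\<And>t. \<bar>bump_term p k t\<bar> \<le> C * (1 - t)\<^sup>2" "C \<ge> 0"
proof -
  have "bounded (poly p ` {0..1})"
    by (intro compact_imp_bounded compact_continuous_image continuous_intros) auto
  then obtain B where B: "B > 0" "\<And>t. t \<in> {0..1} \<Longrightarrow> \<bar>poly p t\<bar> \<le> B"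
    unfolding bounded_pos by auto
  define C where "C = B * fact (k + 2)"
  have C: "C \<ge> 0" using B by (simp add: C_def)
  have main: "\<bar>bump_term p k t\<bar> \<le> C * (t * (1 - t))\<^sup>2" for t
  proof (cases "0 < t \<and> t < 1")
    case True
    let ?w = "t * (1 - t)"
    have w: "?w > 0" using True by simp
    have "\<bar>bump_term p k t\<bar> = \<bar>poly p t\<bar> * (exp (- 1 / ?w) / ?w ^ k)"
      using True w by (simp add: bump_term_def abs_mult)
    also have "\<dots> \<le> B * (fact (k + 2) * ?w ^ (k + 2) / ?w ^ k)"
      using True w B exp_minus_inverse_le[OF w, of "k + 2"] by (intro mult_mono divide_right_mono) auto
    also have "\<dots> = C * ?w\<^sup>2"
      using w by (simp add: C_def power_add power2_eq_square mult.assoc)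
    finally show ?thesis .
  next
    case False
    then have "bump_term p k t = 0" by (auto simp: bump_term_def)
    then show ?thesis using C by simp
  qed
  have "\<bar>bump_term p k t\<bar> \<le> C * t\<^sup>2 \<and> \<bar>bump_term p k t\<bar> \<le> C * (1 - t)\<^sup>2" for t
  proof (cases "0 < t \<and> t < 1")
    case True
    have "t\<^sup>2 * (1 - t)\<^sup>2 \<le> t\<^sup>2 * 1" "t\<^sup>2 * (1 - t)\<^sup>2 \<le> 1 * (1 - t)\<^sup>2"
      using True by (intro mult_left_mono mult_right_mono; simp add: power_le_one)+
    then have "C * (t * (1 - t))\<^sup>2 \<le> C * t\<^sup>2" "C * (t * (1 - t))\<^sup>2 \<le> C * (1 - t)\<^sup>2"
      using C by (auto simp: power_mult_distrib intro!: mult_left_mono)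
    then show ?thesis using main[of t] by linarith
  next
    case False
    then have "bump_term p k t = 0" by (auto simp: bump_term_def)
    then show ?thesis using C by simp
  qed
  then show ?thesis using that C by blast
qed

lemma quadratic_bound_imp_derivative_zero:
  fixes f :: "real \<Rightarrow> real"
  assumes "\<And>t. \<bar>f t\<bar> \<le> C * (t - x)\<^sup>2"
  shows "(f has_real_derivative 0) (at x)"
proof -
  have fx: "f x = 0" using assms[of x] by simp
  have "((\<lambda>y. (f y - f x) / (y - x)) \<longlongrightarrow> 0) (at x)"
  proof (rule Lim_null_comparison)
    show "\<forall>\<^sub>F y in at x. norm ((f y - f x) / (y - x)) \<le> C * \<bar>y - x\<bar>"
    proof (rule eventually_mono[OF eventually_neq_at_within[of x]])
      fix y assume "y \<noteq> x"
      then show "norm ((f y - f x) / (y - x)) \<le> C * \<bar>y - x\<bar>"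
        using assms[of y] by (simp add: fx divide_le_eq power2_eq_square abs_mult[symmetric] mult.assoc)
    qed
    have "((\<lambda>y. C * \<bar>y - x\<bar>) \<longlongrightarrow> C * \<bar>x - x\<bar>) (at x)" by (intro tendsto_intros)
    then show "((\<lambda>y. C * \<bar>y - x\<bar>) \<longlongrightarrow> 0) (at x)" by simp
  qed
  then show ?thesis by (simp add: has_field_derivative_iff)
qed

lemma bump_term_deriv:
  "\<exists>q. \<forall>t. (bump_term p k has_real_derivative bump_term q (k + 2) t) (at t)"
proof -
  let ?w = "[:0, 1, -1:] :: real poly" let ?w' = "[:1, -2:] :: real poly"
  define q where "q = pderiv p * ?w\<^sup>2 - smult (real k) (p * ?w * ?w') + p * ?w'"
  have qt: "poly q t = poly (pderiv p) t * (t * (1 - t))\<^sup>2 - real k * (poly p t * (t * (1 - t)) * (1 - 2 * t)) + poly p t * (1 - 2 * t)" for t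
  proof -
    have 1: "poly ?w t = t * (1 - t)" by (simp add: algebra_simps)
    have 2: "poly ?w' t = 1 - 2 * t" by simp
    show ?thesis unfolding q_def poly_add poly_diff poly_mult poly_smult poly_power 1 2 by (simp add: mult.assoc)
  qed
  obtain C where C: "\<And>t. \<bar>bump_term p k t\<bar> \<le> C * t\<^sup>2" "\<And>t. \<bar>bump_term p k t\<bar> \<le> C * (1 - t)\<^sup>2"
    using bump_term_bound by metis
  have "(bump_term p k has_real_derivative bump_term q (k + 2) t) (at t)" for t
  proof -
    consider "0 < t" "t < 1" | "t < 0" | "t > 1" | "t = 0" | "t = 1" by linarith
    then show ?thesis
    proof cases
      case 1
      let ?W = "\<lambda>t. t * (1 - t)"
      have w: "?W t > 0" using 1 by simp
      have dW: "(?W has_real_derivative (1 - 2 * t)) (at t)"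
        by (auto intro!: derivative_eq_intros)
      have dpk: "((\<lambda>t. inverse (?W t) ^ k) has_real_derivative
          real k * inverse (?W t) ^ (k - 1) * (- ((1 - 2 * t) * inverse ((?W t)\<^sup>2)))) (at t)"
        by (rule DERIV_cong[OF DERIV_power[OF DERIV_inverse_fun[OF dW]]])
          (use w 1 in \<open>simp_all add: power2_eq_square mult.assoc mult.left_commute\<close>)
      have de: "((\<lambda>t. exp (- inverse (?W t))) has_real_derivative exp (- inverse (?W t)) * ((1 - 2 * t) * inverse ((?W t)\<^sup>2))) (at t)"
        by (rule DERIV_cong[OF DERIV_fun_exp[OF DERIV_minus[OF DERIV_inverse_fun[OF dW]]]])
          (use w 1 in \<open>simp_all add: power2_eq_square mult.assoc\<close>)
      have kk: "real k * inverse (?W t) ^ (k - 1) * inverse ((?W t)\<^sup>2) = real k * inverse (?W t) ^ (k + 1)"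
        using w by (cases k) (auto simp: power2_eq_square)
      have "((\<lambda>t. poly p t * inverse (?W t) ^ k * exp (- inverse (?W t))) has_real_derivative
          (poly (pderiv p) t * inverse (?W t) ^ k + real k * inverse (?W t) ^ (k - 1) * (- ((1 - 2 * t) * inverse ((?W t)\<^sup>2))) * poly p t)
            * exp (- inverse (?W t)) + exp (- inverse (?W t)) * ((1 - 2 * t) * inverse ((?W t)\<^sup>2)) * (poly p t * inverse (?W t) ^ k)) (at t)"
        by (rule DERIV_mult[OF DERIV_mult[OF poly_DERIV dpk] de])
      moreover have "(poly (pderiv p) t * inverse (?W t) ^ k + real k * inverse (?W t) ^ (k - 1) * (- ((1 - 2 * t) * inverse ((?W t)\<^sup>2))) * poly p t)
            * exp (- inverse (?W t)) + exp (- inverse (?W t)) * ((1 - 2 * t) * inverse ((?W t)\<^sup>2)) * (poly p t * inverse (?W t) ^ k)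
          = bump_term q (k + 2) t"
      proof -
        have "(poly (pderiv p) t * inverse (?W t) ^ k + real k * inverse (?W t) ^ (k - 1) * (- ((1 - 2 * t) * inverse ((?W t)\<^sup>2))) * poly p t)
            * exp (- inverse (?W t)) + exp (- inverse (?W t)) * ((1 - 2 * t) * inverse ((?W t)\<^sup>2)) * (poly p t * inverse (?W t) ^ k)
          = exp (- inverse (?W t)) * (poly (pderiv p) t * inverse (?W t) ^ k
              - (real k * inverse (?W t) ^ (k - 1) * inverse ((?W t)\<^sup>2)) * (1 - 2 * t) * poly p t
              + (1 - 2 * t) * poly p t * (inverse ((?W t)\<^sup>2) * inverse (?W t) ^ k))"
          by (simp only: ring_distribs mult_minus_left mult_minus_right) (simp add: ac_simps)
        also have "\<dots> = exp (- inverse (?W t)) * (poly q t * inverse (?W t) ^ (k + 2))"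
        proof -
          let ?i = "inverse (?W t)"
          have i: "?W t * ?i = 1" by (rule right_inverse) (use 1 in simp)
          have "(?W t)\<^sup>2 * ?i ^ (k + 2) = (?W t * ?i)\<^sup>2 * ?i ^ k" "?W t * ?i ^ (k + 2) = (?W t * ?i) * ?i ^ (k + 1)"
            by (simp_all only: power_add power_mult_distrib power_one_right power2_eq_square mult.assoc mult.left_commute mult.commute)
          then have e1: "(?W t)\<^sup>2 * ?i ^ (k + 2) = ?i ^ k" and e2: "?W t * ?i ^ (k + 2) = ?i ^ (k + 1)"
            unfolding i by simp_all
          have e3: "inverse ((?W t)\<^sup>2) * ?i ^ k = ?i ^ (k + 2)" by (simp only: power_add power_inverse mult.commute)
          have "poly q t * ?i ^ (k + 2) = poly (pderiv p) t * ((?W t)\<^sup>2 * ?i ^ (k + 2))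
            - real k * (?W t * ?i ^ (k + 2)) * (1 - 2 * t) * poly p t + (1 - 2 * t) * poly p t * ?i ^ (k + 2)"
            unfolding qt left_diff_distrib[of _ _ "?i ^ (k + 2)"] distrib_right[of _ _ "?i ^ (k + 2)"]
            by (simp only: mult.assoc mult.left_commute mult.commute)
          then show ?thesis unfolding kk e1 e2 e3 by simp
        qed
        also have "\<dots> = bump_term q (k + 2) t"
          using 1 by (simp add: bump_term_def divide_inverse power_inverse[symmetric] ac_simps)
        finally show ?thesis .
      qed
      ultimately have "((\<lambda>t. poly p t * inverse (?W t) ^ k * exp (- inverse (?W t))) has_real_derivative bump_term q (k + 2) t) (at t)"
        by simp
      then show ?thesis
        by (rule has_field_derivative_transform_within_open[where S="{0<..<1}"])
          (use 1 in \<open>auto simp: bump_term_def divide_inverse power_inverse[symmetric]\<close>)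
    next
      case 2
      have "((\<lambda>t. 0) has_real_derivative bump_term q (k + 2) t) (at t)" using 2 by (simp add: bump_term_def)
      then show ?thesis
        by (rule has_field_derivative_transform_within_open[where S="{..<0}"]) (use 2 in \<open>auto simp: bump_term_def\<close>)
    next
      case 3
      have "((\<lambda>t. 0) has_real_derivative bump_term q (k + 2) t) (at t)" using 3 by (simp add: bump_term_def)
      then show ?thesis
        by (rule has_field_derivative_transform_within_open[where S="{1<..}"]) (use 3 in \<open>auto simp: bump_term_def\<close>)
    next
      case 4
      then show ?thesis using quadratic_bound_imp_derivative_zero[of "bump_term p k" C 0] C by (simp add: bump_term_def)
    next
      case 5
      then show ?thesis using quadratic_bound_imp_derivative_zero[of "bump_term p k" C 1] C
        by (simp add: bump_term_def power2_commute)
    qed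
  qed
  then show ?thesis by blast
qed

lemma smooth_bump_term: "smooth (bump_term p k)"
proof (rule smooth_coinduct[where S="range (\<lambda>(p, k). bump_term p k)"])
  fix f assume "f \<in> range (\<lambda>(p, k). bump_term p k)"
  then obtain p k where "f = bump_term p k" by auto
  then show "\<exists>g\<in>range (\<lambda>(p, k). bump_term p k). \<forall>x. (f has_real_derivative g x) (at x)"
    using bump_term_deriv[of p k] by (metis (mono_tags, lifting) case_prod_conv rangeI)
qed auto

lemma antiderivative_exists:
  fixes f :: "real \<Rightarrow> real"
  assumes "continuous_on UNIV f"
  shows "\<exists>F. \<forall>x. (F has_real_derivative f x) (at x)"
proof -
  have "\<exists>F. \<forall>x :: real. - \<infinity> < ereal x \<longrightarrow> ereal x < \<infinity> \<longrightarrow> (F has_vector_derivative f x) (at x)"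
    by (rule einterval_antiderivative) (use assms in \<open>auto simp: continuous_on_eq_continuous_at\<close>)
  then show ?thesis by (simp add: has_real_derivative_iff_has_vector_derivative)
qed

lemma smooth_continuous_on: "smooth f \<Longrightarrow> continuous_on S f"
  using smooth_deriv(1) by (meson DERIV_continuous_on DERIV_subset subset_UNIV)

definition is_step :: "(real \<Rightarrow> real) \<Rightarrow> bool" where
  "is_step P \<longleftrightarrow> smooth P \<and> (\<forall>t\<le>0. P t = 0) \<and> (\<forall>t\<ge>1. P t = 1) \<and> (\<forall>t. 0 \<le> deriv P t)"

lemma is_step_exists: "\<exists>P. is_step P"
proof -
  let ?b = "bump_term 1 0"
  have b: "?b t = (if 0 < t \<and> t < 1 then exp (- 1 / (t * (1 - t))) else 0)" for t
    by (simp add: bump_term_def)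
  obtain F where F: "\<And>x. (F has_real_derivative ?b x) (at x)"
    using antiderivative_exists[OF smooth_continuous_on[OF smooth_bump_term, of UNIV]] by blast
  have le0: "F t = F 0" if "t \<le> 0" for t
  proof (cases "t = 0")
    case False
    then have "t < 0" using that by simp
    then obtain z where "z < 0" "F 0 - F t = (0 - t) * ?b z" using MVT2[of t 0 F ?b] F by auto
    then show ?thesis by (simp add: b)
  qed simp
  have ge1: "F t = F 1" if "t \<ge> 1" for t
  proof (cases "t = 1")
    case False
    then have "t > 1" using that by simp
    then obtain z where "z > 1" "F t - F 1 = (t - 1) * ?b z" using MVT2[of 1 t F ?b] F by auto
    then show ?thesis by (simp add: b)
  qed simp
  have lt: "F 0 < F 1"
  proof -
    obtain z where "0 < z" "z < 1" "F 1 - F 0 = (1 - 0) * ?b z" using MVT2[of 0 1 F ?b] F by auto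
    moreover from this have "?b z > 0" by (simp add: b)
    ultimately show ?thesis by simp
  qed
  define c where "c = 1 / (F 1 - F 0)"
  have c: "c > 0" using lt by (simp add: c_def)
  define P where "P t = c * (F t - F 0)" for t
  have dP: "(P has_real_derivative c * ?b x) (at x)" for x
    unfolding P_def by (auto intro!: derivative_eq_intros F)
  have "smooth (\<lambda>x. c * ?b (1 * x + 0) + 0 * ?b (1 * x + 0))"
    by (intro smooth_affine_combination smooth_bump_term)
  then have "smooth (\<lambda>x. c * ?b x)" by simp
  then have "smooth P" using dP by (rule smooth_antiderivative)
  moreover have "deriv P t = c * ?b t" for t using dP by (rule DERIV_imp_deriv)
  moreover have "P t = 0" if "t \<le> 0" for t using le0[OF that] by (simp add: P_def)
  moreover have "P t = 1" if "t \<ge> 1" for t using ge1[OF that] lt by (simp add: P_def c_def)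
  ultimately show ?thesis unfolding is_step_def using c by (intro exI[of _ P]) (simp add: b)
qed

definition smooth_step :: "real \<Rightarrow> real" where "smooth_step = (SOME P. is_step P)"

lemma smooth_step:
  shows smooth_smooth_step: "smooth smooth_step"
    and smooth_step_le_0: "t \<le> 0 \<Longrightarrow> smooth_step t = 0"
    and smooth_step_ge_1: "t \<ge> 1 \<Longrightarrow> smooth_step t = 1"
    and deriv_smooth_step_nonneg: "0 \<le> deriv smooth_step t"
    and smooth_step_nonneg: "0 \<le> smooth_step t"
    and smooth_step_bounded: "smooth_step t \<le> 1"
    and deriv_smooth_step_eq_0: "t < 0 \<or> 1 < t \<Longrightarrow> deriv smooth_step t = 0"
proof -
  have st: "is_step smooth_step" unfolding smooth_step_def using is_step_exists by (rule someI_ex)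
  then show s: "smooth smooth_step" and le0: "\<And>t. t \<le> 0 \<Longrightarrow> smooth_step t = 0"
    and ge1: "\<And>t. t \<ge> 1 \<Longrightarrow> smooth_step t = 1" and nn: "\<And>t. 0 \<le> deriv smooth_step t"
    by (auto simp: is_step_def)
  have mono: "smooth_step x \<le> smooth_step y" if "x \<le> y" for x y
    by (rule DERIV_nonneg_imp_nondecreasing[OF that]) (use smooth_deriv[OF s] nn in blast)
  show "0 \<le> smooth_step t" using mono[of "min t 0" t] le0[of "min t 0"] by simp
  show "smooth_step t \<le> 1" using mono[of t "max t 1"] ge1[of "max t 1"] by simp
  assume t: "t < 0 \<or> 1 < t"
  then show "deriv smooth_step t = 0"
  proof
    assume "t < 0"
    have "((\<lambda>t. 0) has_real_derivative 0) (at t)" by simp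
    then have "(smooth_step has_real_derivative 0) (at t)"
      by (rule has_field_derivative_transform_within_open[where S="{..<0}"]) (use \<open>t < 0\<close> le0 in auto)
    then show ?thesis by (rule DERIV_imp_deriv)
  next
    assume "t > 1"
    have "((\<lambda>t. 1) has_real_derivative 0) (at t)" by simp
    then have "(smooth_step has_real_derivative 0) (at t)"
      by (rule has_field_derivative_transform_within_open[where S="{1<..}"]) (use \<open>t > 1\<close> ge1 in auto)
    then show ?thesis by (rule DERIV_imp_deriv)
  qed
qed

lemma smooth_ramp_exists:
  obtains Q where "smooth Q" "\<And>t. (Q has_real_derivative smooth_step t) (at t)"
    "\<And>t. t \<le> 0 \<Longrightarrow> Q t = 0" "\<And>t. t \<ge> 1 \<Longrightarrow> Q t = t - 1 + Q 1" "\<And>t. \<bar>Q t - max 0 t\<bar> \<le> 1"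
proof -
  obtain F where F: "\<And>x. (F has_real_derivative smooth_step x) (at x)"
    using antiderivative_exists[OF smooth_continuous_on[OF smooth_smooth_step, of UNIV]] by blast
  define Q where "Q t = F t - F 0" for t
  have Q: "(Q has_real_derivative smooth_step t) (at t)" for t
    unfolding Q_def by (auto intro!: derivative_eq_intros F)
  have le0: "Q t = 0" if "t \<le> 0" for t
  proof (cases "t = 0")
    case False
    then have "t < 0" using that by simp
    then obtain z where "z < 0" "Q 0 - Q t = (0 - t) * smooth_step z" using MVT2[of t 0 Q smooth_step] Q by auto
    then show ?thesis by (simp add: smooth_step_le_0 Q_def)
  qed (simp add: Q_def)
  have ge1: "Q t = t - 1 + Q 1" if "t \<ge> 1" for t
  proof (cases "t = 1")
    case False
    then have "t > 1" using that by simp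
    then obtain z where "z > 1" "Q t - Q 1 = (t - 1) * smooth_step z" using MVT2[of 1 t Q smooth_step] Q by auto
    then show ?thesis by (simp add: smooth_step_ge_1)
  qed simp
  have mid: "0 \<le> Q t \<and> Q t \<le> t" if "0 \<le> t" for t
  proof (cases "t = 0")
    case False
    then have "t > 0" using that by simp
    then obtain z where "Q t - Q 0 = (t - 0) * smooth_step z" using MVT2[of 0 t Q smooth_step] Q by auto
    then show ?thesis using smooth_step_nonneg[of z] smooth_step_bounded[of z] that
      by (simp add: Q_def mult_left_le)
  qed (simp add: Q_def)
  have "\<bar>Q t - max 0 t\<bar> \<le> 1" for t
    using le0[of t] ge1[of t] mid[of t] mid[of 1] by (cases "t \<le> 0"; cases "t \<ge> 1") auto
  then show ?thesis
    using that[of Q] smooth_antiderivative[OF smooth_smooth_step Q] Q le0 ge1 by blast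
qed

lemma test_functionI:
  assumes "smooth \<phi>" "\<And>x. \<phi> x \<noteq> 0 \<Longrightarrow> c \<le> x \<and> x \<le> d" "a < c" "d < b"
  shows "test_function a b \<phi>"
proof -
  have "closure {x. \<phi> x \<noteq> 0} \<subseteq> {c..d}" by (rule closure_minimal) (use assms(2) in auto)
  then show ?thesis using assms unfolding test_function_def smooth_def by fastforce
qed

lemma deriv_scaled_step:
  "((\<lambda>t. smooth_step (k * (t - p))) has_real_derivative k * deriv smooth_step (k * (t - p))) (at t)"
  by (rule DERIV_cong[OF DERIV_chain2[OF smooth_deriv(1)[OF smooth_smooth_step]]])
    (auto intro!: derivative_eq_intros)

lemma mollifier_tendsto:
  fixes u :: "real \<Rightarrow> 'a::euclidean_space"
  assumes u: "continuous_on {a..b} u" and p: "a \<le> p" "p < b"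
  shows "(\<lambda>n. integral {a..b} (\<lambda>t. (real n * deriv smooth_step (real n * (t - p))) *\<^sub>R u t)) \<longlonglongrightarrow> u p"
  unfolding lim_sequentially
proof (intro allI impI)
  fix r :: real assume r: "r > 0"
  obtain d where d: "d > 0" "\<And>t. t \<in> {a..b} \<Longrightarrow> dist t p < d \<Longrightarrow> dist (u t) (u p) < r / 2"
    using u p r unfolding continuous_on_iff by (metis atLeastAtMost_iff half_gt_zero less_imp_le)
  obtain N where N: "N > 0" "1 / real N < min d (b - p)"
    using d p nat_approx_posE[of "min d (b - p)"] by (metis diff_gt_0_iff_gt min_less_iff_conj zero_less_Suc)
  have "dist (integral {a..b} (\<lambda>t. (real n * deriv smooth_step (real n * (t - p))) *\<^sub>R u t)) (u p) < r"
    if n: "n \<ge> N" for n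
  proof -
    let ?k = "\<lambda>t. real n * deriv smooth_step (real n * (t - p))"
    have n0: "real n > 0" using n N by simp
    have "1 / real n \<le> 1 / real N" using n N by (intro divide_left_mono) auto
    then have n1: "1 / real n < d" "1 / real n < b - p" using N by auto
    have one: "(?k has_integral 1) {a..b}"
    proof -
      have "(?k has_integral (smooth_step (real n * (b - p)) - smooth_step (real n * (a - p)))) {a..b}"
        using p deriv_scaled_step unfolding has_real_derivative_iff_has_vector_derivative
        by (intro fundamental_theorem_of_calculus) (auto intro: has_vector_derivative_at_within)
      moreover have "real n * (b - p) \<ge> 1" using n1(2) n0 by (simp add: field_simps)
      moreover have "real n * (a - p) \<le> 0" using p n0 by (simp add: mult_nonneg_nonpos)
      ultimately show ?thesis by (simp add: smooth_step_le_0 smooth_step_ge_1)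
    qed
    have ck: "continuous_on {a..b} ?k"
      by (intro continuous_intros continuous_on_compose2[OF smooth_continuous_on[OF smooth_deriv(2)[OF smooth_smooth_step], of UNIV]]) auto
    have i1: "(\<lambda>t. ?k t *\<^sub>R u t) integrable_on {a..b}" and i2: "(\<lambda>t. ?k t *\<^sub>R (u t - u p)) integrable_on {a..b}"
      by (intro integrable_continuous_real continuous_intros ck u)+
    have "((\<lambda>t. ?k t *\<^sub>R u p) has_integral 1 *\<^sub>R u p) {a..b}" by (rule has_integral_scaleR_left[OF one])
    from has_integral_diff[OF integrable_integral[OF i1] this]
    have "((\<lambda>t. ?k t *\<^sub>R (u t - u p)) has_integral (integral {a..b} (\<lambda>t. ?k t *\<^sub>R u t) - u p)) {a..b}"
      by (simp add: scaleR_diff_right)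
    then have "norm (integral {a..b} (\<lambda>t. ?k t *\<^sub>R u t) - u p) = norm (integral {a..b} (\<lambda>t. ?k t *\<^sub>R (u t - u p)))"
      by (simp add: integral_unique)
    also have "\<dots> \<le> integral {a..b} (\<lambda>t. ?k t * (r / 2))"
    proof (rule integral_norm_bound_integral[OF i2])
      show "(\<lambda>t. ?k t * (r / 2)) integrable_on {a..b}"
        by (intro integrable_continuous_real continuous_intros ck)
      fix t assume t: "t \<in> {a..b}"
      show "norm (?k t *\<^sub>R (u t - u p)) \<le> ?k t * (r / 2)"
      proof (cases "0 \<le> real n * (t - p) \<and> real n * (t - p) \<le> 1")
        case True
        then have "0 \<le> t - p" "t - p \<le> 1 / real n" using n0 by (auto simp: field_simps zero_le_mult_iff)
        then have "norm (u t - u p) \<le> r / 2" using d(2)[OF t] n1 by (simp add: dist_norm dist_real_def less_imp_le)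
        then show ?thesis using deriv_smooth_step_nonneg n0 by (simp add: mult_left_mono)
      next
        case False
        then have "deriv smooth_step (real n * (t - p)) = 0" by (intro deriv_smooth_step_eq_0) auto
        then show ?thesis by simp
      qed
    qed
    also have "\<dots> = r / 2" unfolding integral_unique[OF has_integral_mult_left[OF one, of "r / 2"]] by simp
    finally show ?thesis using r by (simp add: dist_norm)
  qed
  then show "\<exists>no. \<forall>n\<ge>no. dist (integral {a..b} (\<lambda>t. (real n * deriv smooth_step (real n * (t - p))) *\<^sub>R u t)) (u p) < r"
    by blast
qed

definition step_test :: "real \<Rightarrow> real \<Rightarrow> nat \<Rightarrow> real \<Rightarrow> real" where
  "step_test p q n t = smooth_step (real n * (t - p)) - smooth_step (real n * (t - q))"

lemma deriv_step_test:
  "deriv (step_test p q n) t = real n * deriv smooth_step (real n * (t - p)) - real n * deriv smooth_step (real n * (t - q))"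
  by (rule DERIV_imp_deriv) (unfold step_test_def, intro DERIV_diff deriv_scaled_step)

lemma test_function_step_test:
  assumes "a < p" "p < q" "q + 1 / real n < b" "n > 0"
  shows "test_function a b (step_test p q n)"
proof (rule test_functionI[OF _ _ assms(1,3)])
  have "smooth (\<lambda>t. 1 * smooth_step (real n * t + (- real n * p)) + (-1) * smooth_step (real n * t + (- real n * q)))"
    by (intro smooth_affine_combination smooth_smooth_step)
  moreover have "step_test p q n = (\<lambda>t. 1 * smooth_step (real n * t + (- real n * p)) + (-1) * smooth_step (real n * t + (- real n * q)))"
    by (simp add: step_test_def fun_eq_iff right_diff_distrib)
  ultimately show "smooth (step_test p q n)" by simp
  fix t assume t: "step_test p q n t \<noteq> 0"
  show "p \<le> t \<and> t \<le> q + 1 / real n"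
  proof (rule ccontr)
    assume "\<not> (p \<le> t \<and> t \<le> q + 1 / real n)"
    then consider "t < p" | "t > q + 1 / real n" by linarith
    then have "step_test p q n t = 0"
    proof cases
      case 1
      then have "real n * (t - p) \<le> 0" "real n * (t - q) \<le> 0" using assms by (auto intro!: mult_nonneg_nonpos)
      then show ?thesis by (simp add: step_test_def smooth_step_le_0)
    next
      case 2
      then have "real n * (t - q) \<ge> 1" using assms by (simp add: field_simps)
      moreover have "real n * (t - p) \<ge> real n * (t - q)" using assms by (intro mult_left_mono) auto
      ultimately show ?thesis by (simp add: step_test_def smooth_step_ge_1)
    qed
    then show False using t by simp
  qed
qed

lemma scaled_step_tendsto: "(\<lambda>n. smooth_step (real n * (t - p))) \<longlonglongrightarrow> (if p < t then 1 else 0)"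
proof (cases "p < t")
  case True
  obtain N where N: "real N * (t - p) > 1" using True reals_Archimedean3[of "t - p"] by auto
  have "smooth_step (real n * (t - p)) = 1" if "n \<ge> N" for n
  proof (rule smooth_step_ge_1)
    have "real N * (t - p) \<le> real n * (t - p)" using that True by (intro mult_right_mono) auto
    then show "1 \<le> real n * (t - p)" using N by simp
  qed
  then show ?thesis using True by (intro tendsto_eventually) (auto simp: eventually_sequentially)
next
  case False
  then have "smooth_step (real n * (t - p)) = 0" for n
    by (intro smooth_step_le_0) (simp add: mult_nonneg_nonpos)
  then show ?thesis using False by simp
qed

lemma diff_eq_integral_if_step_tests:
  fixes u g :: "real \<Rightarrow> 'a::euclidean_space"
  assumes u: "continuous_on {a..b} u" and g: "g absolutely_integrable_on {a..b}"
    and pq: "a < p" "p < q" "q < b"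
    and id: "\<And>n. test_function a b (step_test p q n) \<Longrightarrow>
      (LINT t|lebesgue_on {a..b}. deriv (step_test p q n) t *\<^sub>R u t)
        = - (LINT t|lebesgue_on {a..b}. step_test p q n t *\<^sub>R g t)"
  shows "u q - u p = integral {p..q} g"
proof -
  let ?k = "\<lambda>p n t. real n * deriv smooth_step (real n * (t - p))"
  have ck: "continuous_on {a..b} (?k p n)" for n p
    by (intro continuous_intros continuous_on_compose2[OF smooth_continuous_on[OF smooth_deriv(2)[OF smooth_smooth_step], of UNIV]]) auto
  have cs: "continuous_on {a..b} (step_test p q n)" for n
    unfolding step_test_def
    by (intro continuous_intros continuous_on_compose2[OF smooth_continuous_on[OF smooth_smooth_step, of UNIV]]) auto
  let ?l = "\<lambda>n. integral {a..b} (\<lambda>t. ?k p n t *\<^sub>R u t) - integral {a..b} (\<lambda>t. ?k q n t *\<^sub>R u t)"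
  let ?r = "\<lambda>n. integral {a..b} (\<lambda>t. step_test p q n t *\<^sub>R g t)"
  have l: "?l \<longlonglongrightarrow> u p - u q"
    by (intro tendsto_diff mollifier_tendsto u) (use pq in auto)
  have r: "?r \<longlonglongrightarrow> integral {a..b} (\<lambda>t. if t \<in> {p<..q} then g t else 0)"
  proof (rule dominated_convergence(2)[where h="\<lambda>t. norm (g t)"])
    show "(\<lambda>t. step_test p q n t *\<^sub>R g t) integrable_on {a..b}" for n
      by (intro set_lebesgue_integral_eq_integral(1) absolutely_integrable_continuous_scaleR cs g)
    show "(\<lambda>t. norm (g t)) integrable_on {a..b}" using g absolutely_integrable_on_def by blast
    fix n t
    have "\<bar>step_test p q n t\<bar> \<le> 1"
      using smooth_step_nonneg smooth_step_bounded unfolding step_test_def abs_le_iff by (smt (verit))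
    then show "norm (step_test p q n t *\<^sub>R g t) \<le> norm (g t)"
      by (simp add: mult_left_le_one_le)
    have "(\<lambda>n. step_test p q n t) \<longlonglongrightarrow> (if p < t then 1 else 0) - (if q < t then 1 else 0)"
      unfolding step_test_def by (intro tendsto_diff scaled_step_tendsto)
    from tendsto_scaleR[OF this tendsto_const[of "g t"]]
    show "(\<lambda>n. step_test p q n t *\<^sub>R g t) \<longlonglongrightarrow> (if t \<in> {p<..q} then g t else 0)"
      using pq by (auto split: if_splits)
  qed
  have "eventually (\<lambda>n. ?l n = - ?r n) sequentially"
  proof -
    obtain N where N: "N > 0" "1 / real N < b - q"
      using pq nat_approx_posE[of "b - q"] by (metis diff_gt_0_iff_gt zero_less_Suc)
    have "?l n = - ?r n" if n: "n \<ge> N" for n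
    proof -
      have "1 / real n \<le> 1 / real N" using n N by (intro divide_left_mono) auto
      then have "test_function a b (step_test p q n)"
        using n N pq by (intro test_function_step_test) auto
      from id[OF this] have *: "(LINT t|lebesgue_on {a..b}. (?k p n t - ?k q n t) *\<^sub>R u t) = - (LINT t|lebesgue_on {a..b}. step_test p q n t *\<^sub>R g t)"
        by (simp add: deriv_step_test)
      have i1: "(\<lambda>t. (?k p n t - ?k q n t) *\<^sub>R u t) absolutely_integrable_on {a..b}"
        by (intro absolutely_integrable_continuous_real continuous_on_scaleR continuous_on_diff ck u)
      have i2: "(\<lambda>t. step_test p q n t *\<^sub>R g t) absolutely_integrable_on {a..b}"
        by (intro absolutely_integrable_continuous_scaleR cs g)
      have "integral {a..b} (\<lambda>t. (?k p n t - ?k q n t) *\<^sub>R u t) = ?l n"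
        unfolding scaleR_diff_left
        by (intro integral_diff integrable_continuous_real continuous_on_scaleR ck u)
      then show ?thesis using * unfolding LINT_eq_integral[OF i1] LINT_eq_integral[OF i2] by simp
    qed
    then show ?thesis unfolding eventually_sequentially by blast
  qed
  then have "?l \<longlonglongrightarrow> - integral {a..b} (\<lambda>t. if t \<in> {p<..q} then g t else 0)"
    using tendsto_minus[OF r] by (simp add: tendsto_cong)
  then have "u p - u q = - integral {a..b} (\<lambda>t. if t \<in> {p<..q} then g t else 0)"
    using l LIMSEQ_unique by blast
  also have "integral {a..b} (\<lambda>t. if t \<in> {p<..q} then g t else 0) = integral ({p<..q} \<inter> {a..b}) g"
    using integral_restrict_Int[of "{a..b}" "{p<..q}" g] by (simp only: Int_commute)
  also have "{p<..q} \<inter> {a..b} = {p<..q}" using pq by auto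
  also have "integral {p<..q} g = integral {p..q} g"
    by (rule integral_subset_negligible) (use pq in \<open>auto intro: negligible_subset[of "{p}"]\<close>)
  finally show ?thesis by (simp add: algebra_simps)
qed

text \<open>Only countably many test functions are needed. This matters for weak time derivatives, where the
  exceptional null set of \<open>s\<close> may depend on the test function.\<close>

lemma indefinite_integral_if_step_tests:
  fixes u g :: "real \<Rightarrow> 'a::euclidean_space"
  assumes u: "continuous_on {a..b} u" and g: "g absolutely_integrable_on {a..b}"
    and id: "\<And>p q n. p \<in> \<rat> \<Longrightarrow> q \<in> \<rat> \<Longrightarrow> test_function a b (step_test p q n) \<Longrightarrow>
      (LINT t|lebesgue_on {a..b}. deriv (step_test p q n) t *\<^sub>R u t)
        = - (LINT t|lebesgue_on {a..b}. step_test p q n t *\<^sub>R g t)"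
    and t: "t \<in> {a..b}"
  shows "u t = u a + integral {a..t} g"
proof (cases "a < b")
  case True
  have gi: "g integrable_on {a..b}" using g set_lebesgue_integral_eq_integral(1) by blast
  let ?h = "\<lambda>t. u t - integral {a..t} g"
  have ch: "continuous_on {a..b} ?h"
    by (intro continuous_on_diff u indefinite_integral_continuous_1 gi)
  have *: "?h q = ?h p" if "p \<in> {a<..<b} \<inter> \<rat>" "q \<in> {a<..<b} \<inter> \<rat>" "p < q" for p q
  proof -
    have "u q - u p = integral {p..q} g"
      by (rule diff_eq_integral_if_step_tests[OF u g]) (use that id in auto)
    moreover have "g integrable_on {a..q}"
      by (rule integrable_on_subinterval[OF gi]) (use that in auto)
    then have "integral {a..p} g + integral {p..q} g = integral {a..q} g"
      by (intro Henstock_Kurzweil_Integration.integral_combine) (use that in auto)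
    ultimately show ?thesis by (simp add: algebra_simps)
  qed
  obtain r where r: "r \<in> {a<..<b} \<inter> \<rat>" using Rats_dense_in_real[OF True] by auto
  have cl: "closure ({a<..<b} \<inter> \<rat>) = {a..b}"
    using closure_open_Int_superset[of "{a<..<b}" "\<rat>"] True by (simp add: Rats_closure_real)
  have eq: "?h x = ?h r" if "x \<in> {a<..<b} \<inter> \<rat>" for x
    using *[OF that r] *[OF r that] by (cases x r rule: linorder_cases) auto
  have hr: "?h x = ?h r" if "x \<in> {a..b}" for x
    by (rule continuous_constant_on_closure[where S="{a<..<b} \<inter> \<rat>" and f="?h"]) (use ch cl eq that in auto)
  have "?h t = ?h a" using True by (simp only: hr[OF t] hr[of a] atLeastAtMost_iff less_imp_le order_refl simp_thms)
  then show ?thesis by (simp add: algebra_simps)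
next
  case False
  then have "t = a" "{a..t} = {a}" using t by auto
  then show ?thesis by simp
qed

section \<open>Pointwise space derivatives\<close>

lemma subset_closure_AE:
  fixes a b :: real
  assumes ab: "a < b" and P: "AE t in lebesgue_on {a..b}. P t"
  shows "{a..b} \<subseteq> closure {t \<in> {a..b}. P t}"
proof
  fix t assume t: "t \<in> {a..b}"
  have N: "negligible {t \<in> {a..b}. \<not> P t}"
    by (rule AE_lebesgue_on_iff_negligible[THEN iffD1, OF _ P]) simp
  show "t \<in> closure {t \<in> {a..b}. P t}"
    unfolding closure_approachable
  proof (intro allI impI)
    fix e :: real assume e: "e > 0"
    let ?I = "{max a (t - e)<..<min b (t + e)}"
    have "?I \<noteq> {}" using ab e t by (auto simp: max_def min_def split: if_splits)
    then have "\<not> negligible ?I" by (intro open_not_negligible) auto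
    then have "\<not> ?I \<subseteq> {t \<in> {a..b}. \<not> P t}" using N negligible_subset by blast
    then obtain y where "y \<in> ?I" "P y" by force
    then show "\<exists>y\<in>{t \<in> {a..b}. P t}. dist y t < e"
      by (intro bexI[of _ y]) (auto simp: dist_real_def abs_less_iff)
  qed
qed

text \<open>The hat function on the right is the limit of smooth test functions built from primitives of the
  smooth step.\<close>

lemma second_difference_eq_integral:
  fixes u u1 u2 :: "real \<Rightarrow> 'a::euclidean_space"
  assumes u: "continuous_on {a..b} u" and w1: "has_weak_derivative a b u u1"
    and w2: "has_weak_derivative a b u1 u2" and u2: "u2 absolutely_integrable_on {a..b}"
    and pq: "a < p" "p < m" "m < q" "q < b" and l: "l = (q - m) / (q - p)"
  shows "l *\<^sub>R u p - u m + (1 - l) *\<^sub>R u q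
    = integral {a..b} (\<lambda>t. (l * max 0 (t - p) - max 0 (t - m) + (1 - l) * max 0 (t - q)) *\<^sub>R u2 t)"
proof -
  have m: "l * p + (1 - l) * q = m"
  proof -
    have "l * (q - p) = q - m" using pq l by simp
    then show ?thesis by (simp add: algebra_simps)
  qed
  have l01: "0 \<le> l" "l \<le> 1" using pq l by auto
  obtain Q where Q: "smooth Q" "\<And>t. (Q has_real_derivative smooth_step t) (at t)"
    "\<And>t. t \<le> 0 \<Longrightarrow> Q t = 0" "\<And>t. t \<ge> 1 \<Longrightarrow> Q t = t - 1 + Q 1" "\<And>t. \<bar>Q t - max 0 t\<bar> \<le> 1"
    using smooth_ramp_exists by metis
  let ?s = "\<lambda>p n t. smooth_step (real n * (t - p))"
  let ?k = "\<lambda>p n t. real n * deriv smooth_step (real n * (t - p))"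
  let ?hat = "\<lambda>t. l * max 0 (t - p) - max 0 (t - m) + (1 - l) * max 0 (t - q)"
  define \<phi> where "\<phi> n t = (l * Q (real n * (t - p)) - Q (real n * (t - m)) + (1 - l) * Q (real n * (t - q))) / real n" for n t
  define \<psi> where "\<psi> n t = l * ?s p n t - ?s m n t + (1 - l) * ?s q n t" for n t
  have comb: "smooth (\<lambda>t. l * f (real n * (t - p)) - f (real n * (t - m)) + (1 - l) * f (real n * (t - q)))"
    if f: "smooth f" for f n
  proof -
    have "smooth (\<lambda>t. 1 * (\<lambda>t. l * f (real n * t + (- real n * p)) + (- 1) * f (real n * t + (- real n * m))) (1 * t + 0)
        + (1 - l) * f (real n * t + (- real n * q)))"
      by (intro smooth_affine_combination f)
    moreover have "(\<lambda>t. 1 * (\<lambda>t. l * f (real n * t + (- real n * p)) + (- 1) * f (real n * t + (- real n * m))) (1 * t + 0)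
        + (1 - l) * f (real n * t + (- real n * q)))
      = (\<lambda>t. l * f (real n * (t - p)) - f (real n * (t - m)) + (1 - l) * f (real n * (t - q)))"
      by (simp add: fun_eq_iff right_diff_distrib)
    ultimately show ?thesis by simp
  qed
  have s\<psi>: "smooth (\<psi> n)" for n
    using comb[OF smooth_smooth_step] unfolding \<psi>_def by simp
  have s\<phi>: "smooth (\<phi> n)" for n
  proof -
    have "smooth (\<lambda>t. (1 / real n) * (\<lambda>t. l * Q (real n * (t - p)) - Q (real n * (t - m)) + (1 - l) * Q (real n * (t - q))) (1 * t + 0)
       + 0 * smooth_step (1 * t + 0))"
      by (intro smooth_affine_combination comb Q smooth_smooth_step)
    then show ?thesis unfolding \<phi>_def by (simp add: divide_inverse mult.commute)
  qed
  have dQ: "((\<lambda>t. Q (real n * (t - c))) has_real_derivative real n * ?s c n t) (at t)" for c n t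
    by (rule DERIV_cong[OF DERIV_chain2[OF Q(2)]]) (auto intro!: derivative_eq_intros)
  have d\<phi>: "deriv (\<phi> n) t = \<psi> n t" if "n > 0" for n t
  proof (rule DERIV_imp_deriv)
    have "((\<lambda>t. l * Q (real n * (t - p)) - Q (real n * (t - m)) + (1 - l) * Q (real n * (t - q))) has_real_derivative
       l * (real n * ?s p n t) - real n * ?s m n t + (1 - l) * (real n * ?s q n t)) (at t)"
      by (intro DERIV_add DERIV_diff DERIV_cmult dQ)
    from DERIV_cdivide[OF this, of "real n"]
    have "(\<phi> n has_real_derivative
       (l * (real n * ?s p n t) - real n * ?s m n t + (1 - l) * (real n * ?s q n t)) / real n) (at t)"
      unfolding \<phi>_def .
    moreover have "(l * (real n * ?s p n t) - real n * ?s m n t + (1 - l) * (real n * ?s q n t)) / real n = \<psi> n t"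
      unfolding \<psi>_def using that by (simp add: field_simps)
    ultimately show "(\<phi> n has_real_derivative \<psi> n t) (at t)" by simp
  qed
  have d\<psi>: "deriv (\<psi> n) t = l * ?k p n t - ?k m n t + (1 - l) * ?k q n t" for n t
    by (rule DERIV_imp_deriv) (unfold \<psi>_def, intro DERIV_add DERIV_diff DERIV_cmult deriv_scaled_step)
  have supp: "p \<le> t \<and> t \<le> q + 1 / real n" if n: "n > 0" and nz: "\<phi> n t \<noteq> 0 \<or> \<psi> n t \<noteq> 0" for n t
  proof (rule ccontr)
    assume "\<not> (p \<le> t \<and> t \<le> q + 1 / real n)"
    then consider "t < p" | "t > q + 1 / real n" by linarith
    then have "\<phi> n t = 0 \<and> \<psi> n t = 0"
    proof cases
      case 1
      then have "real n * (t - p) \<le> 0" "real n * (t - m) \<le> 0" "real n * (t - q) \<le> 0"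
        using pq by (auto intro!: mult_nonneg_nonpos)
      then show ?thesis by (simp add: \<phi>_def \<psi>_def smooth_step_le_0 Q)
    next
      case 2
      then have "real n * (t - q) \<ge> 1" using n by (simp add: field_simps)
      moreover have "real n * (t - p) \<ge> real n * (t - q)" "real n * (t - m) \<ge> real n * (t - q)"
        using pq by (auto intro!: mult_left_mono)
      ultimately have ge: "real n * (t - p) \<ge> 1" "real n * (t - m) \<ge> 1" "real n * (t - q) \<ge> 1" by linarith+
      have "l * (real n * (t - p) - 1 + Q 1) - (real n * (t - m) - 1 + Q 1) + (1 - l) * (real n * (t - q) - 1 + Q 1)
        = real n * (m - (l * p + (1 - l) * q))"
        by (simp add: algebra_simps)
      then show ?thesis unfolding \<phi>_def \<psi>_def Q(4)[OF ge(1)] Q(4)[OF ge(2)] Q(4)[OF ge(3)]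
        using ge by (simp add: smooth_step_ge_1 m)
    qed
    then show False using nz by simp
  qed
  have ck: "continuous_on {a..b} (?k p n)" for n p
    by (intro continuous_intros continuous_on_compose2[OF smooth_continuous_on[OF smooth_deriv(2)[OF smooth_smooth_step], of UNIV]]) auto
  let ?K = "\<lambda>p n. integral {a..b} (\<lambda>t. ?k p n t *\<^sub>R u t)"
  have lim1: "(\<lambda>n. l *\<^sub>R ?K p n - ?K m n + (1 - l) *\<^sub>R ?K q n) \<longlonglongrightarrow> l *\<^sub>R u p - u m + (1 - l) *\<^sub>R u q"
    by (intro tendsto_intros mollifier_tendsto u) (use pq in auto)
  have close: "\<bar>\<phi> n t - ?hat t\<bar> \<le> 2 / real n" if n: "n > 0" for n t
  proof -
    have *: "\<bar>Q (real n * x) / real n - max 0 x\<bar> \<le> 1 / real n" for x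
    proof -
      have "max 0 (real n * x) = real n * max 0 x" using n by (simp add: max_mult_distrib_left)
      then have "Q (real n * x) / real n - max 0 x = (Q (real n * x) - max 0 (real n * x)) / real n"
        using n by (simp add: field_simps)
      then show ?thesis using Q(5)[of "real n * x"] n by (simp add: divide_right_mono)
    qed
    have "\<phi> n t - ?hat t = l * (Q (real n * (t - p)) / real n - max 0 (t - p)) - (Q (real n * (t - m)) / real n - max 0 (t - m))
      + (1 - l) * (Q (real n * (t - q)) / real n - max 0 (t - q))"
      using n by (simp add: \<phi>_def field_simps)
    also have "\<bar>\<dots>\<bar> \<le> l * (1 / real n) + 1 / real n + (1 - l) * (1 / real n)"
    proof -
      have "\<bar>l * x - y + (1 - l) * z\<bar> \<le> l * e + e + (1 - l) * e"
        if "\<bar>x\<bar> \<le> e" "\<bar>y\<bar> \<le> e" "\<bar>z\<bar> \<le> e" for x y z e :: real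
      proof -
        have "\<bar>l * x\<bar> \<le> l * e" "\<bar>(1 - l) * z\<bar> \<le> (1 - l) * e"
          using l01 that by (auto simp: abs_mult intro!: mult_left_mono)
        then show ?thesis using that by linarith
      qed
      then show ?thesis using * by blast
    qed
    also have "\<dots> = (l + 1 + (1 - l)) * (1 / real n)" by (simp only: distrib_right mult_1)
    also have "\<dots> = 2 / real n" by simp
    finally show ?thesis .
  qed
  have "continuous_on {a..b} ?hat" by (intro continuous_intros)
  then have "bounded (?hat ` {a..b})" by (intro compact_imp_bounded compact_continuous_image) auto
  then obtain B where "\<forall>t\<in>{a..b}. \<bar>?hat t\<bar> \<le> B" unfolding bounded_pos by auto
  then have B: "\<bar>?hat t\<bar> \<le> B" if "t \<in> {a..b}" for t using that by blast
  have c\<phi>: "continuous_on {a..b} (\<phi> n)" for n by (rule smooth_continuous_on[OF s\<phi>])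
  have lim2: "(\<lambda>n. integral {a..b} (\<lambda>t. \<phi> (Suc n) t *\<^sub>R u2 t)) \<longlonglongrightarrow> integral {a..b} (\<lambda>t. ?hat t *\<^sub>R u2 t)"
  proof (rule dominated_convergence(2)[where h="\<lambda>t. (B + 2) * norm (u2 t)"])
    show "(\<lambda>t. \<phi> (Suc n) t *\<^sub>R u2 t) integrable_on {a..b}" for n
      by (intro set_lebesgue_integral_eq_integral(1) absolutely_integrable_continuous_scaleR c\<phi> u2)
    show "(\<lambda>t. (B + 2) * norm (u2 t)) integrable_on {a..b}"
      using u2 unfolding absolutely_integrable_on_def by (intro integrable_on_mult_right) auto
    fix n t assume t: "t \<in> {a..b}"
    have "2 / real (Suc n) \<le> 2" by (simp add: field_simps)
    moreover have "\<bar>x\<bar> \<le> B + 2" if "\<bar>x - y\<bar> \<le> c" "c \<le> 2" "\<bar>y\<bar> \<le> B" for x y c :: real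
      using that by linarith
    ultimately have "\<bar>\<phi> (Suc n) t\<bar> \<le> B + 2" using close[of "Suc n" t] B[OF t] by blast
    then show "norm (\<phi> (Suc n) t *\<^sub>R u2 t) \<le> (B + 2) * norm (u2 t)"
      by (simp add: mult_right_mono)
    have "(\<lambda>n. \<phi> (Suc n) t) \<longlonglongrightarrow> ?hat t"
    proof (rule LIM_zero_cancel, rule Lim_null_comparison)
      show "\<forall>\<^sub>F n in sequentially. norm (\<phi> (Suc n) t - ?hat t) \<le> 2 / real (Suc n)"
        using close by (intro always_eventually allI) (simp del: of_nat_Suc)
      show "(\<lambda>n. 2 / real (Suc n)) \<longlonglongrightarrow> 0"
        by (rule LIMSEQ_Suc[OF lim_const_over_n])
    qed
    from tendsto_scaleR[OF this tendsto_const[of "u2 t"]]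
    show "(\<lambda>n. \<phi> (Suc n) t *\<^sub>R u2 t) \<longlonglongrightarrow> ?hat t *\<^sub>R u2 t" .
  qed
  have "eventually (\<lambda>n. l *\<^sub>R ?K p n - ?K m n + (1 - l) *\<^sub>R ?K q n = integral {a..b} (\<lambda>t. \<phi> n t *\<^sub>R u2 t)) sequentially"
  proof -
    obtain N where N: "N > 0" "1 / real N < b - q"
      using pq nat_approx_posE[of "b - q"] by (metis diff_gt_0_iff_gt zero_less_Suc)
    have "l *\<^sub>R ?K p n - ?K m n + (1 - l) *\<^sub>R ?K q n = integral {a..b} (\<lambda>t. \<phi> n t *\<^sub>R u2 t)" if n: "n \<ge> N" for n
    proof -
      have n0: "n > 0" using n N by simp
      have "1 / real n \<le> 1 / real N" using n N by (intro divide_left_mono) auto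
      then have qb: "q + 1 / real n < b" using N by simp
      have t\<phi>: "test_function a b (\<phi> n)" and t\<psi>: "test_function a b (\<psi> n)"
        by (rule test_functionI[OF _ _ pq(1) qb]; use s\<phi> s\<psi> supp[OF n0] in blast)+
      have i2: "(\<lambda>t. \<phi> n t *\<^sub>R u2 t) absolutely_integrable_on {a..b}"
        by (intro absolutely_integrable_continuous_scaleR c\<phi> u2)
      have i1: "(\<lambda>t. deriv (\<psi> n) t *\<^sub>R u t) absolutely_integrable_on {a..b}"
        by (intro absolutely_integrable_continuous_real continuous_on_scaleR test_functionD(3)[OF t\<psi>] u)
      have "(LINT t|lebesgue_on {a..b}. deriv (\<psi> n) t *\<^sub>R u t) = - (LINT t|lebesgue_on {a..b}. \<psi> n t *\<^sub>R u1 t)"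
        using w1 t\<psi> unfolding has_weak_derivative_def by blast
      also have "(LINT t|lebesgue_on {a..b}. \<psi> n t *\<^sub>R u1 t) = (LINT t|lebesgue_on {a..b}. deriv (\<phi> n) t *\<^sub>R u1 t)"
        using d\<phi>[OF n0] by simp
      also have "\<dots> = - (LINT t|lebesgue_on {a..b}. \<phi> n t *\<^sub>R u2 t)"
        using w2 t\<phi> unfolding has_weak_derivative_def by blast
      finally have "integral {a..b} (\<lambda>t. deriv (\<psi> n) t *\<^sub>R u t) = integral {a..b} (\<lambda>t. \<phi> n t *\<^sub>R u2 t)"
        unfolding LINT_eq_integral[OF i1] LINT_eq_integral[OF i2] by simp
      moreover have "integral {a..b} (\<lambda>t. deriv (\<psi> n) t *\<^sub>R u t) = l *\<^sub>R ?K p n - ?K m n + (1 - l) *\<^sub>R ?K q n"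
      proof -
        have hk: "((\<lambda>t. ?k c n t *\<^sub>R u t) has_integral ?K c n) {a..b}" for c
          by (intro integrable_integral integrable_continuous_real continuous_on_scaleR ck u)
        have "((\<lambda>t. l *\<^sub>R (?k p n t *\<^sub>R u t) - ?k m n t *\<^sub>R u t + (1 - l) *\<^sub>R (?k q n t *\<^sub>R u t)) has_integral
            l *\<^sub>R ?K p n - ?K m n + (1 - l) *\<^sub>R ?K q n) {a..b}"
          by (intro has_integral_add has_integral_diff has_integral_cmul hk)
        moreover have "(\<lambda>t. l *\<^sub>R (?k p n t *\<^sub>R u t) - ?k m n t *\<^sub>R u t + (1 - l) *\<^sub>R (?k q n t *\<^sub>R u t))
            = (\<lambda>t. deriv (\<psi> n) t *\<^sub>R u t)"
          by (simp only: d\<psi> scaleR_add_left scaleR_diff_left scaleR_scaleR)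
        ultimately show ?thesis by (simp add: integral_unique)
      qed
      ultimately show ?thesis by simp
    qed
    then show ?thesis unfolding eventually_sequentially by blast
  qed
  then have "(\<lambda>n. integral {a..b} (\<lambda>t. \<phi> n t *\<^sub>R u2 t)) \<longlonglongrightarrow> l *\<^sub>R u p - u m + (1 - l) *\<^sub>R u q"
    using lim1 by (simp add: tendsto_cong)
  then have "(\<lambda>n. integral {a..b} (\<lambda>t. \<phi> (Suc n) t *\<^sub>R u2 t)) \<longlonglongrightarrow> l *\<^sub>R u p - u m + (1 - l) *\<^sub>R u q"
    by (rule LIMSEQ_Suc)
  then show ?thesis using lim2 LIMSEQ_unique by blast
qed

lemma difference_quotient_bound:
  fixes u u1 u2 :: "real \<Rightarrow> 'a::euclidean_space"
  assumes u: "continuous_on {a..b} u" and w1: "has_weak_derivative a b u u1"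
    and w2: "has_weak_derivative a b u1 u2" and u2: "u2 absolutely_integrable_on {a..b}"
    and pq: "a < p" "p < m" "m < q" "q < b"
  shows "norm ((u q - u m) /\<^sub>R (q - m) - (u m - u p) /\<^sub>R (m - p)) \<le> integral {p..q} (\<lambda>t. norm (u2 t))"
proof -
  define l where "l = (q - m) / (q - p)"
  let ?hat = "\<lambda>t. l * max 0 (t - p) - max 0 (t - m) + (1 - l) * max 0 (t - q)"
  define h where "h = l * (1 - l) * (q - p)"
  have l: "0 < l" "l < 1" using pq by (auto simp: l_def)
  have h0: "h > 0" using l pq by (simp add: h_def)
  have qm: "q - m = l * (q - p)" using pq by (simp add: l_def)
  then have mp: "m - p = (1 - l) * (q - p)" by (simp add: algebra_simps)
  have hat: "\<bar>?hat t\<bar> \<le> (if t \<in> {p..q} then h else 0)" for t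
  proof -
    consider "t < p" | "p \<le> t" "t \<le> m" | "m < t" "t \<le> q" | "q < t" by linarith
    then show ?thesis
    proof cases
      case 1 then show ?thesis using pq by simp
    next
      case 2
      then have "?hat t = l * (t - p)" using pq by simp
      moreover have "l * (t - p) \<le> l * (m - p)" using 2 l by (intro mult_left_mono) auto
      moreover have "l * (m - p) = h" unfolding mp h_def by simp
      moreover have "0 \<le> l * (t - p)" using 2 l by simp
      ultimately show ?thesis using 2 pq by simp
    next
      case 3
      then have "?hat t = l * (t - p) - (t - m)" using pq by simp
      also have "\<dots> = (1 - l) * (q - t)" using qm by (simp add: algebra_simps)
      finally have e: "?hat t = (1 - l) * (q - t)" .
      moreover have "(1 - l) * (q - t) \<le> (1 - l) * (q - m)" using 3 l by (intro mult_left_mono) auto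
      moreover have "(1 - l) * (q - m) = h" unfolding qm h_def by simp
      moreover have "0 \<le> (1 - l) * (q - t)" using 3 l by simp
      ultimately show ?thesis using 3 pq by simp
    next
      case 4
      then have "?hat t = l * (t - p) - (t - m) + (1 - l) * (t - q)" using pq by simp
      also have "\<dots> = 0" using qm by (simp add: algebra_simps)
      finally show ?thesis using 4 by simp
    qed
  qed
  have ni: "(\<lambda>t. norm (u2 t)) integrable_on {a..b}" using u2 absolutely_integrable_on_def by blast
  have ni2: "(\<lambda>t. norm (u2 t)) integrable_on {p..q}"
    by (rule integrable_on_subinterval[OF ni]) (use pq in auto)
  have "norm (l *\<^sub>R u p - u m + (1 - l) *\<^sub>R u q) = norm (integral {a..b} (\<lambda>t. ?hat t *\<^sub>R u2 t))"
    using second_difference_eq_integral[OF u w1 w2 u2 pq l_def] by simp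
  also have "\<dots> \<le> integral {a..b} (\<lambda>t. if t \<in> {p..q} then h * norm (u2 t) else 0)"
  proof (rule integral_norm_bound_integral)
    show "(\<lambda>t. ?hat t *\<^sub>R u2 t) integrable_on {a..b}"
      by (intro set_lebesgue_integral_eq_integral(1) absolutely_integrable_continuous_scaleR u2 continuous_intros)
    have "(\<lambda>t. h * norm (u2 t)) integrable_on ({p..q} \<inter> {a..b})"
      using ni2 pq by (intro integrable_on_mult_right) (simp add: Int_absorb2)
    then show "(\<lambda>t. if t \<in> {p..q} then h * norm (u2 t) else 0) integrable_on {a..b}"
      using integrable_restrict_Int[of "{p..q}" "\<lambda>t. h * norm (u2 t)" "{a..b}"] by (simp add: Int_commute)
    fix t
    show "norm (?hat t *\<^sub>R u2 t) \<le> (if t \<in> {p..q} then h * norm (u2 t) else 0)"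
      using mult_right_mono[OF hat[of t] norm_ge_zero, of "u2 t"] by (cases "t \<in> {p..q}") (simp_all only: if_True if_False norm_scaleR real_norm_def mult_zero_left)
  qed
  also have "\<dots> = integral ({p..q} \<inter> {a..b}) (\<lambda>t. h * norm (u2 t))"
    by (simp only: integral_restrict_Int Int_commute)
  also have "{p..q} \<inter> {a..b} = {p..q}" using pq by auto
  also have "integral {p..q} (\<lambda>t. h * norm (u2 t)) = h * integral {p..q} (\<lambda>t. norm (u2 t))" by simp
  finally have main: "norm (l *\<^sub>R u p - u m + (1 - l) *\<^sub>R u q) \<le> h * integral {p..q} (\<lambda>t. norm (u2 t))" .
  have "(u q - u m) /\<^sub>R (q - m) - (u m - u p) /\<^sub>R (m - p) = (l *\<^sub>R u p - u m + (1 - l) *\<^sub>R u q) /\<^sub>R h"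
  proof -
    have e: "h * inverse (q - m) = 1 - l" "h * inverse (m - p) = l"
    proof -
      have "l \<noteq> 0" "1 - l \<noteq> 0" "q - p \<noteq> 0" using l pq by auto
      then show "h * inverse (q - m) = 1 - l" "h * inverse (m - p) = l"
        unfolding qm mp h_def by (simp_all add: divide_inverse[symmetric] del: mult_divide_mult_cancel_left)
    qed
    have "h *\<^sub>R ((u q - u m) /\<^sub>R (q - m) - (u m - u p) /\<^sub>R (m - p)) = (1 - l) *\<^sub>R (u q - u m) - l *\<^sub>R (u m - u p)"
      by (simp only: scaleR_diff_right[of h] scaleR_scaleR e)
    also have "\<dots> = l *\<^sub>R u p - u m + (1 - l) *\<^sub>R u q" by (simp add: algebra_simps)
    finally show ?thesis using h0 by (metis less_irrefl scaleR_left_imp_eq divideR_right)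
  qed
  then have "norm ((u q - u m) /\<^sub>R (q - m) - (u m - u p) /\<^sub>R (m - p)) = norm (l *\<^sub>R u p - u m + (1 - l) *\<^sub>R u q) / h"
    using h0 by (simp add: divide_inverse mult.commute)
  also have "\<dots> \<le> integral {p..q} (\<lambda>t. norm (u2 t))" using main h0 by (simp add: field_simps)
  finally show ?thesis .
qed

lemma absolutely_integrable_if_L2_on:
  fixes f :: "real \<Rightarrow> 'a::euclidean_space"
  assumes "L2_on {a..b} f" shows "f absolutely_integrable_on {a..b}"
proof (rule measurable_bounded_by_integrable_imp_absolutely_integrable)
  show "f \<in> borel_measurable (lebesgue_on {a..b})" using assms by (simp add: L2_on_def)
  have "(\<lambda>t. (norm (f t))\<^sup>2) integrable_on {a..b}"
    using assms by (intro integrable_on_lebesgue_on) (auto simp: L2_on_def)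
  then show "(\<lambda>t. (norm (f t))\<^sup>2 + 1) integrable_on {a..b}" by (intro integrable_add) auto
  show "norm (f t) \<le> (norm (f t))\<^sup>2 + 1" for t
    using sum_power2_ge_zero[of "norm (f t) - 1/2" 0] by (simp add: power2_eq_square algebra_simps)
qed auto

lemma L2_on_if_square_integrable:
  fixes f :: "real \<Rightarrow> 'a::euclidean_space"
  assumes f: "f \<in> borel_measurable borel" and i: "integrable lborel (\<lambda>t. (norm (f t))\<^sup>2)"
  shows "L2_on {a..b} f"
  unfolding L2_on_def
proof
  show "f \<in> borel_measurable (lebesgue_on {a..b})"
    using f by (intro measurable_restrict_space1 measurable_completion) auto
  have "integrable lebesgue (\<lambda>t. (norm (f t))\<^sup>2)" using i integrable_completion[of "\<lambda>t. (norm (f t))\<^sup>2" lborel] by auto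
  then show "integrable (lebesgue_on {a..b}) (\<lambda>t. (norm (f t))\<^sup>2)"
    using integrable_restrict_space[of "{a..b}" lebesgue "\<lambda>t. (norm (f t))\<^sup>2"]
      integrable_mult_indicator[of "{a..b}" lebesgue "\<lambda>t. (norm (f t))\<^sup>2"] by simp
qed

lemma square_integrable_imp_absolutely_integrable:
  fixes f :: "real \<Rightarrow> 'a::euclidean_space"
  assumes "f \<in> borel_measurable borel" "integrable lborel (\<lambda>t. (norm (f t))\<^sup>2)"
  shows "f absolutely_integrable_on {a..b}"
  by (rule absolutely_integrable_if_L2_on[OF L2_on_if_square_integrable[OF assms]])

lemma integral_norm_le_sqrt_length:
  fixes f :: "real \<Rightarrow> 'a::euclidean_space"
  assumes f: "L2_on {a..b} f" and M: "(LINT t|lebesgue_on {a..b}. (norm (f t))\<^sup>2) \<le> M"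
    and pq: "a \<le> p" "p < q" "q \<le> b"
  shows "integral {p..q} (\<lambda>t. norm (f t)) \<le> (M + 1) / 2 * sqrt (q - p)"
    and "f absolutely_integrable_on {a..b}"
proof -
  have fm: "f \<in> borel_measurable (lebesgue_on {a..b})" and f2: "integrable (lebesgue_on {a..b}) (\<lambda>t. (norm (f t))\<^sup>2)"
    using f by (auto simp: L2_on_def)
  have f2i: "(\<lambda>t. (norm (f t))\<^sup>2) integrable_on {a..b}"
    by (rule integrable_on_lebesgue_on[OF f2]) simp
  show fi: "f absolutely_integrable_on {a..b}" by (rule absolutely_integrable_if_L2_on[OF f])
  define e where "e = sqrt (q - p)"
  have e: "e > 0" "e * e = q - p" using pq by (auto simp: e_def)
  have sub: "{p..q} \<subseteq> {a..b}" using pq by auto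
  have i1: "(\<lambda>t. (norm (f t))\<^sup>2) integrable_on {p..q}" using integrable_on_subinterval[OF f2i sub] .
  have i2: "(\<lambda>t. norm (f t)) integrable_on {p..q}"
    using integrable_on_subinterval[OF _ sub] fi absolutely_integrable_on_def by blast
  have "integral {p..q} (\<lambda>t. norm (f t)) \<le> integral {p..q} (\<lambda>t. (e * (norm (f t))\<^sup>2 + inverse e) / 2)"
  proof (rule integral_le[OF i2])
    show "(\<lambda>t. (e * (norm (f t))\<^sup>2 + inverse e) / 2) integrable_on {p..q}"
      by (intro integrable_on_divide integrable_add integrable_on_mult_right i1) auto
    fix t
    have "0 \<le> (e * norm (f t) - 1)\<^sup>2" by simp
    also have "\<dots> = e * (e * (norm (f t))\<^sup>2 + inverse e - 2 * norm (f t))"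
      using e by (simp add: power2_eq_square algebra_simps)
    finally have "0 \<le> e * (norm (f t))\<^sup>2 + inverse e - 2 * norm (f t)"
      using e by (simp add: zero_le_mult_iff)
    then show "norm (f t) \<le> (e * (norm (f t))\<^sup>2 + inverse e) / 2" by simp
  qed
  also have "\<dots> = (e * integral {p..q} (\<lambda>t. (norm (f t))\<^sup>2) + (q - p) * inverse e) / 2"
  proof -
    have "((\<lambda>t. (e * (norm (f t))\<^sup>2 + inverse e) / 2) has_integral (e * integral {p..q} (\<lambda>t. (norm (f t))\<^sup>2) + (q - p) * inverse e) / 2) {p..q}"
      using pq by (intro has_integral_divide has_integral_add has_integral_mult_right integrable_integral i1)
        (use has_integral_const_real[of "inverse e" p q] in auto)
    then show ?thesis by (rule integral_unique)
  qed
  also have "(q - p) * inverse e = e" using e by (simp add: e(2)[symmetric])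
  also have "integral {p..q} (\<lambda>t. (norm (f t))\<^sup>2) \<le> M"
  proof -
    have "integral {p..q} (\<lambda>t. (norm (f t))\<^sup>2) \<le> integral {a..b} (\<lambda>t. (norm (f t))\<^sup>2)"
      by (intro integral_subset_le sub i1 f2i) auto
    also have "\<dots> = (LINT t|lebesgue_on {a..b}. (norm (f t))\<^sup>2)"
      by (rule lebesgue_integral_eq_integral[symmetric, OF f2]) simp
    finally show ?thesis using M by simp
  qed
  finally have "integral {p..q} (\<lambda>t. norm (f t)) \<le> (e * M + e) / 2" using e by (simp add: mult_left_mono)
  then show "integral {p..q} (\<lambda>t. norm (f t)) \<le> (M + 1) / 2 * sqrt (q - p)"
    by (simp add: e_def algebra_simps)
qed

definition diff_quot :: "(real \<Rightarrow> 'a::real_normed_vector) \<Rightarrow> real \<Rightarrow> real \<Rightarrow> 'a" where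
  "diff_quot f x y = (f y - f x) /\<^sub>R (y - x)"

lemma diff_quot_commute: "diff_quot f x y = diff_quot f y x"
  unfolding diff_quot_def
  by (metis minus_diff_eq inverse_minus_eq scaleR_minus_left scaleR_minus_right minus_minus)

lemma diff_quot_telescope:
  fixes x y z :: real
  assumes "x \<noteq> y" "y \<noteq> z" "x \<noteq> z"
  shows "diff_quot f x z - diff_quot f x y = ((z - y) / (z - x)) *\<^sub>R (diff_quot f y z - diff_quot f x y)"
proof -
  have e: "(z - x) * inverse (z - x) = 1" "(y - x) * inverse (y - x) = 1" "(z - y) * inverse (z - y) = 1"
    using assms by auto
  have 1: "(z - x) *\<^sub>R diff_quot f x z = f z - f x" "(y - x) *\<^sub>R diff_quot f x y = f y - f x"
    "(z - y) *\<^sub>R diff_quot f y z = f z - f y"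
    unfolding diff_quot_def scaleR_scaleR e by simp_all
  have "(z - x) *\<^sub>R (diff_quot f x z - diff_quot f x y) = (z - x) *\<^sub>R diff_quot f x z - (z - y) *\<^sub>R diff_quot f x y - (y - x) *\<^sub>R diff_quot f x y"
    by (simp add: algebra_simps)
  also have "\<dots> = (z - y) *\<^sub>R (diff_quot f y z - diff_quot f x y)"
    unfolding 1 scaleR_diff_right by simp
  also have "\<dots> = (z - x) *\<^sub>R (((z - y) / (z - x)) *\<^sub>R (diff_quot f y z - diff_quot f x y))"
    using assms by simp
  finally show ?thesis using assms by (simp only: scaleR_cancel_left) simp
qed

text \<open>This is what an \<open>L\<^sup>2\<close> bound on the second derivative leaves on difference quotients. Unlike the
  weak derivatives, which are only controlled for almost every \<open>t\<close>, it passes to every \<open>t\<close> by continuity.\<close>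

locale three_point =
  fixes f :: "real \<Rightarrow> 'a::euclidean_space" and L C :: real
  assumes C: "C \<ge> 0"
    and three: "\<And>p m q. 0 \<le> p \<Longrightarrow> p < m \<Longrightarrow> m < q \<Longrightarrow> q \<le> L \<Longrightarrow>
      norm (diff_quot f m q - diff_quot f p m) \<le> C * sqrt (q - p)"
begin

lemma same_base:
  assumes x: "x \<in> {0..L}" and y: "y \<in> {0..L}" "y \<noteq> x" and z: "z \<in> {0..L}" "z \<noteq> x"
    and h: "\<bar>y - x\<bar> \<le> h" "\<bar>z - x\<bar> \<le> h"
  shows "norm (diff_quot f x y - diff_quot f x z) \<le> C * sqrt (2 * h)"
proof -
  have mono: "C * sqrt d \<le> C * sqrt (2 * h)" if "d \<le> 2 * h" for d
    using that C by (intro mult_left_mono real_sqrt_le_mono) auto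
  have main: "norm (diff_quot f x y - diff_quot f x z) \<le> C * sqrt (2 * h)"
    if yz: "y < z" and y: "y \<in> {0..L}" "y \<noteq> x" and z: "z \<in> {0..L}" "z \<noteq> x"
      and h: "\<bar>y - x\<bar> \<le> h" "\<bar>z - x\<bar> \<le> h" for y z
  proof -
    consider "x < y" | "y < x" "x < z" | "z < x" using y z by linarith
    then show ?thesis
    proof cases
      case 1
      have "norm (diff_quot f x y - diff_quot f x z) = ((z - y) / (z - x)) * norm (diff_quot f y z - diff_quot f x y)"
        using diff_quot_telescope[of x y z f] 1 yz by (simp add: norm_minus_commute[of "diff_quot f x y"])
      also have "\<dots> \<le> 1 * (C * sqrt (z - x))"
        using three[of x y z] 1 yz x z C by (intro mult_mono) auto
      finally show ?thesis using mono[of "z - x"] h by linarith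
    next
      case 2
      have "norm (diff_quot f x z - diff_quot f y x) \<le> C * sqrt (z - y)"
        using three[of y x z] 2 y z by auto
      moreover have "C * sqrt (z - y) \<le> C * sqrt (2 * h)" using h by (intro mono) linarith
      ultimately show ?thesis by (simp add: norm_minus_commute diff_quot_commute[of f x y])
    next
      case 3
      have "diff_quot f x y - diff_quot f x z = ((y - z) / (y - x)) *\<^sub>R (diff_quot f z y - diff_quot f x z)"
        using diff_quot_telescope[of x z y f] 3 yz by simp
      then have "norm (diff_quot f x y - diff_quot f x z) = ((z - y) / (x - y)) * norm (diff_quot f z x - diff_quot f y z)"
      proof -
        have "(y - z) / (y - x) = (z - y) / (x - y)" using minus_divide_divide[of "z - y" "x - y"] by simp
        then have "\<bar>(y - z) / (y - x)\<bar> = (z - y) / (x - y)" using 3 yz by simp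
        moreover have "norm (diff_quot f z y - diff_quot f x z) = norm (diff_quot f z x - diff_quot f y z)"
          unfolding diff_quot_commute[of f z y] diff_quot_commute[of f x z] by (rule norm_minus_commute)
        ultimately show ?thesis
          unfolding \<open>diff_quot f x y - diff_quot f x z = _\<close> norm_scaleR by (simp only:)
      qed
      also have "\<dots> \<le> 1 * (C * sqrt (x - y))"
        using three[of y z x] 3 yz x y C by (intro mult_mono) auto
      finally show ?thesis using mono[of "x - y"] h by linarith
    qed
  qed
  show ?thesis
  proof (cases y z rule: linorder_cases)
    case less then show ?thesis using main y z h by blast
  next
    case equal
    have "0 \<le> C * sqrt (2 * h)" using C h by simp
    then show ?thesis using equal by simp
  next
    case greater
    then show ?thesis using main[of z y] y z h by (simp add: norm_minus_commute)
  qed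
qed

lemma derivative_estimate:
  assumes L: "L > 0" and x: "x \<in> {0..L}"
  shows "\<exists>d. \<forall>y\<in>{0..L} - {x}. norm (diff_quot f x y - d) \<le> C * sqrt (2 * \<bar>y - x\<bar>)"
proof -
  define y where "y n = (if x < L then x + (L - x) / real (Suc n) else x - L / real (Suc n))" for n
  have y: "y n \<in> {0..L}" "y n \<noteq> x" "\<bar>y n - x\<bar> \<le> L / real (Suc n)" for n
  proof -
    have "0 \<le> (L - x) / real (Suc n)" "(L - x) / real (Suc n) \<le> L - x" "(L - x) / real (Suc n) \<le> L / real (Suc n)"
      "0 < L / real (Suc n)" "L / real (Suc n) \<le> L"
      using x L by (auto simp: field_simps intro!: divide_right_mono mult_right_mono)
    moreover have "x < L \<Longrightarrow> 0 < (L - x) / real (Suc n)" by simp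
    ultimately show "y n \<in> {0..L}" "y n \<noteq> x" "\<bar>y n - x\<bar> \<le> L / real (Suc n)"
      using x unfolding y_def by (auto split: if_splits)
  qed
  have lim: "(\<lambda>n. L / real (Suc n)) \<longlonglongrightarrow> 0" by (rule LIMSEQ_Suc[OF lim_const_over_n])
  have lim2: "(\<lambda>n. C * sqrt (2 * (L / real (Suc n)))) \<longlonglongrightarrow> 0"
    using tendsto_mult[OF tendsto_const[of C] tendsto_real_sqrt[OF tendsto_mult[OF tendsto_const[of 2] lim]]] by simp
  have "Cauchy (\<lambda>n. diff_quot f x (y n))"
  proof (rule metric_CauchyI)
    fix e :: real assume "e > 0"
    then have "\<forall>\<^sub>F n in sequentially. C * sqrt (2 * (L / real (Suc n))) < e"
      using lim2 by (rule order_tendstoD(2)[rotated])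
    then obtain N where N: "C * sqrt (2 * (L / real (Suc N))) < e" by (auto simp: eventually_sequentially)
    have "dist (diff_quot f x (y m)) (diff_quot f x (y n)) < e" if "m \<ge> N" "n \<ge> N" for m n
    proof -
      have "L / real (Suc k) \<le> L / real (Suc N)" if "k \<ge> N" for k
        using that L by (intro divide_left_mono) auto
      then have "\<bar>y m - x\<bar> \<le> L / real (Suc N)" "\<bar>y n - x\<bar> \<le> L / real (Suc N)"
        using y(3)[of m] y(3)[of n] that by (meson order_trans)+
      then show ?thesis using same_base[OF x y(1,2) y(1,2)] N by (fastforce simp: dist_norm)
    qed
    then show "\<exists>M. \<forall>m\<ge>M. \<forall>n\<ge>M. dist (diff_quot f x (y m)) (diff_quot f x (y n)) < e" by blast
  qed
  then obtain d where d: "(\<lambda>n. diff_quot f x (y n)) \<longlonglongrightarrow> d"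
    using Cauchy_convergent convergent_def by blast
  have "norm (diff_quot f x z - d) \<le> C * sqrt (2 * \<bar>z - x\<bar>)" if z: "z \<in> {0..L} - {x}" for z
  proof (rule tendsto_upperbound)
    show "(\<lambda>n. norm (diff_quot f x z - diff_quot f x (y n))) \<longlonglongrightarrow> norm (diff_quot f x z - d)"
      by (intro tendsto_intros d)
    have "\<forall>\<^sub>F n in sequentially. L / real (Suc n) < \<bar>z - x\<bar>"
      by (rule order_tendstoD(2)[OF lim]) (use z in auto)
    then show "\<forall>\<^sub>F n in sequentially. norm (diff_quot f x z - diff_quot f x (y n)) \<le> C * sqrt (2 * \<bar>z - x\<bar>)"
    proof (rule eventually_mono)
      fix n assume n: "L / real (Suc n) < \<bar>z - x\<bar>"
      then show "norm (diff_quot f x z - diff_quot f x (y n)) \<le> C * sqrt (2 * \<bar>z - x\<bar>)"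
        using same_base[OF x _ _ y(1,2), of z "\<bar>z - x\<bar>"] z y(3)[of n] by auto
    qed
  qed auto
  then show ?thesis by blast
qed

end

lemma diff_quot_estimate_imp_derivative:
  fixes f :: "real \<Rightarrow> 'a::euclidean_space"
  assumes x: "x \<in> {0..L}" and C: "C \<ge> 0"
    and le: "\<And>y. y \<in> {0..L} - {x} \<Longrightarrow> norm (diff_quot f x y - d) \<le> C * sqrt (2 * \<bar>y - x\<bar>)"
  shows "(f has_vector_derivative d) (at x within {0..L})"
  unfolding has_vector_derivative_def has_derivative_within_alt
proof (intro conjI allI impI)
  show "bounded_linear (\<lambda>x. x *\<^sub>R d)" by (rule bounded_linear_scaleR_left)
  fix e :: real assume e: "e > 0"
  define D where "D = (e / (C + 1))\<^sup>2 / 2"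
  have D: "D > 0" using e C by (simp add: D_def)
  have "norm (f y - f x - (y - x) *\<^sub>R d) \<le> e * norm (y - x)" if y: "y \<in> {0..L}" "norm (y - x) < D" for y
  proof (cases "y = x")
    case False
    have "sqrt (2 * \<bar>y - x\<bar>) \<le> e / (C + 1)"
    proof (rule real_le_lsqrt)
      show "2 * \<bar>y - x\<bar> \<le> (e / (C + 1))\<^sup>2" using y by (simp add: D_def)
    qed (use e C in auto)
    then have "C * sqrt (2 * \<bar>y - x\<bar>) \<le> C * (e / (C + 1))" using C by (intro mult_left_mono)
    also have "\<dots> \<le> e" using e C by (simp add: field_simps)
    finally have *: "norm (diff_quot f x y - d) \<le> e" using le[of y] y False by simp
    have "f y - f x - (y - x) *\<^sub>R d = (y - x) *\<^sub>R (diff_quot f x y - d)"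
      using False by (simp add: diff_quot_def scaleR_diff_right)
    then show ?thesis using mult_left_mono[OF *, of "\<bar>y - x\<bar>"] by (simp add: mult.commute)
  qed simp
  then show "\<exists>d'>0. \<forall>y\<in>{0..L}. norm (y - x) < d' \<longrightarrow> norm (f y - f x - (y - x) *\<^sub>R d) \<le> e * norm (y - x)"
    using D by blast
qed

lemma space_derivative_continuous:
  fixes \<xi> :: "real \<Rightarrow> real \<Rightarrow> 'a::euclidean_space"
  assumes L: "L > 0" and C: "C \<ge> 0" and cont: "continuous_on ({0..L} \<times> S) (\<lambda>(s, t). \<xi> s t)"
    and tp: "\<And>t. t \<in> S \<Longrightarrow> three_point (\<lambda>s. \<xi> s t) L C"
  obtains d where "continuous_on ({0..L} \<times> S) (\<lambda>(s, t). d s t)"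
    "\<And>s t. s \<in> {0..L} \<Longrightarrow> t \<in> S \<Longrightarrow> ((\<lambda>\<sigma>. \<xi> \<sigma> t) has_vector_derivative d s t) (at s within {0..L})"
proof -
  have "\<exists>d. \<forall>y\<in>{0..L} - {s}. norm (diff_quot (\<lambda>s. \<xi> s t) s y - d) \<le> C * sqrt (2 * \<bar>y - s\<bar>)"
    if "s \<in> {0..L}" "t \<in> S" for s t
    using three_point.derivative_estimate[OF tp[OF that(2)] L that(1)] .
  then obtain d where d: "\<And>s t y. s \<in> {0..L} \<Longrightarrow> t \<in> S \<Longrightarrow> y \<in> {0..L} - {s} \<Longrightarrow>
      norm (diff_quot (\<lambda>s. \<xi> s t) s y - d s t) \<le> C * sqrt (2 * \<bar>y - s\<bar>)"
    by metis
  have "continuous_on ({0..L} \<times> S) (\<lambda>(s, t). d s t)"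
    unfolding continuous_on_iff
  proof (clarify)
    fix s t and e :: real assume st: "s \<in> {0..L}" "t \<in> S" and e: "e > 0"
    define h where "h = min L ((e / (3 * (C + 1)))\<^sup>2 / 4)"
    have h: "h > 0" "h \<le> L" using L e C by (auto simp: h_def)
    have sq: "C * sqrt (4 * h) < e / 3"
    proof -
      have "4 * h \<le> (e / (3 * (C + 1)))\<^sup>2" by (simp add: h_def min_def)
      then have "sqrt (4 * h) \<le> e / (3 * (C + 1))" using e C by (intro real_le_lsqrt) auto
      then have "C * sqrt (4 * h) \<le> C * (e / (3 * (C + 1)))" using C by (intro mult_left_mono)
      also have "\<dots> < e / 3" using e C by (simp add: field_simps)
      finally show ?thesis .
    qed
    define y where "y = (if s + h / 2 \<le> L then s + h / 2 else s - h / 2)"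
    have y: "y \<in> {0..L}" "\<bar>y - s\<bar> = h / 2" using h st by (auto simp: y_def)
    have cq: "continuous_on (({0..L} \<inter> ball s (h / 2)) \<times> S) (\<lambda>(s, t). diff_quot (\<lambda>s. \<xi> s t) s y)"
    proof -
      have 1: "continuous_on (({0..L} \<inter> ball s (h / 2)) \<times> S) (\<lambda>z. \<xi> (fst z) (snd z))"
        by (rule continuous_on_subset[of "{0..L} \<times> S"]) (use cont in \<open>auto simp: split_def\<close>)
      have "continuous_on (({0..L} \<inter> ball s (h / 2)) \<times> S) (\<lambda>z. (y, snd z))" by (intro continuous_intros)
      from continuous_on_compose2[OF cont this]
      have 2: "continuous_on (({0..L} \<inter> ball s (h / 2)) \<times> S) (\<lambda>z. \<xi> y (snd z))" using y(1) by fastforce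
      have "y - fst z \<noteq> 0" if "z \<in> ({0..L} \<inter> ball s (h / 2)) \<times> S" for z
        using that y by (auto simp: dist_real_def)
      then show ?thesis unfolding split_def diff_quot_def by (intro continuous_intros 1 2) auto
    qed
    have st2: "(s, t) \<in> ({0..L} \<inter> ball s (h / 2)) \<times> S" using st h by auto
    have e3: "e / 3 > 0" using e by simp
    from cq[unfolded continuous_on_iff, rule_format, OF st2 e3]
    obtain r where r0: "r > 0" and r1: "\<forall>z\<in>({0..L} \<inter> ball s (h / 2)) \<times> S. dist z (s, t) < r \<longrightarrow>
        dist (case z of (s, t) \<Rightarrow> diff_quot (\<lambda>s. \<xi> s t) s y) (case (s, t) of (s, t) \<Rightarrow> diff_quot (\<lambda>s. \<xi> s t) s y) < e / 3"
      by (elim exE conjE)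
    have r: "dist (diff_quot (\<lambda>s. \<xi> s t') s' y) (diff_quot (\<lambda>s. \<xi> s t) s y) < e / 3"
      if "(s', t') \<in> ({0..L} \<inter> ball s (h / 2)) \<times> S" "dist (s', t') (s, t) < r" for s' t'
      using bspec[OF r1 that(1)] that(2) by simp
    have fin: "dist (d s' t') (d s t) < e" if st': "s' \<in> {0..L}" "t' \<in> S" and dd: "dist (s', t') (s, t) < min r (h / 2)" for s' t'
    proof -
      have s's: "dist s' s < h / 2" using dd dist_fst_le[of "(s', t')" "(s, t)"] by simp
      have "\<bar>y - s'\<bar> \<le> 2 * h" "\<bar>y - s\<bar> \<le> 2 * h" "y \<noteq> s'" "y \<noteq> s"
        using y(2) s's h unfolding dist_real_def by linarith+
      have b: "norm (diff_quot (\<lambda>s. \<xi> s \<tau>) \<sigma> y - d \<sigma> \<tau>) < e / 3"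
        if "\<sigma> \<in> {0..L}" "\<tau> \<in> S" "\<bar>y - \<sigma>\<bar> \<le> 2 * h" "y \<noteq> \<sigma>" for \<sigma> \<tau>
      proof -
        have "C * sqrt (2 * \<bar>y - \<sigma>\<bar>) \<le> C * sqrt (4 * h)" using that C by (intro mult_left_mono real_sqrt_le_mono) auto
        then show ?thesis using d[OF that(1,2), of y] y that sq by auto
      qed
      have "dist (diff_quot (\<lambda>s. \<xi> s t') s' y) (diff_quot (\<lambda>s. \<xi> s t) s y) < e / 3"
        by (rule r) (use st' s's dd in \<open>auto simp: dist_commute\<close>)
      moreover have "dist (d s' t') (diff_quot (\<lambda>s. \<xi> s t') s' y) < e / 3"
        unfolding dist_norm norm_minus_commute[of "d s' t'"] by (rule b; fact)
      moreover have "dist (diff_quot (\<lambda>s. \<xi> s t) s y) (d s t) < e / 3"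
        unfolding dist_norm by (rule b; fact)
      ultimately show ?thesis
        by (blast intro: dist_triangle_third)
    qed
    have "min r (h / 2) > 0" using r0 h by simp
    then show "\<exists>r>0. \<forall>x'\<in>{0..L} \<times> S. dist x' (s, t) < r \<longrightarrow> dist (case x' of (s, t) \<Rightarrow> d s t) (d s t) < e"
    proof (intro exI conjI ballI impI)
      fix z assume z: "z \<in> {0..L} \<times> S" "dist z (s, t) < min r (h / 2)"
      obtain s' t' where "z = (s', t')" by (cases z)
      with z fin[of s' t'] show "dist (case z of (s, t) \<Rightarrow> d s t) (d s t) < e"
        by (simp only: mem_Times_iff fst_conv snd_conv case_prod_conv)
    qed
  qed
  moreover have "((\<lambda>\<sigma>. \<xi> \<sigma> t) has_vector_derivative d s t) (at s within {0..L})" if "s \<in> {0..L}" "t \<in> S" for s t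
    by (rule diff_quot_estimate_imp_derivative[OF that(1) C]) (use d that in blast)
  ultimately show ?thesis using that by blast
qed

lemma continuous_on_slices:
  assumes "continuous_on (A \<times> B) (\<lambda>(s, t). f s t)"
  shows "t \<in> B \<Longrightarrow> continuous_on A (\<lambda>s. f s t)" and "s \<in> A \<Longrightarrow> continuous_on B (\<lambda>t. f s t)"
proof -
  show "continuous_on A (\<lambda>s. f s t)" if "t \<in> B"
  proof -
    have "continuous_on A (\<lambda>s. case (s, t) of (s, t) \<Rightarrow> f s t)"
      by (rule continuous_on_compose2[OF assms]) (use that in \<open>auto intro!: continuous_intros\<close>)
    then show ?thesis by simp
  qed
  show "continuous_on B (\<lambda>t. f s t)" if "s \<in> A"
  proof -
    have "continuous_on B (\<lambda>t. case (s, t) of (s, t) \<Rightarrow> f s t)"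
      by (rule continuous_on_compose2[OF assms]) (use that in \<open>auto intro!: continuous_intros\<close>)
    then show ?thesis by simp
  qed
qed

lemma space_X_three_point:
  assumes L: "L > 0" and T: "T > 0" and \<eta>: "\<eta> \<in> space_X L T"
  obtains C where "C \<ge> 0" "\<And>t. t \<in> {0..T} \<Longrightarrow> three_point (\<lambda>s. \<eta> s t) L C"
proof -
  have cont: "continuous_on ({0..L} \<times> {0..T}) (\<lambda>(s, t). \<eta> s t)" and "Linf_H2 L T \<eta>"
    using \<eta> by (auto simp: space_X_def)
  then obtain \<eta>1 \<eta>2 M where ae: "AE t in lebesgue_on {0..T}.
        L2_on {0..L} (\<lambda>s. \<eta> s t) \<and> L2_on {0..L} (\<lambda>s. \<eta>1 s t) \<and> L2_on {0..L} (\<lambda>s. \<eta>2 s t) \<and>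
        has_weak_derivative 0 L (\<lambda>s. \<eta> s t) (\<lambda>s. \<eta>1 s t) \<and>
        has_weak_derivative 0 L (\<lambda>s. \<eta>1 s t) (\<lambda>s. \<eta>2 s t) \<and>
        (LINT s|lebesgue_on {0..L}. (norm (\<eta> s t))\<^sup>2)
          + (LINT s|lebesgue_on {0..L}. (norm (\<eta>1 s t))\<^sup>2)
          + (LINT s|lebesgue_on {0..L}. (norm (\<eta>2 s t))\<^sup>2) \<le> M" (is "AE t in _. ?P t")
    unfolding Linf_H2_def by blast
  define C where "C = (\<bar>M\<bar> + 1) / 2"
  have C: "C \<ge> 0" by (simp add: C_def)
  note cs = continuous_on_slices(1)[OF cont] and ct = continuous_on_slices(2)[OF cont]
  have int: "norm (diff_quot (\<lambda>s. \<eta> s t) m q - diff_quot (\<lambda>s. \<eta> s t) p m) \<le> C * sqrt (q - p)"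
    if t: "?P t" "t \<in> {0..T}" and pq: "0 < p" "p < m" "m < q" "q < L" for t p m q
  proof -
    have nn: "0 \<le> (LINT s|lebesgue_on {0..L}. (norm (\<eta> s t))\<^sup>2)" "0 \<le> (LINT s|lebesgue_on {0..L}. (norm (\<eta>1 s t))\<^sup>2)"
      by (auto intro!: integral_nonneg_AE)
    then have M: "(LINT s|lebesgue_on {0..L}. (norm (\<eta>2 s t))\<^sup>2) \<le> \<bar>M\<bar>" using t(1) by linarith
    have L2: "L2_on {0..L} (\<lambda>s. \<eta>2 s t)" using t(1) by blast
    have b: "integral {p..q} (\<lambda>s. norm (\<eta>2 s t)) \<le> C * sqrt (q - p)"
      and ai: "(\<lambda>s. \<eta>2 s t) absolutely_integrable_on {0..L}"
      using integral_norm_le_sqrt_length[OF L2 M, of p q] pq by (auto simp: C_def)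
    have "norm ((\<eta> q t - \<eta> m t) /\<^sub>R (q - m) - (\<eta> m t - \<eta> p t) /\<^sub>R (m - p)) \<le> integral {p..q} (\<lambda>s. norm (\<eta>2 s t))"
    proof -
      have "has_weak_derivative 0 L (\<lambda>s. \<eta> s t) (\<lambda>s. \<eta>1 s t)" "has_weak_derivative 0 L (\<lambda>s. \<eta>1 s t) (\<lambda>s. \<eta>2 s t)"
        using t(1) by blast+
      from difference_quotient_bound[OF cs[OF t(2)] this ai pq] show ?thesis .
    qed
    then show ?thesis using b by (simp add: diff_quot_def)
  qed
  have int2: "norm (diff_quot (\<lambda>s. \<eta> s t) m q - diff_quot (\<lambda>s. \<eta> s t) p m) \<le> C * sqrt (q - p)"
    if t: "t \<in> {0..T}" and pq: "0 < p" "p < m" "m < q" "q < L" for t p m q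
  proof (rule continuous_on_closure_norm_le[where s="{t \<in> {0..T}. ?P t}" and x=t
      and f="\<lambda>t. diff_quot (\<lambda>s. \<eta> s t) m q - diff_quot (\<lambda>s. \<eta> s t) p m"])
    show "t \<in> closure {t \<in> {0..T}. ?P t}" using subset_closure_AE[OF T ae] t by blast
    have "closure {t \<in> {0..T}. ?P t} \<subseteq> {0..T}" by (rule closure_minimal) auto
    moreover have "continuous_on {0..T} (\<lambda>t. diff_quot (\<lambda>s. \<eta> s t) m q - diff_quot (\<lambda>s. \<eta> s t) p m)"
      unfolding diff_quot_def by (intro continuous_intros ct) (use pq in auto)
    ultimately show "continuous_on (closure {t \<in> {0..T}. ?P t}) (\<lambda>t. diff_quot (\<lambda>s. \<eta> s t) m q - diff_quot (\<lambda>s. \<eta> s t) p m)"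
      using continuous_on_subset by blast
  qed (use int pq in blast)
  have "three_point (\<lambda>s. \<eta> s t) L C" if t: "t \<in> {0..T}" for t
  proof
    show "0 \<le> C" by (rule C)
    fix p m q assume pq: "0 \<le> p" "p < m" "m < q" "q \<le> L"
    define P where "P e = m + (1 - e) * (p - m)" for e
    define Q where "Q e = m + (1 - e) * (q - m)" for e
    have PQ: "0 < P e" "P e < m" "m < Q e" "Q e < L" "Q e - P e \<le> q - p" if "e \<in> {0<..<1}" for e
    proof -
      have "(1 - e) * (m - p) < m - p" "(1 - e) * (q - m) < q - m" "0 < (1 - e) * (m - p)" "0 < (1 - e) * (q - m)"
        using that pq by auto
      moreover have "(1 - e) * (p - m) = - ((1 - e) * (m - p))" by (simp add: algebra_simps)
      ultimately show "0 < P e" "P e < m" "m < Q e" "Q e < L" "Q e - P e \<le> q - p"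
        unfolding P_def Q_def using pq by linarith+
    qed
    have PQ01: "P e \<in> {0..L}" "Q e \<in> {0..L}" "P e \<noteq> m \<or> e = 1" "Q e \<noteq> m \<or> e = 1" if "e \<in> {0..1}" for e
    proof -
      have "(1 - e) * (m - p) \<le> m - p" "(1 - e) * (q - m) \<le> q - m" "0 \<le> (1 - e) * (m - p)" "0 \<le> (1 - e) * (q - m)"
        using that pq by (auto simp: mult_left_le_one_le)
      moreover have "(1 - e) * (p - m) = - ((1 - e) * (m - p))" by (simp add: algebra_simps)
      ultimately show "P e \<in> {0..L}" "Q e \<in> {0..L}" unfolding P_def Q_def atLeastAtMost_iff using pq by linarith+
      show "P e \<noteq> m \<or> e = 1" "Q e \<noteq> m \<or> e = 1" unfolding P_def Q_def using pq by auto
    qed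
    have cl2: "closure {0<..<1/2} = {0..1/2::real}" by simp
    have "norm (diff_quot (\<lambda>s. \<eta> s t) m (Q 0) - diff_quot (\<lambda>s. \<eta> s t) (P 0) m) \<le> C * sqrt (q - p)"
    proof (rule continuous_on_closure_norm_le[where s="{0<..<1/2::real}" and f="\<lambda>e. diff_quot (\<lambda>s. \<eta> s t) m (Q e) - diff_quot (\<lambda>s. \<eta> s t) (P e) m"])
      have cP: "continuous_on {0..1/2} P" and cQ: "continuous_on {0..1/2} Q"
        unfolding P_def Q_def by (intro continuous_intros)+
      have c\<eta>: "continuous_on {0..1/2} (\<lambda>e. \<eta> (P e) t)" "continuous_on {0..1/2} (\<lambda>e. \<eta> (Q e) t)"
        by (rule continuous_on_compose2[OF cs[OF t] cP], use PQ01(1) in auto)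
          (rule continuous_on_compose2[OF cs[OF t] cQ], use PQ01(2) in auto)
      have nz: "\<forall>e\<in>{0..1/2}. m - P e \<noteq> 0" "\<forall>e\<in>{0..1/2}. Q e - m \<noteq> 0"
      proof -
        have "P e \<noteq> m \<and> Q e \<noteq> m" if "e \<in> {0..1/2}" for e
        proof -
          have "e \<in> {0..1}" "e \<noteq> 1" using that by auto
          then show ?thesis using PQ01(3,4)[of e] by blast
        qed
        then show "\<forall>e\<in>{0..1/2}. m - P e \<noteq> 0" "\<forall>e\<in>{0..1/2}. Q e - m \<noteq> 0" by fastforce+
      qed
      show "continuous_on (closure {0<..<1/2::real}) (\<lambda>e. diff_quot (\<lambda>s. \<eta> s t) m (Q e) - diff_quot (\<lambda>s. \<eta> s t) (P e) m)"
        unfolding cl2 diff_quot_def by (intro continuous_intros cP cQ c\<eta> nz)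
      show "\<forall>y\<in>{0<..<1/2}. norm (diff_quot (\<lambda>s. \<eta> s t) m (Q y) - diff_quot (\<lambda>s. \<eta> s t) (P y) m) \<le> C * sqrt (q - p)"
      proof
        fix e :: real assume "e \<in> {0<..<1/2}"
        then have e: "e \<in> {0<..<1}" by auto
        have "norm (diff_quot (\<lambda>s. \<eta> s t) m (Q e) - diff_quot (\<lambda>s. \<eta> s t) (P e) m) \<le> C * sqrt (Q e - P e)"
          using PQ[OF e] by (intro int2 t)
        also have "\<dots> \<le> C * sqrt (q - p)" using PQ[OF e] C by (intro mult_left_mono real_sqrt_le_mono)
        finally show "norm (diff_quot (\<lambda>s. \<eta> s t) m (Q e) - diff_quot (\<lambda>s. \<eta> s t) (P e) m) \<le> C * sqrt (q - p)" .
      qed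
    qed (simp add: cl2)
    then show "norm (diff_quot (\<lambda>s. \<eta> s t) m q - diff_quot (\<lambda>s. \<eta> s t) p m) \<le> C * sqrt (q - p)"
      by (simp add: P_def Q_def)
  qed
  then show ?thesis using that C by blast
qed

lemma space_X_space_derivative:
  assumes L: "L > 0" and T: "T > 0" and \<eta>: "\<eta> \<in> space_X L T"
  shows "continuous_on ({0..L} \<times> {0..T}) (\<lambda>(s, t). space_derivative L \<eta> s t)"
    and "\<And>s t. s \<in> {0..L} \<Longrightarrow> t \<in> {0..T} \<Longrightarrow>
      ((\<lambda>\<sigma>. \<eta> \<sigma> t) has_vector_derivative space_derivative L \<eta> s t) (at s within {0..L})"
proof -
  have cont: "continuous_on ({0..L} \<times> {0..T}) (\<lambda>(s, t). \<eta> s t)" using \<eta> by (auto simp: space_X_def)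
  obtain C where C: "C \<ge> 0" "\<And>t. t \<in> {0..T} \<Longrightarrow> three_point (\<lambda>s. \<eta> s t) L C"
    using space_X_three_point[OF assms] by blast
  obtain d where d: "continuous_on ({0..L} \<times> {0..T}) (\<lambda>(s, t). d s t)"
    "\<And>s t. s \<in> {0..L} \<Longrightarrow> t \<in> {0..T} \<Longrightarrow> ((\<lambda>\<sigma>. \<eta> \<sigma> t) has_vector_derivative d s t) (at s within {0..L})"
    by (rule space_derivative_continuous[OF L C(1) cont C(2)]) auto
  have eq: "space_derivative L \<eta> s t = d s t" if "s \<in> {0..L}" "t \<in> {0..T}" for s t
    unfolding space_derivative_def by (rule vector_derivative_within_closed_interval[OF L that(1) d(2)[OF that]])
  show "continuous_on ({0..L} \<times> {0..T}) (\<lambda>(s, t). space_derivative L \<eta> s t)"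
    using d(1) by (rule continuous_on_eq) (auto simp: eq)
  show "((\<lambda>\<sigma>. \<eta> \<sigma> t) has_vector_derivative space_derivative L \<eta> s t) (at s within {0..L})"
    if "s \<in> {0..L}" "t \<in> {0..T}" for s t using d(2)[OF that] eq[OF that] by simp
qed

section \<open>Pointwise time derivatives\<close>

lemma AE_lebesgue_on_iff_lborel:
  assumes "S \<in> sets lebesgue"
  shows "(AE x in lebesgue_on S. P x) \<longleftrightarrow> (AE x in lborel. x \<in> S \<longrightarrow> P x)"
proof -
  have "(AE x in lebesgue_on S. P x) \<longleftrightarrow> (AE x in lebesgue. x \<in> S \<longrightarrow> P x)"
    using assms by (intro AE_restrict_space_iff) auto
  then show ?thesis by (simp add: AE_completion_iff)
qed

lemma AE_lborel_pairD:
  assumes "AE z in (lborel :: ('a::euclidean_space \<times> 'b::euclidean_space) measure). Q z"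
  shows "AE x in lborel. AE y in lborel. Q (x, y)" and "AE y in lborel. AE x in lborel. Q (x, y)"
proof -
  obtain N where N: "N \<in> null_sets (lborel :: ('a \<times> 'b) measure)" "{z. \<not> Q z} \<subseteq> N"
    using assms by (auto simp: eventually_ae_filter)
  have ae: "AE x in lborel. AE y in lborel. (x, y) \<notin> N"
    using lborel_pair.AE_pair[of "\<lambda>z. z \<notin> N", unfolded lborel_prod] AE_not_in[OF N(1)] by blast
  moreover have "{z \<in> space (lborel \<Otimes>\<^sub>M lborel). (fst z, snd z) \<notin> N} \<in> sets (lborel \<Otimes>\<^sub>M lborel)"
    using borel_comp[of N] null_setsD2[OF N(1)] unfolding lborel_prod by (simp add: Collect_neg_eq)
  ultimately have ae': "AE y in lborel. AE x in lborel. (x, y) \<notin> N"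
    using lborel_pair.AE_commute[of "\<lambda>x y. (x, y) \<notin> N"] by blast
  have Q: "Q z" if "z \<notin> N" for z using N(2) that by blast
  show "AE x in lborel. AE y in lborel. Q (x, y)"
    using ae by (rule eventually_mono) (erule eventually_mono, erule Q)
  show "AE y in lborel. AE x in lborel. Q (x, y)"
    using ae' by (rule eventually_mono) (erule eventually_mono, erule Q)
qed

lemma lebesgue_measurable_ex_borel:
  fixes f :: "'a::euclidean_space \<Rightarrow> 'b::euclidean_space"
  assumes "f \<in> borel_measurable lebesgue"
  obtains g where "g \<in> borel_measurable borel" "AE x in lborel. f x = g x"
proof -
  have "\<exists>g'\<in>borel_measurable lborel. (AE x in lborel. f x \<bullet> i = g' x)" for i
    by (rule completion_ex_borel_measurable_real) (use assms in simp)
  then obtain h where h: "\<And>i. h i \<in> borel_measurable lborel" "\<And>i. AE x in lborel. f x \<bullet> i = h i x" by metis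
  have "AE x in lborel. \<forall>i\<in>Basis. f x \<bullet> i = h i x"
    by (rule AE_ball_countable') (auto intro: h countable_finite)
  then have "AE x in lborel. f x = (\<Sum>i\<in>Basis. h i x *\<^sub>R i)"
  proof (rule eventually_mono)
    fix x assume *: "\<forall>i\<in>Basis. f x \<bullet> i = h i x"
    have "f x = (\<Sum>i\<in>Basis. (f x \<bullet> i) *\<^sub>R i)" by (simp add: euclidean_representation)
    also have "\<dots> = (\<Sum>i\<in>Basis. h i x *\<^sub>R i)" using * by (intro sum.cong) auto
    finally show "f x = (\<Sum>i\<in>Basis. h i x *\<^sub>R i)" .
  qed
  moreover have "(\<lambda>x. \<Sum>i\<in>Basis. h i x *\<^sub>R i) \<in> borel_measurable borel"
    using h(1) by (intro borel_measurable_sum borel_measurable_scaleR) auto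
  ultimately show ?thesis using that by blast
qed

text \<open>Countable quantifiers make the set of points of differentiability Borel, which is needed to
  exchange "almost every \<open>s\<close>" and "almost every \<open>t\<close>" by Fubini's theorem.\<close>

lemma has_vector_derivative_at_iff_rat:
  fixes F :: "real \<Rightarrow> 'a::euclidean_space"
  assumes F: "continuous_on UNIV F"
  shows "(F has_vector_derivative d) (at t) \<longleftrightarrow>
    (\<forall>k::nat. \<exists>m::nat. \<forall>h::rat. \<bar>of_rat h\<bar> < 1 / real (Suc m) \<longrightarrow>
      norm (F (t + of_rat h) - F t - of_rat h *\<^sub>R d) \<le> \<bar>of_rat h\<bar> / real (Suc k))" (is "?l \<longleftrightarrow> ?r")
proof
  assume ?l
  then have *: "\<forall>e>0. \<exists>r>0. \<forall>y. norm (y - t) < r \<longrightarrow> norm (F y - F t - (y - t) *\<^sub>R d) \<le> e * norm (y - t)"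
    by (simp add: has_vector_derivative_def has_derivative_at_alt)
  show ?r
  proof
    fix k :: nat
    obtain r where r: "r > 0" "\<And>y. norm (y - t) < r \<Longrightarrow> norm (F y - F t - (y - t) *\<^sub>R d) \<le> 1 / real (Suc k) * norm (y - t)"
      using *[rule_format, of "1 / real (Suc k)"] by auto
    obtain m where m: "1 / real (Suc m) < r" using r(1) nat_approx_posE by blast
    show "\<exists>m::nat. \<forall>h::rat. \<bar>of_rat h\<bar> < 1 / real (Suc m) \<longrightarrow>
      norm (F (t + of_rat h) - F t - of_rat h *\<^sub>R d) \<le> \<bar>of_rat h\<bar> / real (Suc k)"
    proof (intro exI allI impI)
      fix h :: rat assume "\<bar>of_rat h\<bar> < 1 / real (Suc m)"
      then show "norm (F (t + of_rat h) - F t - of_rat h *\<^sub>R d) \<le> \<bar>of_rat h\<bar> / real (Suc k)"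
        using r(2)[of "t + of_rat h"] m by simp
    qed
  qed
next
  assume r: ?r
  show ?l unfolding has_vector_derivative_def has_derivative_at_alt
  proof (intro conjI allI impI)
    show "bounded_linear (\<lambda>x. x *\<^sub>R d)" by (rule bounded_linear_scaleR_left)
    fix e :: real assume "e > 0"
    then obtain k where k: "1 / real (Suc k) < e" using nat_approx_posE by blast
    obtain m where m: "\<And>h::rat. \<bar>of_rat h\<bar> < 1 / real (Suc m) \<Longrightarrow>
      norm (F (t + of_rat h) - F t - of_rat h *\<^sub>R d) \<le> \<bar>of_rat h\<bar> / real (Suc k)"
      using r by blast
    let ?S = "ball 0 (1 / real (Suc m)) \<inter> (\<rat> :: real set)"
    have le: "norm (F (t + h) - F t - h *\<^sub>R d) - \<bar>h\<bar> / real (Suc k) \<le> 0" if h: "h \<in> ball 0 (1 / real (Suc m))" for h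
    proof (rule continuous_le_on_closure[where S="?S" and x=h and f="\<lambda>h. norm (F (t + h) - F t - h *\<^sub>R d) - \<bar>h\<bar> / real (Suc k)"])
      have "continuous_on UNIV (\<lambda>h. F (t + h))"
        by (rule continuous_on_compose2[OF F]) (auto intro!: continuous_intros)
      then have "continuous_on UNIV (\<lambda>h. norm (F (t + h) - F t - h *\<^sub>R d) - \<bar>h\<bar> / real (Suc k))"
        by (intro continuous_intros) auto
      then show "continuous_on (closure ?S) (\<lambda>h. norm (F (t + h) - F t - h *\<^sub>R d) - \<bar>h\<bar> / real (Suc k))"
        using continuous_on_subset by blast
      have "closure ?S = closure (ball 0 (1 / real (Suc m)))"
        by (rule closure_open_Int_superset) (simp_all only: Rats_closure_real open_ball subset_UNIV)
      then show "h \<in> closure ?S" using h closure_subset by blast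
      fix x assume "x \<in> ?S"
      then obtain q where "x = of_rat q" "\<bar>x\<bar> < 1 / real (Suc m)" by (auto elim!: Rats_cases)
      then show "norm (F (t + x) - F t - x *\<^sub>R d) - \<bar>x\<bar> / real (Suc k) \<le> 0" using m[of q] by simp
    qed
    have "norm (F y - F t - (y - t) *\<^sub>R d) \<le> e * norm (y - t)" if "norm (y - t) < 1 / real (Suc m)" for y
    proof -
      have "norm (F y - F t - (y - t) *\<^sub>R d) \<le> \<bar>y - t\<bar> / real (Suc k)" using le[of "y - t"] that by simp
      also have "\<dots> = 1 / real (Suc k) * \<bar>y - t\<bar>" by simp
      also have "\<dots> \<le> e * \<bar>y - t\<bar>" using k by (intro mult_right_mono) auto
      finally show ?thesis by simp
    qed
    moreover have "0 < 1 / real (Suc m)" by simp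
    ultimately show "\<exists>r>0. \<forall>y. norm (y - t) < r \<longrightarrow> norm (F y - F t - (y - t) *\<^sub>R d) \<le> e * norm (y - t)"
      by blast
  qed
qed

lemma sets_has_vector_derivative:
  fixes F g :: "real \<times> real \<Rightarrow> 'a::euclidean_space"
  assumes F: "continuous_on UNIV F" and g: "g \<in> borel_measurable borel"
  shows "{z. ((\<lambda>\<tau>. F (fst z, \<tau>)) has_vector_derivative g z) (at (snd z))} \<in> sets borel"
proof -
  have [measurable]: "g \<in> borel_measurable borel" by (rule g)
  have [measurable]: "F \<in> borel_measurable borel" using F by (rule borel_measurable_continuous_onI)
  have [measurable]: "(\<lambda>z. F (fst z, snd z + of_rat h)) \<in> borel_measurable borel" for h :: rat
    by (intro borel_measurable_continuous_onI continuous_on_compose2[OF F] continuous_intros) auto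
  have "continuous_on UNIV (\<lambda>\<tau>. F (s, \<tau>))" for s
    by (intro continuous_on_compose2[OF F] continuous_intros) auto
  then have "{z. ((\<lambda>\<tau>. F (fst z, \<tau>)) has_vector_derivative g z) (at (snd z))} =
    {z \<in> space borel. \<forall>k::nat. \<exists>m::nat. \<forall>h::rat. \<bar>of_rat h\<bar> < 1 / real (Suc m) \<longrightarrow>
      norm (F (fst z, snd z + of_rat h) - F z - of_rat h *\<^sub>R g z) \<le> \<bar>of_rat h\<bar> / real (Suc k)}"
    by (subst has_vector_derivative_at_iff_rat) auto
  also have "\<dots> \<in> sets borel" by measurable
  finally show ?thesis .
qed

lemma continuous_extension_rectangle:
  fixes f :: "real \<Rightarrow> real \<Rightarrow> 'a::euclidean_space"
  assumes "0 \<le> L" "0 \<le> T" "continuous_on ({0..L} \<times> {0..T}) (\<lambda>(s, t). f s t)"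
  obtains F where "continuous_on UNIV F" "\<And>s t. s \<in> {0..L} \<Longrightarrow> t \<in> {0..T} \<Longrightarrow> F (s, t) = f s t"
    "bounded (range F)"
proof -
  have cb: "cbox (0, 0) (L, T) = {0..L} \<times> {0..T}" by (simp add: cbox_Pair_eq)
  let ?F = "ext_cont (\<lambda>(s, t). f s t) (0, 0) (L, T)"
  have "continuous_on UNIV ?F"
    by (rule continuous_on_ext_cont) (use assms(3) cb in simp)
  moreover have "?F (s, t) = f s t" if "s \<in> {0..L}" "t \<in> {0..T}" for s t
    using ext_cont_cancel_cbox[of "(s, t)" "(0, 0)" "(L, T)" "\<lambda>(s, t). f s t"] that cb by simp
  moreover have "bounded (range ?F)"
  proof -
    have "bounded ((\<lambda>(s, t). f s t) ` ({0..L} \<times> {0..T}))"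
      by (intro compact_imp_bounded compact_continuous_image assms(3) compact_Times) auto
    moreover have "range ?F \<subseteq> (\<lambda>(s, t). f s t) ` ({0..L} \<times> {0..T})"
      unfolding ext_cont_def cb[symmetric]
      by (intro image_subsetI imageI clamp_in_interval) (use assms in \<open>auto simp: Basis_prod_def\<close>)
    ultimately show ?thesis using bounded_subset by blast
  qed
  ultimately show ?thesis using that by blast
qed

definition rect :: "real \<Rightarrow> real \<Rightarrow> (real \<times> real) set" where "rect L T = {0..L} \<times> {0..T}"

lemma rect_borel[measurable]: "rect L T \<in> sets borel"
  unfolding rect_def by (intro borel_closed closed_Times) auto

lemma L2_on_rect_borel_version:
  fixes g :: "real \<Rightarrow> real \<Rightarrow> 'a::euclidean_space"
  assumes g: "L2_on ({0..L} \<times> {0..T}) (\<lambda>(s, t). g s t)"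
  obtains g0 where "g0 \<in> borel_measurable borel" "\<forall>z. z \<notin> rect L T \<longrightarrow> g0 z = 0"
    "integrable lborel (\<lambda>z. (norm (g0 z))\<^sup>2)"
    "AE z in lborel. z \<in> rect L T \<longrightarrow> g (fst z) (snd z) = g0 z"
proof -
  have R: "rect L T \<in> sets lebesgue" using rect_borel by simp
  have gm: "(\<lambda>z. g (fst z) (snd z)) \<in> borel_measurable (lebesgue_on (rect L T))"
    and gi: "integrable (lebesgue_on (rect L T)) (\<lambda>z. (norm (g (fst z) (snd z)))\<^sup>2)"
    using g by (auto simp: L2_on_def rect_def split_def)
  let ?f = "\<lambda>z. indicat_real (rect L T) z *\<^sub>R g (fst z) (snd z)"
  have "?f \<in> borel_measurable lebesgue"
    by (subst borel_measurable_restrict_space_iff[symmetric]) (use R gm in auto)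
  then obtain h where h: "h \<in> borel_measurable borel" "AE z in lborel. ?f z = h z"
    by (rule lebesgue_measurable_ex_borel)
  define g0 where "g0 z = indicat_real (rect L T) z *\<^sub>R h z" for z
  have g0: "g0 \<in> borel_measurable borel"
    unfolding g0_def using h(1) by (intro borel_measurable_scaleR borel_measurable_indicator) auto
  have ae: "AE z in lborel. z \<in> rect L T \<longrightarrow> g (fst z) (snd z) = g0 z"
    using h(2) by (rule eventually_mono) (intro impI, simp add: g0_def)
  have ae2: "AE z in lborel. ?f z = g0 z"
    using h(2) by (rule eventually_mono) (auto simp: g0_def split: split_indicator_asm)
  have "integrable lebesgue (\<lambda>z. indicat_real (rect L T) z *\<^sub>R (norm (g (fst z) (snd z)))\<^sup>2)"
    by (subst integrable_restrict_space[symmetric]) (use R gi in auto)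
  moreover have "AE z in lebesgue. indicat_real (rect L T) z *\<^sub>R (norm (g (fst z) (snd z)))\<^sup>2 = (norm (g0 z))\<^sup>2"
    using AE_completion[OF ae2] by (rule eventually_mono) (auto split: split_indicator_asm simp: g0_def)
  ultimately have "integrable lebesgue (\<lambda>z. (norm (g0 z))\<^sup>2)"
    using g0 by (subst integrable_cong_AE[symmetric]) (auto intro: measurable_completion)
  then have "integrable lborel (\<lambda>z. (norm (g0 z))\<^sup>2)"
    using g0 by (subst (asm) integrable_completion) auto
  then show ?thesis using that[of g0] g0 ae by (simp add: g0_def)
qed

lemma time_regularity:
  fixes \<eta> g :: "real \<Rightarrow> real \<Rightarrow> real^2"
  assumes L: "L > 0" and T: "T > 0"
    and cont: "continuous_on ({0..L} \<times> {0..T}) (\<lambda>(s, t). \<eta> s t)"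
    and g: "is_time_derivative L T \<eta> g"
  obtains g0 where "g0 \<in> borel_measurable borel" "\<forall>z. z \<notin> rect L T \<longrightarrow> g0 z = 0"
    "integrable lborel (\<lambda>z. (norm (g0 z))\<^sup>2)"
    "AE s in lebesgue_on {0..L}. (\<lambda>t. g0 (s, t)) absolutely_integrable_on {0..T} \<and>
       (\<forall>t\<in>{0..T}. \<eta> s t = \<eta> s 0 + integral {0..t} (\<lambda>t. g0 (s, t)))"
    "AE t in lebesgue_on {0..T}. AE s in lebesgue_on {0..L}.
       g s t = g0 (s, t) \<and> (\<eta> s has_vector_derivative g s t) (at t within {0..T})"
proof -
  have L2: "L2_on ({0..L} \<times> {0..T}) (\<lambda>(s, t). g s t)"
    and id: "\<And>\<phi>. test_function 0 T \<phi> \<Longrightarrow> AE s in lebesgue_on {0..L}.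
        (LINT t|lebesgue_on {0..T}. deriv \<phi> t *\<^sub>R \<eta> s t) = - (LINT t|lebesgue_on {0..T}. \<phi> t *\<^sub>R g s t)"
    using g by (auto simp: is_time_derivative_def)
  obtain g0 where g0: "g0 \<in> borel_measurable borel" "\<forall>z. z \<notin> rect L T \<longrightarrow> g0 z = 0"
    and g0i: "integrable lborel (\<lambda>z. (norm (g0 z))\<^sup>2)"
    and g0ae: "AE z in lborel. z \<in> rect L T \<longrightarrow> g (fst z) (snd z) = g0 z"
    by (rule L2_on_rect_borel_version[OF L2])
  have g0s: "(\<lambda>t. g0 (s, t)) \<in> borel_measurable borel" for s
    using g0(1) by measurable
  have ai: "AE s in lborel. (\<lambda>t. g0 (s, t)) absolutely_integrable_on {0..T}"
  proof -
    have "AE s in lborel. integrable lborel (\<lambda>t. (norm (g0 (s, t)))\<^sup>2)"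
      using lborel_pair.AE_integrable_fst'[of "\<lambda>z. (norm (g0 z))\<^sup>2"] g0i by (simp add: lborel_prod)
    then show ?thesis
      by (rule eventually_mono) (rule square_integrable_imp_absolutely_integrable[OF g0s])
  qed
  let ?X = "{(p, q, n). p \<in> \<rat> \<and> q \<in> \<rat> \<and> test_function 0 T (step_test p q n)}"
  have cX: "countable ?X"
  proof (rule countable_subset)
    show "?X \<subseteq> \<rat> \<times> \<rat> \<times> UNIV" by auto
    show "countable ((\<rat> \<times> \<rat> \<times> UNIV) :: (real \<times> real \<times> nat) set)"
      by (intro countable_SIGMA countable_rat) auto
  qed
  have "AE s in lebesgue_on {0..L}. \<forall>x\<in>?X. case x of (p, q, n) \<Rightarrow>
      (LINT t|lebesgue_on {0..T}. deriv (step_test p q n) t *\<^sub>R \<eta> s t)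
        = - (LINT t|lebesgue_on {0..T}. step_test p q n t *\<^sub>R g s t)"
    by (rule AE_ball_countable'[OF _ cX]) (use id in auto)
  then have ids: "AE s in lborel. s \<in> {0..L} \<longrightarrow> (\<forall>x\<in>?X. case x of (p, q, n) \<Rightarrow>
      (LINT t|lebesgue_on {0..T}. deriv (step_test p q n) t *\<^sub>R \<eta> s t)
        = - (LINT t|lebesgue_on {0..T}. step_test p q n t *\<^sub>R g s t))"
    by (subst (asm) AE_lebesgue_on_iff_lborel) auto
  have prim: "AE s in lborel. s \<in> {0..L} \<longrightarrow> (\<lambda>t. g0 (s, t)) absolutely_integrable_on {0..T} \<and>
       (\<forall>t\<in>{0..T}. \<eta> s t = \<eta> s 0 + integral {0..t} (\<lambda>t. g0 (s, t)))"
    using AE_lborel_pairD(1)[OF g0ae] ai ids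
  proof eventually_elim
    case (elim s)
    show ?case
    proof
      assume s: "s \<in> {0..L}"
      define N where "N = {t \<in> {0..T}. g s t \<noteq> g0 (s, t)}"
      have N: "negligible N"
      proof -
        have "AE t in lebesgue_on {0..T}. g s t = g0 (s, t)"
          using elim(1) s by (subst AE_lebesgue_on_iff_lborel) (auto simp: rect_def)
        then show ?thesis by (subst (asm) AE_lebesgue_on_iff_negligible) (auto simp: N_def)
      qed
      have gs: "g s absolutely_integrable_on {0..T}"
        by (rule absolutely_integrable_spike[OF elim(2) N]) (auto simp: N_def)
      have cs: "continuous_on {0..T} (\<eta> s)" using continuous_on_slices(2)[OF cont s] .
      have h1: "\<eta> s t = \<eta> s 0 + integral {0..t} (g s)" if t: "t \<in> {0..T}" for t
        by (rule indefinite_integral_if_step_tests[OF cs gs _ t]) (use elim(3) s in auto)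
      have h2: "integral {0..t} (g s) = integral {0..t} (\<lambda>t. g0 (s, t))" if t: "t \<in> {0..T}" for t
        by (rule integral_spike[OF N]) (use t in \<open>auto simp: N_def\<close>)
      show "(\<lambda>t. g0 (s, t)) absolutely_integrable_on {0..T} \<and>
       (\<forall>t\<in>{0..T}. \<eta> s t = \<eta> s 0 + integral {0..t} (\<lambda>t. g0 (s, t)))"
      proof (intro conjI ballI)
        fix t assume t: "t \<in> {0..T}"
        show "\<eta> s t = \<eta> s 0 + integral {0..t} (\<lambda>t. g0 (s, t))" using h1[OF t] unfolding h2[OF t] .
      qed (rule elim(2))
    qed
  qed
  obtain F where F: "continuous_on UNIV F" "\<And>s t. s \<in> {0..L} \<Longrightarrow> t \<in> {0..T} \<Longrightarrow> F (s, t) = \<eta> s t"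
    using continuous_extension_rectangle[OF less_imp_le[OF L] less_imp_le[OF T] cont] by metis
  let ?P = "\<lambda>s t. s \<in> {0..L} \<and> t \<in> {0<..<T} \<longrightarrow> ((\<lambda>\<tau>. F (s, \<tau>)) has_vector_derivative g0 (s, t)) (at t)"
  have "AE s in lborel. AE t in lborel. ?P s t"
    using prim
  proof eventually_elim
    case (elim s)
    show ?case
    proof (cases "s \<in> {0..L}")
      case True
      then have ai: "(\<lambda>t. g0 (s, t)) absolutely_integrable_on {0..T}"
        and eq: "\<And>t. t \<in> {0..T} \<Longrightarrow> \<eta> s t = \<eta> s 0 + integral {0..t} (\<lambda>t. g0 (s, t))"
        using elim by blast+
      have gi: "(\<lambda>t. g0 (s, t)) integrable_on {0..T}" using ai set_lebesgue_integral_eq_integral(1) by blast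
      have "AE t in lebesgue_on {0..T}. ((\<lambda>t. integral {0..t} (\<lambda>t. g0 (s, t))) has_vector_derivative g0 (s, t)) (at t within {0..T})"
        using negligible_not_differentiable_indefinite_integral[OF gi]
        by (subst AE_lebesgue_on_iff_negligible) auto
      then have "AE t in lborel. t \<in> {0..T} \<longrightarrow> ((\<lambda>t. integral {0..t} (\<lambda>t. g0 (s, t))) has_vector_derivative g0 (s, t)) (at t within {0..T})"
        by (subst (asm) AE_lebesgue_on_iff_lborel) auto
      then show ?thesis
      proof eventually_elim
        case (elim t)
        show ?case
        proof
          assume t: "s \<in> {0..L} \<and> t \<in> {0<..<T}"
          then have "((\<lambda>t. integral {0..t} (\<lambda>t. g0 (s, t))) has_vector_derivative g0 (s, t)) (at t within {0..T})"
            using elim by auto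
          from has_vector_derivative_add[OF has_vector_derivative_const[of "\<eta> s 0"] this]
          have "((\<lambda>t. \<eta> s 0 + integral {0..t} (\<lambda>t. g0 (s, t))) has_vector_derivative g0 (s, t)) (at t within {0..T})"
            by simp
          then have "((\<lambda>\<tau>. F (s, \<tau>)) has_vector_derivative g0 (s, t)) (at t within {0..T})"
          proof (rule has_vector_derivative_transform[rotated 2])
            show "F (s, x) = \<eta> s 0 + integral {0..x} (\<lambda>t. g0 (s, t))" if "x \<in> {0..T}" for x
              using F(2)[OF True that] eq[OF that] by (rule trans)
          qed (use t in auto)
          then show "((\<lambda>\<tau>. F (s, \<tau>)) has_vector_derivative g0 (s, t)) (at t)"
            using t by (subst (asm) at_within_Icc_at) auto
        qed
      qed
    next
      case False
      then show ?thesis by (intro AE_I2) blast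
    qed
  qed
  moreover have "{z \<in> space (lborel \<Otimes>\<^sub>M lborel). ?P (fst z) (snd z)} \<in> sets (lborel \<Otimes>\<^sub>M lborel)"
  proof -
    have "{z. ((\<lambda>\<tau>. F (fst z, \<tau>)) has_vector_derivative g0 z) (at (snd z))} \<in> sets borel"
      by (rule sets_has_vector_derivative[OF F(1) g0(1)])
    moreover have "- ({0..L} \<times> {0<..<T}) \<in> sets (borel :: (real \<times> real) measure)"
      by (intro borel_comp borel_Times) auto
    moreover have "{z. ?P (fst z) (snd z)} = - ({0..L} \<times> {0<..<T}) \<union>
      {z. ((\<lambda>\<tau>. F (fst z, \<tau>)) has_vector_derivative g0 z) (at (snd z))}"
      by auto
    ultimately show ?thesis unfolding lborel_prod by auto
  qed
  ultimately have "AE t in lborel. AE s in lborel. ?P s t"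
    using lborel_pair.AE_commute[of ?P] by blast
  moreover have "AE t in lborel. t \<noteq> 0 \<and> t \<noteq> T"
    by (intro eventually_conj AE_lborel_singleton)
  ultimately have "AE t in lborel. t \<in> {0..T} \<longrightarrow> (AE s in lebesgue_on {0..L}.
       g s t = g0 (s, t) \<and> (\<eta> s has_vector_derivative g s t) (at t within {0..T}))"
    using AE_lborel_pairD(2)[OF g0ae]
  proof eventually_elim
    case (elim t)
    show ?case
    proof
      assume t: "t \<in> {0..T}"
      then have t': "t \<in> {0<..<T}" using elim(2) by auto
      have "AE s in lborel. s \<in> {0..L} \<longrightarrow> g s t = g0 (s, t) \<and> (\<eta> s has_vector_derivative g s t) (at t within {0..T})"
        using elim(1) elim(3)
      proof eventually_elim
        case (elim s)
        show ?case
        proof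
          assume s: "s \<in> {0..L}"
          have e: "g s t = g0 (s, t)" using elim(2) s t by (simp add: rect_def)
          have "((\<lambda>\<tau>. F (s, \<tau>)) has_vector_derivative g0 (s, t)) (at t within {0..T})"
            using elim(1) s t' by (auto intro: has_vector_derivative_at_within)
          then have "(\<eta> s has_vector_derivative g0 (s, t)) (at t within {0..T})"
            by (rule has_vector_derivative_transform[rotated 2]) (use t s F(2) in auto)
          then show "g s t = g0 (s, t) \<and> (\<eta> s has_vector_derivative g s t) (at t within {0..T})"
            using e by simp
        qed
      qed
      then show "AE s in lebesgue_on {0..L}.
       g s t = g0 (s, t) \<and> (\<eta> s has_vector_derivative g s t) (at t within {0..T})"
        by (subst AE_lebesgue_on_iff_lborel) auto
    qed
  qed
  then have "AE t in lebesgue_on {0..T}. AE s in lebesgue_on {0..L}.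
       g s t = g0 (s, t) \<and> (\<eta> s has_vector_derivative g s t) (at t within {0..T})"
    by (subst AE_lebesgue_on_iff_lborel) auto
  moreover have "AE s in lebesgue_on {0..L}. (\<lambda>t. g0 (s, t)) absolutely_integrable_on {0..T} \<and>
       (\<forall>t\<in>{0..T}. \<eta> s t = \<eta> s 0 + integral {0..t} (\<lambda>t. g0 (s, t)))"
    using prim by (subst AE_lebesgue_on_iff_lborel) auto
  ultimately show ?thesis using that g0 g0i by blast
qed

section \<open>The grand resistance matrix\<close>

lemma J_apply: "J *v x = vector [- x $ 2, x $ 1]"
  by (simp add: J_def vec_eq_iff matrix_vector_mult_def forall_2 sum_2)

lemma J_nth [simp]: "(J *v x) $ 1 = - x $ 2" "(J *v x) $ 2 = x $ 1"
  by (simp_all add: J_apply)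

lemma inner_2: "(x::real^2) \<bullet> y = x $ 1 * y $ 1 + x $ 2 * y $ 2"
  by (simp add: inner_vec_def sum_2)

lemma J_isometry: "(J *v x) \<bullet> (J *v y) = x \<bullet> y"
  by (simp add: inner_2)

lemma norm_J [simp]: "norm (J *v x) = norm x"
  by (simp add: norm_eq_sqrt_inner J_isometry)

definition drag :: "real \<Rightarrow> real \<Rightarrow> real^2 \<Rightarrow> real^2^2" where
  "drag C\<^sub>\<tau> C\<^sub>\<nu> p = C\<^sub>\<tau> *\<^sub>R outer p p + C\<^sub>\<nu> *\<^sub>R outer (J *v p) (J *v p)"

lemma K_eq_drag: "K C\<^sub>\<tau> C\<^sub>\<nu> L \<eta> s t = drag C\<^sub>\<tau> C\<^sub>\<nu> (space_derivative L \<eta> s t)"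
  by (simp add: K_def drag_def Let_def)

lemma drag_apply:
  "drag C\<^sub>\<tau> C\<^sub>\<nu> p *v x = (C\<^sub>\<tau> * (p \<bullet> x)) *\<^sub>R p + (C\<^sub>\<nu> * ((J *v p) \<bullet> x)) *\<^sub>R (J *v p)"
  by (simp add: drag_def outer_def vec_eq_iff forall_2 matrix_vector_mult_def sum_2 inner_2 algebra_simps)

lemma drag_symmetric: "x \<bullet> (drag C\<^sub>\<tau> C\<^sub>\<nu> p *v y) = (drag C\<^sub>\<tau> C\<^sub>\<nu> p *v x) \<bullet> y"
  by (simp add: drag_apply inner_add_left inner_add_right inner_commute)

lemma drag_nth_symmetric: "drag C\<^sub>\<tau> C\<^sub>\<nu> p $ 1 $ 2 = drag C\<^sub>\<tau> C\<^sub>\<nu> p $ 2 $ 1"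
  by (simp add: drag_def outer_def)

lemma drag_coercive:
  assumes "norm p = 1" "C\<^sub>\<tau> > 0" "C\<^sub>\<nu> > 0"
  shows "min C\<^sub>\<tau> C\<^sub>\<nu> * (norm x)\<^sup>2 \<le> x \<bullet> (drag C\<^sub>\<tau> C\<^sub>\<nu> p *v x)"
proof -
  have p: "(p $ 1)\<^sup>2 + (p $ 2)\<^sup>2 = 1"
    using assms(1) by (simp add: norm_eq_1 inner_2 power2_eq_square)
  have "(p \<bullet> x)\<^sup>2 + ((J *v p) \<bullet> x)\<^sup>2 = ((p $ 1)\<^sup>2 + (p $ 2)\<^sup>2) * (x \<bullet> x)"
    by (simp add: inner_2 power2_eq_square algebra_simps)
  then have n: "(norm x)\<^sup>2 = (p \<bullet> x)\<^sup>2 + ((J *v p) \<bullet> x)\<^sup>2" by (simp add: p power2_norm_eq_inner)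
  have "min C\<^sub>\<tau> C\<^sub>\<nu> * (norm x)\<^sup>2 \<le> C\<^sub>\<tau> * (p \<bullet> x)\<^sup>2 + C\<^sub>\<nu> * ((J *v p) \<bullet> x)\<^sup>2"
    unfolding n distrib_left by (intro add_mono mult_right_mono) auto
  also have "\<dots> = x \<bullet> (drag C\<^sub>\<tau> C\<^sub>\<nu> p *v x)"
    by (simp add: drag_apply inner_add_right inner_commute power2_eq_square)
  finally show ?thesis .
qed

lemma drag_bounded:
  assumes "norm p = 1" "C\<^sub>\<tau> > 0" "C\<^sub>\<nu> > 0"
  shows "norm (drag C\<^sub>\<tau> C\<^sub>\<nu> p *v x) \<le> (C\<^sub>\<tau> + C\<^sub>\<nu>) * norm x"
proof -
  have "\<bar>p \<bullet> x\<bar> \<le> norm x" "\<bar>(J *v p) \<bullet> x\<bar> \<le> norm x"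
    using Cauchy_Schwarz_ineq2[of p x] Cauchy_Schwarz_ineq2[of "J *v p" x] assms(1) by auto
  then have "norm ((C\<^sub>\<tau> * (p \<bullet> x)) *\<^sub>R p) \<le> C\<^sub>\<tau> * norm x" "norm ((C\<^sub>\<nu> * ((J *v p) \<bullet> x)) *\<^sub>R (J *v p)) \<le> C\<^sub>\<nu> * norm x"
    using assms by (auto simp: abs_mult)
  then show ?thesis unfolding drag_apply by (intro norm_triangle_le) (simp add: distrib_right)
qed

definition vec3 :: "real^2 \<Rightarrow> real \<Rightarrow> real^3" where
  "vec3 v \<omega> = vector [v $ 1, v $ 2, \<omega>]"

lemma vec3_nth [simp]: "vec3 v \<omega> $ 1 = v $ 1" "vec3 v \<omega> $ 2 = v $ 2" "vec3 v \<omega> $ 3 = \<omega>"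
  by (simp_all add: vec3_def)

lemma vec3_eq_iff: "vec3 v \<omega> = vec3 v' \<omega>' \<longleftrightarrow> v = v' \<and> \<omega> = \<omega>'"
  by (auto simp: vec_eq_iff forall_2 forall_3)

lemma vec3_exists: "\<exists>v \<omega>. z = vec3 v \<omega>"
  by (rule exI[of _ "vector [z $ 1, z $ 2]"], rule exI[of _ "z $ 3"]) (simp add: vec_eq_iff forall_3)

lemma inner_vec3: "vec3 v \<omega> \<bullet> vec3 v' \<omega>' = v \<bullet> v' + \<omega> * \<omega>'"
  by (simp add: inner_vec_def sum_3 sum_2)

lemma integrable_continuous_lebesgue_on:
  fixes f :: "real \<Rightarrow> 'a::euclidean_space"
  assumes "continuous_on {a..b} f"
  shows "integrable (lebesgue_on {a..b}) f"
  by (intro absolutely_integrable_imp_integrable absolutely_integrable_continuous_real assms) simp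

locale swimmer =
  fixes L T C\<^sub>\<tau> C\<^sub>\<nu> :: real and \<xi> :: "real \<Rightarrow> real \<Rightarrow> real^2"
  assumes L: "L > 0" and T: "T > 0" and C\<tau>: "C\<^sub>\<tau> > 0" and C\<nu>: "C\<^sub>\<nu> > 0"
    and \<xi>: "\<xi> \<in> space_X1 L T"
begin

abbreviation "tng \<equiv> space_derivative L \<xi>"
abbreviation "KK \<equiv> K C\<^sub>\<tau> C\<^sub>\<nu> L \<xi>"
abbreviation "\<xi>dot \<equiv> time_derivative L T \<xi>"

lemma \<xi>_X: "\<xi> \<in> space_X L T" and norm_tng: "s \<in> {0..L} \<Longrightarrow> t \<in> {0..T} \<Longrightarrow> norm (tng s t) = 1"
  using \<xi> by (auto simp: space_X1_def)

lemma cont_\<xi>: "continuous_on ({0..L} \<times> {0..T}) (\<lambda>(s, t). \<xi> s t)"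
  using \<xi>_X by (auto simp: space_X_def)

lemma cont_tng: "continuous_on ({0..L} \<times> {0..T}) (\<lambda>(s, t). tng s t)"
  by (rule space_X_space_derivative(1)[OF L T \<xi>_X])

lemma has_derivative_tng: "s \<in> {0..L} \<Longrightarrow> t \<in> {0..T} \<Longrightarrow>
    ((\<lambda>\<sigma>. \<xi> \<sigma> t) has_vector_derivative tng s t) (at s within {0..L})"
  by (rule space_X_space_derivative(2)[OF L T \<xi>_X])

lemma cont_J: "continuous_on S f \<Longrightarrow> continuous_on S (\<lambda>x. J *v f x)"
  by (rule bounded_linear.continuous_on[OF matrix_vector_mul_bounded_linear])

lemma cont_drag:
  assumes "continuous_on S p" "continuous_on S w"
  shows "continuous_on S (\<lambda>x. drag C\<^sub>\<tau> C\<^sub>\<nu> (p x) *v w x)"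
  unfolding drag_apply by (intro continuous_intros cont_J assms)

lemma cont_KK:
  assumes "continuous_on ({0..L} \<times> {0..T}) (\<lambda>(s, t). w s t)"
  shows "continuous_on ({0..L} \<times> {0..T}) (\<lambda>(s, t). KK s t *v w s t)"
  using cont_drag[OF cont_tng assms] by (simp add: K_eq_drag split_def)

lemma cont_K_matrix: "continuous_on ({0..L} \<times> {0..T}) (\<lambda>(s, t). KK s t)"
proof -
  have 1: "continuous_on ({0..L} \<times> {0..T}) (\<lambda>z. tng (fst z) (snd z))" using cont_tng by (simp add: split_def)
  have 2: "continuous_on ({0..L} \<times> {0..T}) (\<lambda>z. tng (fst z) (snd z) $ i)" for i
    by (rule bounded_linear.continuous_on[OF bounded_linear_vec_nth 1])
  have 3: "continuous_on ({0..L} \<times> {0..T}) (\<lambda>z. (J *v tng (fst z) (snd z)) $ i)" for i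
    by (rule bounded_linear.continuous_on[OF bounded_linear_vec_nth cont_J[OF 1]])
  show ?thesis
    unfolding K_eq_drag drag_def outer_def split_def
    by (intro continuous_intros continuous_on_vec_lambda 2 3)
qed

lemma slice_\<xi>: "t \<in> {0..T} \<Longrightarrow> continuous_on {0..L} (\<lambda>s. \<xi> s t)"
  by (rule continuous_on_slices(1)[OF cont_\<xi>])

lemma slice_K: "t \<in> {0..T} \<Longrightarrow> continuous_on {0..L} (\<lambda>s. KK s t)"
  by (rule continuous_on_slices(1)[OF cont_K_matrix])

lemma slice_KK:
  assumes t: "t \<in> {0..T}" and w: "continuous_on {0..L} w"
  shows "continuous_on {0..L} (\<lambda>s. KK s t *v w s)"
  unfolding K_eq_drag by (intro cont_drag continuous_on_slices(1)[OF cont_tng t] w)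

lemma grand_resistance_mult:
  assumes t: "t \<in> {0..T}"
  shows "grand_resistance C\<^sub>\<tau> C\<^sub>\<nu> L \<xi> t *v vec3 v \<omega> =
    vec3 (LINT s|lebesgue_on {0..L}. KK s t *v (v + \<omega> *\<^sub>R (J *v \<xi> s t)))
      (LINT s|lebesgue_on {0..L}. (J *v \<xi> s t) \<bullet> (KK s t *v (v + \<omega> *\<^sub>R (J *v \<xi> s t))))"
proof -
  let ?I = "\<lambda>f. LINT s|lebesgue_on {0..L}. f s"
  have iK: "integrable (lebesgue_on {0..L}) (\<lambda>s. KK s t)"
    by (intro integrable_continuous_lebesgue_on slice_K t)
  have i1: "integrable (lebesgue_on {0..L}) (\<lambda>s. KK s t *v v)" for v
    by (intro integrable_continuous_lebesgue_on slice_KK t continuous_intros)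
  have i2: "integrable (lebesgue_on {0..L}) (\<lambda>s. KK s t *v (J *v \<xi> s t))"
    by (intro integrable_continuous_lebesgue_on slice_KK t cont_J slice_\<xi>)
  have i3: "integrable (lebesgue_on {0..L}) (\<lambda>s. (J *v \<xi> s t) \<bullet> (KK s t *v v))" for v
    by (intro integrable_continuous_lebesgue_on slice_KK t cont_J slice_\<xi> continuous_intros)
  have i4: "integrable (lebesgue_on {0..L}) (\<lambda>s. (J *v \<xi> s t) \<bullet> (KK s t *v (J *v \<xi> s t)))"
    by (intro integrable_continuous_lebesgue_on slice_KK t cont_J slice_\<xi> continuous_intros)
  have bl: "bounded_linear (\<lambda>M :: real^2^2. M *v v)" for v
    by (intro linear_conv_bounded_linear[THEN iffD1] linearI)
      (simp_all add: matrix_vector_mult_add_rdistrib scaleR_matrix_vector_assoc)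
  have Av: "A_mat C\<^sub>\<tau> C\<^sub>\<nu> L \<xi> t *v v = ?I (\<lambda>s. KK s t *v v)" for v
    unfolding A_mat_def by (rule integral_bounded_linear[OF bl iK, symmetric])
  have q: "?I (\<lambda>s. KK s t *v (v + \<omega> *\<^sub>R (J *v \<xi> s t))) = A_mat C\<^sub>\<tau> C\<^sub>\<nu> L \<xi> t *v v + \<omega> *\<^sub>R b_vec C\<^sub>\<tau> C\<^sub>\<nu> L \<xi> t"
    unfolding Av b_vec_def by (simp add: matrix_vector_right_distrib matrix_vector_mult_scaleR i1 i2)
  have bv: "?I (\<lambda>s. (J *v \<xi> s t) \<bullet> (KK s t *v v)) = b_vec C\<^sub>\<tau> C\<^sub>\<nu> L \<xi> t \<bullet> v"
    unfolding b_vec_def K_eq_drag drag_symmetric using i2 by (simp add: K_eq_drag)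
  have r: "?I (\<lambda>s. (J *v \<xi> s t) \<bullet> (KK s t *v (v + \<omega> *\<^sub>R (J *v \<xi> s t)))) = b_vec C\<^sub>\<tau> C\<^sub>\<nu> L \<xi> t \<bullet> v + \<omega> * c_scal C\<^sub>\<tau> C\<^sub>\<nu> L \<xi> t"
    unfolding bv[symmetric] c_scal_def
    by (simp add: matrix_vector_right_distrib matrix_vector_mult_scaleR inner_add_right i3 i4)
  show ?thesis
    unfolding q r
    by (simp add: grand_resistance_def Let_def vec_eq_iff forall_3 matrix_vector_mult_def sum_3 sum_2 inner_2 algebra_simps)
qed

lemma A_mat_symmetric:
  assumes t: "t \<in> {0..T}"
  shows "A_mat C\<^sub>\<tau> C\<^sub>\<nu> L \<xi> t $ 1 $ 2 = A_mat C\<^sub>\<tau> C\<^sub>\<nu> L \<xi> t $ 2 $ 1"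
proof -
  have iK: "integrable (lebesgue_on {0..L}) (\<lambda>s. KK s t)"
    by (intro integrable_continuous_lebesgue_on slice_K t)
  have nth: "A_mat C\<^sub>\<tau> C\<^sub>\<nu> L \<xi> t $ i $ j = (LINT s|lebesgue_on {0..L}. KK s t $ i $ j)" for i j
    unfolding A_mat_def
    by (rule integral_bounded_linear[OF bounded_linear_compose[OF bounded_linear_vec_nth bounded_linear_vec_nth] iK, symmetric])
  show ?thesis unfolding nth K_eq_drag drag_nth_symmetric ..
qed

lemma grand_resistance_symmetric:
  assumes t: "t \<in> {0..T}"
  shows "transpose (grand_resistance C\<^sub>\<tau> C\<^sub>\<nu> L \<xi> t) = grand_resistance C\<^sub>\<tau> C\<^sub>\<nu> L \<xi> t"
  by (simp add: grand_resistance_def Let_def vec_eq_iff forall_3 transpose_def A_mat_symmetric[OF t])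

lemma grand_resistance_ker:
  assumes t: "t \<in> {0..T}" and z: "grand_resistance C\<^sub>\<tau> C\<^sub>\<nu> L \<xi> t *v z = 0"
  shows "z = 0"
proof -
  obtain v \<omega> where vw: "z = vec3 v \<omega>" using vec3_exists by blast
  define w where "w s = v + \<omega> *\<^sub>R (J *v \<xi> s t)" for s
  have cw: "continuous_on {0..L} w" unfolding w_def by (intro continuous_intros cont_J slice_\<xi> t)
  have i1: "integrable (lebesgue_on {0..L}) (\<lambda>s. KK s t *v w s)"
    and i2: "integrable (lebesgue_on {0..L}) (\<lambda>s. (J *v \<xi> s t) \<bullet> (KK s t *v w s))"
    by (intro integrable_continuous_lebesgue_on slice_KK t cont_J slice_\<xi> continuous_intros cw)+
  have cq: "continuous_on {0..L} (\<lambda>s. w s \<bullet> (KK s t *v w s))"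
    by (intro slice_KK t continuous_intros cw)
  have nn: "min C\<^sub>\<tau> C\<^sub>\<nu> * (norm (w s))\<^sup>2 \<le> w s \<bullet> (KK s t *v w s)" if "s \<in> {0..L}" for s
    unfolding K_eq_drag by (rule drag_coercive[OF norm_tng[OF that t] C\<tau> C\<nu>])
  have mp: "min C\<^sub>\<tau> C\<^sub>\<nu> > 0" using C\<tau> C\<nu> by simp
  have "0 = vec3 v \<omega> \<bullet> (grand_resistance C\<^sub>\<tau> C\<^sub>\<nu> L \<xi> t *v vec3 v \<omega>)" using z vw by simp
  also have "\<dots> = v \<bullet> (LINT s|lebesgue_on {0..L}. KK s t *v w s) + \<omega> * (LINT s|lebesgue_on {0..L}. (J *v \<xi> s t) \<bullet> (KK s t *v w s))"
    unfolding grand_resistance_mult[OF t] w_def[symmetric] inner_vec3 ..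
  also have "\<dots> = (LINT s|lebesgue_on {0..L}. w s \<bullet> (KK s t *v w s))"
    using i1 i2 by (simp add: w_def[of "_::real"] inner_add_left)
  also have "\<dots> = integral {0..L} (\<lambda>s. w s \<bullet> (KK s t *v w s))"
    by (intro LINT_eq_integral absolutely_integrable_continuous_real cq)
  finally have "integral {0..L} (\<lambda>s. w s \<bullet> (KK s t *v w s)) = 0" by simp
  then have "(\<forall>s\<in>{0..L}. w s \<bullet> (KK s t *v w s) = 0)"
    using integral_eq_0_iff[OF cq L] nn mp by (smt (verit) mult_nonneg_nonneg zero_le_power2)
  then have w0: "w s = 0" if "s \<in> {0..L}" for s
    using nn[OF that] mp that by (auto simp: mult_le_0_iff)
  have s0: "(0::real) \<in> {0..L}" using L by simp
  have "\<omega> *\<^sub>R (J *v tng 0 t) = 0"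
  proof -
    have "((\<lambda>s. v + \<omega> *\<^sub>R (J *v \<xi> s t)) has_vector_derivative 0 + \<omega> *\<^sub>R (J *v tng 0 t)) (at 0 within {0..L})"
      by (intro has_vector_derivative_add has_vector_derivative_const bounded_linear.has_vector_derivative[OF bounded_linear_scaleR_right]
          bounded_linear.has_vector_derivative[OF matrix_vector_mul_bounded_linear] has_derivative_tng s0 t)
    moreover have "((\<lambda>s. v + \<omega> *\<^sub>R (J *v \<xi> s t)) has_vector_derivative 0) (at 0 within {0..L})"
      by (rule has_vector_derivative_transform[OF s0 _ has_vector_derivative_const[of 0]]) (use w0 in \<open>simp add: w_def\<close>)
    ultimately have "0 + \<omega> *\<^sub>R (J *v tng 0 t) = 0"
      using vector_derivative_within_closed_interval[OF L s0] by metis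
    then show ?thesis by simp
  qed
  moreover have "J *v tng 0 t \<noteq> 0" using norm_tng[OF s0 t] norm_J[of "tng 0 t"] by force
  ultimately have \<omega>: "\<omega> = 0" by simp
  then have "v = 0" using w0[OF s0] by (simp add: w_def)
  then show ?thesis using \<omega> vw by (simp add: vec_eq_iff forall_3)
qed

lemma invertible_grand_resistance:
  assumes "t \<in> {0..T}" shows "invertible (grand_resistance C\<^sub>\<tau> C\<^sub>\<nu> L \<xi> t)"
  unfolding invertible_left_inverse matrix_left_invertible_ker using grand_resistance_ker[OF assms] by blast

lemma matrix_inv_grand_resistance:
  assumes t: "t \<in> {0..T}"
  defines "G \<equiv> grand_resistance C\<^sub>\<tau> C\<^sub>\<nu> L \<xi> t"
  shows "G ** matrix_inv G = mat 1" "matrix_inv G ** G = mat 1" "transpose (matrix_inv G) = matrix_inv G"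
proof -
  have "\<exists>A'. G ** A' = mat 1 \<and> A' ** G = mat 1"
    using invertible_grand_resistance[OF t] unfolding invertible_def G_def .
  then show 1: "G ** matrix_inv G = mat 1" and 2: "matrix_inv G ** G = mat 1"
    unfolding matrix_inv_def by (metis (mono_tags, lifting) someI_ex)+
  have "transpose (matrix_inv G) ** G = transpose (G ** matrix_inv G)"
    using grand_resistance_symmetric[OF t] unfolding G_def by (simp add: matrix_transpose_mul)
  also have "\<dots> = mat 1" unfolding 1 by (simp add: transpose_mat)
  finally have "transpose (matrix_inv G) ** G = mat 1" .
  then have "transpose (matrix_inv G) ** (G ** matrix_inv G) = matrix_inv G"
    by (simp add: matrix_mul_assoc)
  then show "transpose (matrix_inv G) = matrix_inv G" unfolding 1 by simp
qed

lemma vec3_vel: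
  assumes t: "t \<in> {0..T}"
  shows "vec3 (vel C\<^sub>\<tau> C\<^sub>\<nu> L T \<xi> t) (ang_vel C\<^sub>\<tau> C\<^sub>\<nu> L T \<xi> t)
    = matrix_inv (grand_resistance C\<^sub>\<tau> C\<^sub>\<nu> L \<xi> t) *v vec3 (F_sh C\<^sub>\<tau> C\<^sub>\<nu> L T \<xi> t) (M_sh C\<^sub>\<tau> C\<^sub>\<nu> L T \<xi> t)"
proof -
  let ?N = "matrix_inv (grand_resistance C\<^sub>\<tau> C\<^sub>\<nu> L \<xi> t)"
  have "?N $ i $ j = ?N $ j $ i" for i j
  proof -
    have "transpose ?N $ i $ j = ?N $ j $ i" by (simp add: transpose_def)
    then show ?thesis unfolding matrix_inv_grand_resistance(3)[OF t] .
  qed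
  from this[of 3 1] this[of 3 2] show ?thesis
    by (simp add: vel_def ang_vel_def Abar_def bbar_def cbar_def Let_def vec_eq_iff forall_3
        matrix_vector_mult_def sum_3 sum_2 inner_2 algebra_simps)
qed

lemma vel_iff:
  assumes t: "t \<in> {0..T}"
  shows "v = vel C\<^sub>\<tau> C\<^sub>\<nu> L T \<xi> t \<and> \<omega> = ang_vel C\<^sub>\<tau> C\<^sub>\<nu> L T \<xi> t \<longleftrightarrow>
    grand_resistance C\<^sub>\<tau> C\<^sub>\<nu> L \<xi> t *v vec3 v \<omega> = vec3 (F_sh C\<^sub>\<tau> C\<^sub>\<nu> L T \<xi> t) (M_sh C\<^sub>\<tau> C\<^sub>\<nu> L T \<xi> t)"
proof -
  let ?G = "grand_resistance C\<^sub>\<tau> C\<^sub>\<nu> L \<xi> t"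
  note N = matrix_inv_grand_resistance(1,2)[OF t]
  have "v = vel C\<^sub>\<tau> C\<^sub>\<nu> L T \<xi> t \<and> \<omega> = ang_vel C\<^sub>\<tau> C\<^sub>\<nu> L T \<xi> t \<longleftrightarrow>
    vec3 v \<omega> = matrix_inv ?G *v vec3 (F_sh C\<^sub>\<tau> C\<^sub>\<nu> L T \<xi> t) (M_sh C\<^sub>\<tau> C\<^sub>\<nu> L T \<xi> t)"
    unfolding vec3_vel[OF t, symmetric] vec3_eq_iff ..
  also have "\<dots> \<longleftrightarrow> ?G *v vec3 v \<omega> = vec3 (F_sh C\<^sub>\<tau> C\<^sub>\<nu> L T \<xi> t) (M_sh C\<^sub>\<tau> C\<^sub>\<nu> L T \<xi> t)"
  proof
    assume e: "vec3 v \<omega> = matrix_inv ?G *v vec3 (F_sh C\<^sub>\<tau> C\<^sub>\<nu> L T \<xi> t) (M_sh C\<^sub>\<tau> C\<^sub>\<nu> L T \<xi> t)"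
    show "?G *v vec3 v \<omega> = vec3 (F_sh C\<^sub>\<tau> C\<^sub>\<nu> L T \<xi> t) (M_sh C\<^sub>\<tau> C\<^sub>\<nu> L T \<xi> t)"
      unfolding e matrix_vector_mul_assoc N by simp
  next
    assume e: "?G *v vec3 v \<omega> = vec3 (F_sh C\<^sub>\<tau> C\<^sub>\<nu> L T \<xi> t) (M_sh C\<^sub>\<tau> C\<^sub>\<nu> L T \<xi> t)"
    show "vec3 v \<omega> = matrix_inv ?G *v vec3 (F_sh C\<^sub>\<tau> C\<^sub>\<nu> L T \<xi> t) (M_sh C\<^sub>\<tau> C\<^sub>\<nu> L T \<xi> t)"
      unfolding e[symmetric] matrix_vector_mul_assoc N by simp
  qed
  finally show ?thesis .
qed

lemma integrable_KK:
  fixes g :: "real \<Rightarrow> real^2"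
  assumes t: "t \<in> {0..T}" and g: "g absolutely_integrable_on {0..L}"
  shows "integrable (lebesgue_on {0..L}) (\<lambda>s. KK s t *v g s)"
    and "integrable (lebesgue_on {0..L}) (\<lambda>s. (J *v \<xi> s t) \<bullet> (KK s t *v g s))"
proof -
  have bounded: "bounded (f ` {0..L})" if "continuous_on {0..L} f" for f :: "real \<Rightarrow> 'b::euclidean_space"
    using that by (intro compact_imp_bounded compact_continuous_image) auto
  have blv: "bilinear (\<lambda>(M :: real^2^2) x. M *v x)"
    unfolding bilinear_def
    by (intro conjI allI linearI) (simp_all add: matrix_vector_mult_add_rdistrib scaleR_matrix_vector_assoc
      matrix_vector_right_distrib matrix_vector_mult_scaleR)
  have 1: "(\<lambda>s. KK s t *v g s) absolutely_integrable_on {0..L}"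
    by (rule absolutely_integrable_bounded_measurable_product[OF blv _ _ _ g])
      (auto intro!: continuous_imp_measurable_on_sets_lebesgue slice_K t bounded)
  have bli: "bilinear (\<lambda>(x :: real^2) y. x \<bullet> y)"
    by (simp add: bilinear_conv_bounded_bilinear bounded_bilinear_inner)
  have 2: "(\<lambda>s. (J *v \<xi> s t) \<bullet> (KK s t *v g s)) absolutely_integrable_on {0..L}"
    by (rule absolutely_integrable_bounded_measurable_product[OF bli _ _ _ 1])
      (auto intro!: continuous_imp_measurable_on_sets_lebesgue cont_J slice_\<xi> t bounded)
  show "integrable (lebesgue_on {0..L}) (\<lambda>s. KK s t *v g s)"
    "integrable (lebesgue_on {0..L}) (\<lambda>s. (J *v \<xi> s t) \<bullet> (KK s t *v g s))"
    using 1 2 by (auto intro: absolutely_integrable_imp_integrable)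
qed

lemma balance_iff:
  assumes t: "t \<in> {0..T}" and g: "(\<lambda>s. \<xi>dot s t) absolutely_integrable_on {0..L}"
  shows "(LINT s|lebesgue_on {0..L}. KK s t *v (v + \<omega> *\<^sub>R (J *v \<xi> s t) + \<xi>dot s t)) = 0 \<and>
      (LINT s|lebesgue_on {0..L}. (J *v \<xi> s t) \<bullet> (KK s t *v (v + \<omega> *\<^sub>R (J *v \<xi> s t) + \<xi>dot s t))) = 0
    \<longleftrightarrow> v = vel C\<^sub>\<tau> C\<^sub>\<nu> L T \<xi> t \<and> \<omega> = ang_vel C\<^sub>\<tau> C\<^sub>\<nu> L T \<xi> t"
proof -
  let ?w = "\<lambda>s. v + \<omega> *\<^sub>R (J *v \<xi> s t)"
  have w: "?w absolutely_integrable_on {0..L}"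
    by (intro absolutely_integrable_continuous_real continuous_intros cont_J slice_\<xi> t)
  have 1: "(LINT s|lebesgue_on {0..L}. KK s t *v (?w s + \<xi>dot s t)) =
      (LINT s|lebesgue_on {0..L}. KK s t *v ?w s) - F_sh C\<^sub>\<tau> C\<^sub>\<nu> L T \<xi> t"
    unfolding F_sh_def matrix_vector_right_distrib[of _ "?w _"]
    using integrable_KK(1)[OF t w] integrable_KK(1)[OF t g] by simp
  have 2: "(LINT s|lebesgue_on {0..L}. (J *v \<xi> s t) \<bullet> (KK s t *v (?w s + \<xi>dot s t))) =
      (LINT s|lebesgue_on {0..L}. (J *v \<xi> s t) \<bullet> (KK s t *v ?w s)) - M_sh C\<^sub>\<tau> C\<^sub>\<nu> L T \<xi> t"
    unfolding M_sh_def matrix_vector_right_distrib[of _ "?w _"] inner_add_right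
    using integrable_KK(2)[OF t w] integrable_KK(2)[OF t g] by simp
  show ?thesis
    unfolding 1 2 vel_iff[OF t] grand_resistance_mult[OF t] vec3_eq_iff by simp
qed

lemma continuous_on_LINT:
  fixes f :: "real \<Rightarrow> real \<Rightarrow> 'a::euclidean_space"
  assumes "continuous_on ({0..L} \<times> {0..T}) (\<lambda>(s, t). f s t)"
  shows "continuous_on {0..T} (\<lambda>t. LINT s|lebesgue_on {0..L}. f s t)"
proof -
  have "continuous_on ({0..T} \<times> cbox 0 L) (\<lambda>z. case (snd z, fst z) of (s, t) \<Rightarrow> f s t)"
    by (rule continuous_on_compose2[OF assms]) (auto intro!: continuous_intros)
  then have "continuous_on ({0..T} \<times> cbox 0 L) (\<lambda>(t, s). f s t)" by (simp add: split_def)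
  then have "continuous_on {0..T} (\<lambda>t. integral (cbox 0 L) (\<lambda>s. f s t))"
    by (rule integral_continuous_on_param)
  then show ?thesis
    by (rule continuous_on_eq)
      (simp add: LINT_eq_integral[OF absolutely_integrable_continuous_real[OF continuous_on_slices(1)[OF assms]]])
qed

lemma continuous_grand_resistance:
  "continuous_on {0..T} (\<lambda>t. grand_resistance C\<^sub>\<tau> C\<^sub>\<nu> L \<xi> t $ i $ j)"
proof -
  have A: "continuous_on {0..T} (A_mat C\<^sub>\<tau> C\<^sub>\<nu> L \<xi>)"
    unfolding A_mat_def by (rule continuous_on_LINT[OF cont_K_matrix])
  have J\<xi>: "continuous_on ({0..L} \<times> {0..T}) (\<lambda>(s, t). J *v \<xi> s t)"
    using cont_J[OF cont_\<xi>] by (simp add: split_def)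
  have b: "continuous_on {0..T} (b_vec C\<^sub>\<tau> C\<^sub>\<nu> L \<xi>)"
    unfolding b_vec_def by (rule continuous_on_LINT[OF cont_KK[OF J\<xi>]])
  have c: "continuous_on {0..T} (c_scal C\<^sub>\<tau> C\<^sub>\<nu> L \<xi>)"
    unfolding c_scal_def
    by (rule continuous_on_LINT) (use continuous_on_inner[OF J\<xi> cont_KK[OF J\<xi>]] in \<open>simp add: split_def\<close>)
  have A2: "continuous_on {0..T} (\<lambda>t. A_mat C\<^sub>\<tau> C\<^sub>\<nu> L \<xi> t $ i $ j)" for i j
    by (rule bounded_linear.continuous_on[OF bounded_linear_compose[OF bounded_linear_vec_nth bounded_linear_vec_nth] A])
  have b2: "continuous_on {0..T} (\<lambda>t. b_vec C\<^sub>\<tau> C\<^sub>\<nu> L \<xi> t $ i)" for i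
    by (rule bounded_linear.continuous_on[OF bounded_linear_vec_nth b])
  show ?thesis
    using exhaust_3[of i] exhaust_3[of j]
    by (elim disjE) (simp_all add: grand_resistance_def Let_def A2 b2 c)
qed

lemma continuous_matrix_inv:
  "continuous_on {0..T} (\<lambda>t. matrix_inv (grand_resistance C\<^sub>\<tau> C\<^sub>\<nu> L \<xi> t) $ k $ l)"
proof -
  let ?G = "grand_resistance C\<^sub>\<tau> C\<^sub>\<nu> L \<xi>"
  have nz: "det (?G t) \<noteq> 0" if "t \<in> {0..T}" for t
    using invertible_grand_resistance[OF that] invertible_det_nz by blast
  have eq: "matrix_inv (?G t) $ k $ l = det (\<chi> i j. if j = k then axis l 1 $ i else ?G t $ i $ j) / det (?G t)"
    if t: "t \<in> {0..T}" for t
  proof -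
    have "?G t *v (matrix_inv (?G t) *v axis l 1) = axis l 1"
      by (simp add: matrix_vector_mul_assoc matrix_inv_grand_resistance(1)[OF t])
    then have "matrix_inv (?G t) *v axis l 1 = (\<chi> k. det (\<chi> i j. if j = k then axis l 1 $ i else ?G t $ i $ j) / det (?G t))"
      using cramer[OF nz[OF t]] by blast
    moreover have "(matrix_inv (?G t) *v axis l 1) $ k = matrix_inv (?G t) $ k $ l"
      by (simp add: matrix_vector_mult_basis column_def)
    ultimately show ?thesis by simp
  qed
  have cif: "continuous_on {0..T} (\<lambda>t. if j = k then axis l 1 $ i else ?G t $ i $ j)" for i j
    by (cases "j = k") (auto intro: continuous_grand_resistance)
  have "continuous_on {0..T} (\<lambda>t. det (\<chi> i j. if j = k then axis l 1 $ i else ?G t $ i $ j) / det (?G t))"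
  proof (rule continuous_on_divide)
    show "continuous_on {0..T} (\<lambda>t. det (\<chi> i j. if j = k then axis l 1 $ i else ?G t $ i $ j))"
      unfolding det_3 vec_lambda_beta by (intro continuous_on_add continuous_on_diff continuous_on_mult cif)
    show "continuous_on {0..T} (\<lambda>t. det (?G t))"
      unfolding det_3 by (intro continuous_on_add continuous_on_diff continuous_on_mult continuous_grand_resistance)
    show "\<forall>t\<in>{0..T}. det (?G t) \<noteq> 0" using nz by blast
  qed
  then show ?thesis by (rule continuous_on_eq) (rule eq[symmetric])
qed

end

section \<open>Integrals over the space variable\<close>

lemma LINT_lebesgue_on_eq_lborel:
  fixes f h :: "real \<Rightarrow> 'a::euclidean_space"
  assumes f: "f \<in> borel_measurable (lebesgue_on S)" and h: "h \<in> borel_measurable borel"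
    and S: "S \<in> sets borel" and ae: "AE s in lebesgue_on S. f s = h s" and z: "\<And>s. s \<notin> S \<Longrightarrow> h s = 0"
  shows "(LINT s|lebesgue_on S. f s) = (LINT s|lborel. h s)"
proof -
  have hm: "h \<in> borel_measurable (lebesgue_on S)"
    using h by (intro measurable_restrict_space1 measurable_completion) auto
  have "(LINT s|lebesgue_on S. f s) = (LINT s|lebesgue_on S. h s)"
    by (rule integral_cong_AE[OF f hm ae])
  also have "\<dots> = (LINT s|lebesgue. indicator S s *\<^sub>R h s)"
    using S by (subst integral_restrict_space) auto
  also have "(\<lambda>s. indicator S s *\<^sub>R h s) = h" using z by (auto simp: fun_eq_iff indicator_def)
  also have "(LINT s|lebesgue. h s) = (LINT s|lborel. h s)"
    using h by (subst integral_completion) auto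
  finally show ?thesis .
qed

lemma integrable_lborel_if_supported:
  fixes f :: "real \<Rightarrow> 'a::euclidean_space"
  assumes f: "f \<in> borel_measurable borel" and z: "\<And>s. s \<notin> {a..b} \<Longrightarrow> f s = 0"
    and i: "f absolutely_integrable_on {a..b}"
  shows "integrable lborel f"
proof -
  have "integrable lebesgue (\<lambda>s. indicat_real {a..b} s *\<^sub>R f s)" using i unfolding set_integrable_def .
  also have "(\<lambda>s. indicat_real {a..b} s *\<^sub>R f s) = f" using z by (auto simp: fun_eq_iff indicator_def)
  finally show ?thesis using f by (subst (asm) integrable_completion) auto
qed

lemma square_norm_integral_le:
  fixes f :: "real \<Rightarrow> 'a::euclidean_space"
  assumes L: "L > 0" and f: "f \<in> borel_measurable borel" and z: "\<And>s. s \<notin> {0..L} \<Longrightarrow> f s = 0"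
    and i2: "integrable lborel (\<lambda>s. (norm (f s))\<^sup>2)"
  shows "(norm (LINT s|lborel. f s))\<^sup>2 \<le> L * (LINT s|lborel. (norm (f s))\<^sup>2)"
proof -
  have i: "integrable lborel f"
    by (rule integrable_lborel_if_supported[OF f z square_integrable_imp_absolutely_integrable[OF f i2]])
  define A where "A = (LINT s|lborel. norm (f s))"
  define m where "m = A / L"
  have A: "0 \<le> A" unfolding A_def by (rule integral_nonneg_AE) auto
  have e: "(norm (f s) - m * indicat_real {0..L} s)\<^sup>2 = (norm (f s))\<^sup>2 - 2 * m * norm (f s) + m\<^sup>2 * indicat_real {0..L} s" for s
    using z[of s] by (cases "s \<in> {0..L}") (simp_all add: power2_eq_square algebra_simps)
  have "0 \<le> (LINT s|lborel. (norm (f s) - m * indicat_real {0..L} s)\<^sup>2)" by (rule integral_nonneg_AE) auto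
  also have "\<dots> = (LINT s|lborel. (norm (f s))\<^sup>2) - 2 * m * A + m\<^sup>2 * L"
    unfolding e A_def using i i2 L by simp
  also have "\<dots> = (LINT s|lborel. (norm (f s))\<^sup>2) - A\<^sup>2 / L"
    using L by (simp add: m_def power2_eq_square field_simps)
  finally have "A\<^sup>2 \<le> L * (LINT s|lborel. (norm (f s))\<^sup>2)" using L by (simp add: field_simps)
  moreover have "(norm (LINT s|lborel. f s))\<^sup>2 \<le> A\<^sup>2"
    unfolding A_def by (intro power_mono integral_norm_bound) auto
  ultimately show ?thesis by simp
qed

lemma fiber_integral_L2:
  fixes h :: "real \<times> real \<Rightarrow> 'a::euclidean_space"
  assumes L: "L > 0" and h: "h \<in> borel_measurable borel" and z: "\<forall>z. z \<notin> rect L T \<longrightarrow> h z = 0"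
    and i: "integrable lborel (\<lambda>z. (norm (h z))\<^sup>2)"
  shows "(\<lambda>t. LINT s|lborel. h (s, t)) \<in> borel_measurable borel"
    and "integrable lborel (\<lambda>t. (norm (LINT s|lborel. h (s, t)))\<^sup>2)"
    and "AE t in lborel. integrable lborel (\<lambda>s. (norm (h (s, t)))\<^sup>2)"
proof -
  have sw: "(\<lambda>(t, s). h (s, t)) \<in> borel_measurable (lborel \<Otimes>\<^sub>M lborel)"
  proof -
    have "(\<lambda>z. (snd z, fst z)) \<in> borel_measurable (borel :: (real \<times> real) measure)"
      by (intro borel_measurable_continuous_onI continuous_intros)
    from measurable_compose[OF this h] show ?thesis by (simp add: lborel_prod split_def)
  qed
  have "(\<lambda>t. LINT s|lborel. h (s, t)) \<in> borel_measurable lborel"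
    by (rule lborel.borel_measurable_lebesgue_integral[OF sw])
  then show m: "(\<lambda>t. LINT s|lborel. h (s, t)) \<in> borel_measurable borel" by simp
  have ip: "integrable (lborel \<Otimes>\<^sub>M lborel) (\<lambda>(s, t). (norm (h (s, t)))\<^sup>2)"
    using i by (simp add: lborel_prod split_def)
  show ae: "AE t in lborel. integrable lborel (\<lambda>s. (norm (h (s, t)))\<^sup>2)"
    using lborel_pair.AE_integrable_snd[OF ip] .
  have hs: "(\<lambda>s. h (s, t)) \<in> borel_measurable borel" for t using h by measurable
  show "integrable lborel (\<lambda>t. (norm (LINT s|lborel. h (s, t)))\<^sup>2)"
  proof (rule Bochner_Integration.integrable_bound)
    show "integrable lborel (\<lambda>t. L * (LINT s|lborel. (norm (h (s, t)))\<^sup>2))"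
      using lborel_pair.integrable_snd[OF ip] by simp
    show "(\<lambda>t. (norm (LINT s|lborel. h (s, t)))\<^sup>2) \<in> borel_measurable lborel" using m by simp
    show "AE t in lborel. norm ((norm (LINT s|lborel. h (s, t)))\<^sup>2) \<le> norm (L * (LINT s|lborel. (norm (h (s, t)))\<^sup>2))"
      using ae
    proof eventually_elim
      case (elim t)
      have "(norm (LINT s|lborel. h (s, t)))\<^sup>2 \<le> L * (LINT s|lborel. (norm (h (s, t)))\<^sup>2)"
        by (rule square_norm_integral_le[OF L hs _ elim]) (use z in \<open>auto simp: rect_def\<close>)
      then show ?case by (simp add: abs_le_iff)
    qed
  qed
qed

text \<open>The regularity in time of elements of \<open>X\<close>, with a Borel version \<open>h\<close> of the time derivative.
  It makes no reference to weak derivatives and is stable under products.\<close>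

definition time_prim :: "real \<Rightarrow> real \<Rightarrow> (real \<Rightarrow> real \<Rightarrow> 'a::euclidean_space) \<Rightarrow> (real \<times> real \<Rightarrow> 'a) \<Rightarrow> bool" where
  "time_prim L T u h \<longleftrightarrow> h \<in> borel_measurable borel \<and> (\<forall>z. z \<notin> rect L T \<longrightarrow> h z = 0) \<and>
    integrable lborel (\<lambda>z. (norm (h z))\<^sup>2) \<and> continuous_on ({0..L} \<times> {0..T}) (\<lambda>(s, t). u s t) \<and>
    (AE s in lebesgue_on {0..L}. (\<lambda>t. h (s, t)) absolutely_integrable_on {0..T} \<and>
       (\<forall>t\<in>{0..T}. u s t = u s 0 + integral {0..t} (\<lambda>t. h (s, t))))"

lemma time_prim_X:
  assumes "L > 0" "T > 0" "\<eta> \<in> space_X L T"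
  obtains g0 where "time_prim L T \<eta> g0"
    "AE t in lebesgue_on {0..T}. AE s in lebesgue_on {0..L}.
       time_derivative L T \<eta> s t = g0 (s, t) \<and> (\<eta> s has_vector_derivative time_derivative L T \<eta> s t) (at t within {0..T})"
proof -
  have c: "continuous_on ({0..L} \<times> {0..T}) (\<lambda>(s, t). \<eta> s t)" and ex: "\<exists>g. is_time_derivative L T \<eta> g"
    using assms(3) unfolding space_X_def by blast+
  have "is_time_derivative L T \<eta> (time_derivative L T \<eta>)"
    using ex unfolding time_derivative_def by (rule someI_ex)
  then obtain g0 where g0: "g0 \<in> borel_measurable borel" "\<forall>z. z \<notin> rect L T \<longrightarrow> g0 z = 0"
    "integrable lborel (\<lambda>z. (norm (g0 z))\<^sup>2)"
    "AE s in lebesgue_on {0..L}. (\<lambda>t. g0 (s, t)) absolutely_integrable_on {0..T} \<and>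
       (\<forall>t\<in>{0..T}. \<eta> s t = \<eta> s 0 + integral {0..t} (\<lambda>t. g0 (s, t)))"
    and ae: "AE t in lebesgue_on {0..T}. AE s in lebesgue_on {0..L}.
       time_derivative L T \<eta> s t = g0 (s, t) \<and> (\<eta> s has_vector_derivative time_derivative L T \<eta> s t) (at t within {0..T})"
    by (rule time_regularity[OF assms(1,2) c])
  have "time_prim L T \<eta> g0" unfolding time_prim_def by (intro conjI g0 c)
  then show ?thesis using ae by (rule that)
qed

lemma time_prim_bilinear:
  fixes prod :: "'a::euclidean_space \<Rightarrow> 'b::euclidean_space \<Rightarrow> 'c::euclidean_space"
  assumes L: "L > 0" and T: "T > 0" and bb: "bounded_bilinear prod" and u: "time_prim L T u h" and v: "time_prim L T v k"
  obtains m where "time_prim L T (\<lambda>s t. prod (u s t) (v s t)) m"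
proof -
  interpret bounded_bilinear prod by (rule bb)
  have h: "h \<in> borel_measurable borel" "\<forall>z. z \<notin> rect L T \<longrightarrow> h z = 0" "integrable lborel (\<lambda>z. (norm (h z))\<^sup>2)"
    and cu: "continuous_on ({0..L} \<times> {0..T}) (\<lambda>(s, t). u s t)"
    and k: "k \<in> borel_measurable borel" "\<forall>z. z \<notin> rect L T \<longrightarrow> k z = 0" "integrable lborel (\<lambda>z. (norm (k z))\<^sup>2)"
    and cv: "continuous_on ({0..L} \<times> {0..T}) (\<lambda>(s, t). v s t)"
    using u v by (auto simp: time_prim_def)
  obtain U where U: "continuous_on UNIV U" "\<And>s t. s \<in> {0..L} \<Longrightarrow> t \<in> {0..T} \<Longrightarrow> U (s, t) = u s t" "bounded (range U)"
    using continuous_extension_rectangle[OF less_imp_le[OF L] less_imp_le[OF T] cu] by metis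
  obtain V where V: "continuous_on UNIV V" "\<And>s t. s \<in> {0..L} \<Longrightarrow> t \<in> {0..T} \<Longrightarrow> V (s, t) = v s t" "bounded (range V)"
    using continuous_extension_rectangle[OF less_imp_le[OF L] less_imp_le[OF T] cv] by metis
  obtain B where B: "B > 0" "\<And>x y. norm (prod x y) \<le> norm x * norm y * B" using pos_bounded by blast
  obtain CU where CU: "CU > 0" "\<And>z. norm (U z) \<le> CU" using U(3) unfolding bounded_pos by auto
  obtain CV where CV: "CV > 0" "\<And>z. norm (V z) \<le> CV" using V(3) unfolding bounded_pos by auto
  define m where "m z = prod (U z) (k z) + prod (h z) (V z)" for z
  have pm: "(\<lambda>z. prod (f z) (g z)) \<in> borel_measurable borel"
    if "f \<in> borel_measurable borel" "g \<in> borel_measurable borel" for f :: "real \<times> real \<Rightarrow> 'a" and g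
    by (rule borel_measurable_continuous_Pair[OF that])
      (rule continuous_on[OF continuous_on_fst[OF continuous_on_id] continuous_on_snd[OF continuous_on_id]])
  have m: "m \<in> borel_measurable borel"
    unfolding m_def using U(1) V(1) h(1) k(1)
    by (intro borel_measurable_add pm) (auto intro: borel_measurable_continuous_onI)
  have mz: "\<forall>z. z \<notin> rect L T \<longrightarrow> m z = 0" using h(2) k(2) by (simp add: m_def zero_left zero_right)
  have mb: "(norm (m z))\<^sup>2 \<le> 2 * (CU * B)\<^sup>2 * (norm (k z))\<^sup>2 + 2 * (CV * B)\<^sup>2 * (norm (h z))\<^sup>2" for z
  proof -
    have "norm (m z) \<le> norm (U z) * norm (k z) * B + norm (h z) * norm (V z) * B"
      unfolding m_def by (intro norm_triangle_le add_mono B)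
    also have "\<dots> \<le> CU * norm (k z) * B + norm (h z) * CV * B"
      using B CU CV by (intro add_mono mult_right_mono mult_left_mono) auto
    finally have "norm (m z) \<le> (CU * B) * norm (k z) + (CV * B) * norm (h z)" by (simp add: ac_simps)
    then have "(norm (m z))\<^sup>2 \<le> ((CU * B) * norm (k z) + (CV * B) * norm (h z))\<^sup>2" by (intro power_mono) auto
    also have "\<dots> \<le> 2 * ((CU * B) * norm (k z))\<^sup>2 + 2 * ((CV * B) * norm (h z))\<^sup>2"
      using sum_squares_bound[of "(CU * B) * norm (k z)" "(CV * B) * norm (h z)"] by (simp add: power2_sum)
    finally show ?thesis by (simp only: power_mult_distrib mult.assoc)
  qed
  have mi: "integrable lborel (\<lambda>z. (norm (m z))\<^sup>2)"
  proof (rule Bochner_Integration.integrable_bound)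
    show "integrable lborel (\<lambda>z. 2 * (CU * B)\<^sup>2 * (norm (k z))\<^sup>2 + 2 * (CV * B)\<^sup>2 * (norm (h z))\<^sup>2)"
      using h(3) k(3) by simp
    show "(\<lambda>z. (norm (m z))\<^sup>2) \<in> borel_measurable lborel" using m by simp
    show "AE z in lborel. norm ((norm (m z))\<^sup>2) \<le> norm (2 * (CU * B)\<^sup>2 * (norm (k z))\<^sup>2 + 2 * (CV * B)\<^sup>2 * (norm (h z))\<^sup>2)"
      using mb by (intro AE_I2) (auto intro: order_trans)
  qed
  have c: "continuous_on ({0..L} \<times> {0..T}) (\<lambda>(s, t). prod (u s t) (v s t))"
    using continuous_on[OF cu cv] by (simp add: split_def)
  have ms: "AE s in lborel. (\<lambda>t. m (s, t)) absolutely_integrable_on {0..T}"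
  proof -
    have "AE s in lborel. integrable lborel (\<lambda>t. (norm (m (s, t)))\<^sup>2)"
      using lborel_pair.AE_integrable_fst'[of "\<lambda>z. (norm (m z))\<^sup>2"] mi by (simp add: lborel_prod)
    moreover have "(\<lambda>t. m (s, t)) \<in> borel_measurable borel" for s using m by measurable
    ultimately show ?thesis by (elim eventually_mono) (rule square_integrable_imp_absolutely_integrable)
  qed
  have "AE s in lborel. s \<in> {0..L} \<longrightarrow> (\<lambda>t. h (s, t)) absolutely_integrable_on {0..T} \<and>
       (\<forall>t\<in>{0..T}. u s t = u s 0 + integral {0..t} (\<lambda>t. h (s, t)))"
    "AE s in lborel. s \<in> {0..L} \<longrightarrow> (\<lambda>t. k (s, t)) absolutely_integrable_on {0..T} \<and>
       (\<forall>t\<in>{0..T}. v s t = v s 0 + integral {0..t} (\<lambda>t. k (s, t)))"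
    using u v unfolding time_prim_def by (simp_all only: AE_lebesgue_on_iff_lborel lmeasurable_iff_integrable sets_completionI_sets sets_lborel atLeastAtMost_borel)
  then have "AE s in lborel. s \<in> {0..L} \<longrightarrow> (\<lambda>t. m (s, t)) absolutely_integrable_on {0..T} \<and>
       (\<forall>t\<in>{0..T}. prod (u s t) (v s t) = prod (u s 0) (v s 0) + integral {0..t} (\<lambda>t. m (s, t)))"
    using ms
  proof eventually_elim
    case (elim s)
    show ?case
    proof (intro impI conjI ballI)
      assume s: "s \<in> {0..L}"
      show mai: "(\<lambda>t. m (s, t)) absolutely_integrable_on {0..T}" by (rule elim(3))
      have hs: "(\<lambda>t. h (s, t)) absolutely_integrable_on {0..T}"
        and us: "\<And>t. t \<in> {0..T} \<Longrightarrow> u s t = u s 0 + integral {0..t} (\<lambda>t. h (s, t))"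
        using elim(1) s by blast+
      have ks: "(\<lambda>t. k (s, t)) absolutely_integrable_on {0..T}"
        and vs: "\<And>t. t \<in> {0..T} \<Longrightarrow> v s t = v s 0 + integral {0..t} (\<lambda>t. k (s, t))"
        using elim(2) s by blast+
      have ac: "abs_continuous 0 T (\<lambda>t. prod (u s t) (v s t))"
        by (intro abs_continuous_bilinear[OF bb] abs_continuous_if_indefinite_integral[OF hs us] abs_continuous_if_indefinite_integral[OF ks vs])
      have AE0: "AE t in lebesgue_on {0..T}. t \<in> {0..T}" by (rule AE_I2) simp
      have "AE t in lebesgue_on {0..T}. t \<in> {0..T} \<and> (u s has_vector_derivative h (s, t)) (at t within {0..T}) \<and> (v s has_vector_derivative k (s, t)) (at t within {0..T})"
      proof -
        have "AE t in lebesgue_on {0..T}. (u s has_vector_derivative h (s, t)) (at t within {0..T})"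
          by (rule AE_derivative_if_indefinite_integral[OF hs us])
        moreover have "AE t in lebesgue_on {0..T}. (v s has_vector_derivative k (s, t)) (at t within {0..T})"
          by (rule AE_derivative_if_indefinite_integral[OF ks vs])
        ultimately show ?thesis using AE0 by eventually_elim blast
      qed
      then have der: "AE t in lebesgue_on {0..T}. ((\<lambda>t. prod (u s t) (v s t)) has_vector_derivative m (s, t)) (at t within {0..T})"
      proof eventually_elim
        case (elim t)
        then have "((\<lambda>t. prod (u s t) (v s t)) has_vector_derivative prod (u s t) (k (s, t)) + prod (h (s, t)) (v s t)) (at t within {0..T})"
          by (intro has_vector_derivative) auto
        then show ?case using elim U(2)[OF s] V(2)[OF s] by (simp add: m_def)
      qed
      fix t assume "t \<in> {0..T}"
      from indefinite_integral_if_AE_derivative[OF ac mai der this]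
      show "prod (u s t) (v s t) = prod (u s 0) (v s 0) + integral {0..t} (\<lambda>t. m (s, t))" .
    qed
  qed
  then have "AE s in lebesgue_on {0..L}. (\<lambda>t. m (s, t)) absolutely_integrable_on {0..T} \<and>
       (\<forall>t\<in>{0..T}. prod (u s t) (v s t) = prod (u s 0) (v s 0) + integral {0..t} (\<lambda>t. m (s, t)))"
    by (subst AE_lebesgue_on_iff_lborel) auto
  then show ?thesis using that m mz mi c unfolding time_prim_def by blast
qed

lemma time_prim_fiber_integral:
  fixes u :: "real \<Rightarrow> real \<Rightarrow> 'a::euclidean_space"
  assumes L: "L > 0" and T: "T > 0" and u: "time_prim L T u h"
  shows "abs_continuous 0 T (\<lambda>t. LINT s|lebesgue_on {0..L}. u s t)"
    and "AE t in lebesgue_on {0..T}. (\<lambda>t. LINT s|lebesgue_on {0..L}. u s t) differentiable (at t within {0..T})"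
proof -
  have h: "h \<in> borel_measurable borel" "\<forall>z. z \<notin> rect L T \<longrightarrow> h z = 0" "integrable lborel (\<lambda>z. (norm (h z))\<^sup>2)"
    and cu: "continuous_on ({0..L} \<times> {0..T}) (\<lambda>(s, t). u s t)"
    and ae: "AE s in lebesgue_on {0..L}. (\<lambda>t. h (s, t)) absolutely_integrable_on {0..T} \<and>
       (\<forall>t\<in>{0..T}. u s t = u s 0 + integral {0..t} (\<lambda>t. h (s, t)))"
    using u by (auto simp: time_prim_def)
  define f where "f t = (LINT s|lborel. h (s, t))" for t
  have f: "f \<in> borel_measurable borel" "integrable lborel (\<lambda>t. (norm (f t))\<^sup>2)"
    using fiber_integral_L2(1,2)[OF L h] by (simp_all add: f_def[abs_def])
  have fz: "f t = 0" if "t \<notin> {0..T}" for t using h(2) that by (simp add: f_def rect_def)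
  have fai: "f absolutely_integrable_on {0..T}" by (rule square_integrable_imp_absolutely_integrable[OF f])
  let ?U = "\<lambda>t. LINT s|lebesgue_on {0..L}. u s t"
  have eq: "?U t = ?U 0 + integral {0..t} f" if t: "t \<in> {0..T}" for t
  proof -
    define H where "H z = indicat_real {0..t} (snd z) *\<^sub>R h z" for z
    have "(\<lambda>z. indicat_real {0..t} (snd z)) \<in> borel_measurable (borel :: (real \<times> real) measure)"
    proof (rule measurable_compose[of snd borel borel])
      show "snd \<in> borel_measurable (borel :: (real \<times> real) measure)"
        by (intro borel_measurable_continuous_onI continuous_intros)
    qed simp
    then have H: "H \<in> borel_measurable borel" unfolding H_def using h(1) by (rule borel_measurable_scaleR)
    have rectm: "emeasure lborel (rect L T) < \<infinity>"
    proof -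
      have "rect L T = cbox (0, 0) (L, T)" by (simp add: rect_def cbox_Pair_eq)
      then show ?thesis by (simp only: emeasure_lborel_cbox_finite)
    qed
    have Hi: "integrable lborel H"
    proof (rule Bochner_Integration.integrable_bound)
      show "integrable lborel (\<lambda>z. (norm (h z))\<^sup>2 + indicat_real (rect L T) z)"
        using h(3) rectm by (intro Bochner_Integration.integrable_add integrable_real_indicator) auto
      show "H \<in> borel_measurable lborel" using H by simp
      have "norm (H z) \<le> norm ((norm (h z))\<^sup>2 + indicat_real (rect L T) z)" for z
      proof (cases "z \<in> rect L T")
        case True
        have "norm (h z) \<le> (norm (h z))\<^sup>2 + 1"
          using sum_power2_ge_zero[of "norm (h z) - 1/2" 0] by (simp add: power2_eq_square algebra_simps)
        moreover have "norm (H z) \<le> norm (h z)" by (simp add: H_def indicator_def)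
        ultimately show ?thesis using True by simp
      next
        case False
        then have "h z = 0" using h(2) by blast
        then show ?thesis by (simp add: H_def)
      qed
      then show "AE z in lborel. norm (H z) \<le> norm ((norm (h z))\<^sup>2 + indicat_real (rect L T) z)" by simp
    qed
    have t0: "(0::real) \<in> {0..T}" using T by simp
    have iu: "integrable (lebesgue_on {0..L}) (\<lambda>s. u s \<tau>)" if "\<tau> \<in> {0..T}" for \<tau>
      by (rule integrable_continuous_lebesgue_on[OF continuous_on_slices(1)[OF cu that]])
    have "?U t - ?U 0 = (LINT s|lebesgue_on {0..L}. u s t - u s 0)"
      using iu[OF t] iu[OF t0] by simp
    also have "\<dots> = (LINT s|lborel. LINT \<tau>|lborel. H (s, \<tau>))"
    proof (rule LINT_lebesgue_on_eq_lborel)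
      show "(\<lambda>s. u s t - u s 0) \<in> borel_measurable (lebesgue_on {0..L})"
        using iu[OF t] iu[OF t0] by (intro borel_measurable_diff) auto
      have "(\<lambda>(s, \<tau>). H (s, \<tau>)) \<in> borel_measurable (lborel \<Otimes>\<^sub>M lborel)"
        using H by (simp add: lborel_prod split_def)
      then show "(\<lambda>s. LINT \<tau>|lborel. H (s, \<tau>)) \<in> borel_measurable borel"
        using lborel.borel_measurable_lebesgue_integral[of "\<lambda>s \<tau>. H (s, \<tau>)" lborel] by simp
      show "(LINT \<tau>|lborel. H (s, \<tau>)) = 0" if "s \<notin> {0..L}" for s
      proof -
        have "h (s, \<tau>) = 0" for \<tau> using h(2)[rule_format, of "(s, \<tau>)"] that by (auto simp: rect_def)
        then show ?thesis by (simp add: H_def)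
      qed
      show "AE s in lebesgue_on {0..L}. u s t - u s 0 = (LINT \<tau>|lborel. H (s, \<tau>))"
        using ae
      proof eventually_elim
        case (elim s)
        have hs: "(\<lambda>t. h (s, t)) \<in> borel_measurable borel" using h(1) by measurable
        have ait: "(\<lambda>t. h (s, t)) absolutely_integrable_on {0..t}"
        proof -
          have "(\<lambda>t. h (s, t)) absolutely_integrable_on {0..T}" using elim by blast
          from absolutely_integrable_on_subinterval[OF this, of 0 t] show ?thesis using t by simp
        qed
        have "u s t = u s 0 + integral {0..t} (\<lambda>t. h (s, t))" using elim t by blast
        then have "u s t - u s 0 = integral {0..t} (\<lambda>t. h (s, t))" by (simp only: add_diff_cancel_left')
        also have "\<dots> = (LINT \<tau>|lebesgue_on {0..t}. h (s, \<tau>))" by (rule LINT_eq_integral[OF ait, symmetric])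
        also have "\<dots> = (LINT \<tau>|lborel. H (s, \<tau>))"
        proof (rule LINT_lebesgue_on_eq_lborel)
          show "(\<lambda>\<tau>. h (s, \<tau>)) \<in> borel_measurable (lebesgue_on {0..t})"
            using hs by (intro measurable_restrict_space1 measurable_completion) auto
          show "(\<lambda>\<tau>. H (s, \<tau>)) \<in> borel_measurable borel" using H by measurable
          show "AE \<tau> in lebesgue_on {0..t}. h (s, \<tau>) = H (s, \<tau>)"
            by (subst AE_lebesgue_on_iff_lborel) (auto simp: H_def)
        qed (auto simp: H_def)
        finally show ?case .
      qed
    qed simp
    also have "\<dots> = (LINT \<tau>|lborel. LINT s|lborel. H (s, \<tau>))"
      using lborel_pair.Fubini_integral[of "\<lambda>s \<tau>. H (s, \<tau>)"] Hi by (simp add: lborel_prod split_def)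
    also have "\<dots> = (LINT \<tau>|lborel. indicat_real {0..t} \<tau> *\<^sub>R f \<tau>)"
      by (simp add: H_def f_def)
    also have "\<dots> = (LINT \<tau>|lebesgue_on {0..t}. f \<tau>)"
    proof (rule LINT_lebesgue_on_eq_lborel[symmetric])
      show "f \<in> borel_measurable (lebesgue_on {0..t})"
        using f(1) by (intro measurable_restrict_space1 measurable_completion) auto
      show "(\<lambda>\<tau>. indicat_real {0..t} \<tau> *\<^sub>R f \<tau>) \<in> borel_measurable borel" using f(1) by measurable
      show "AE \<tau> in lebesgue_on {0..t}. f \<tau> = indicat_real {0..t} \<tau> *\<^sub>R f \<tau>"
        by (subst AE_lebesgue_on_iff_lborel) auto
    qed auto
    also have "\<dots> = integral {0..t} f"
      by (rule LINT_eq_integral[OF square_integrable_imp_absolutely_integrable[OF f]])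
    finally show ?thesis by (simp add: algebra_simps)
  qed
  show "abs_continuous 0 T ?U" by (rule abs_continuous_if_indefinite_integral[OF fai eq])
  show "AE t in lebesgue_on {0..T}. ?U differentiable (at t within {0..T})"
  proof -
    have "AE t in lebesgue_on {0..T}. (?U has_vector_derivative f t) (at t within {0..T})"
      by (rule AE_derivative_if_indefinite_integral[OF fai eq])
    then show ?thesis by (rule eventually_mono) (rule differentiableI_vector)
  qed
qed

section \<open>Rigid motions\<close>

lemma LINT_spike:
  fixes f g :: "real \<Rightarrow> 'a::euclidean_space"
  assumes f: "f absolutely_integrable_on {a..b}" and ae: "AE x in lebesgue_on {a..b}. g x = f x"
  shows "(LINT x|lebesgue_on {a..b}. g x) = (LINT x|lebesgue_on {a..b}. f x)" "g absolutely_integrable_on {a..b}"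
proof -
  have N: "negligible {x \<in> {a..b}. g x \<noteq> f x}"
    using ae by (subst (asm) AE_lebesgue_on_iff_negligible) auto
  show g: "g absolutely_integrable_on {a..b}"
    by (rule absolutely_integrable_spike[OF f N]) auto
  have "integral {a..b} g = integral {a..b} f"
    by (rule integral_spike[OF N]) auto
  then show "(LINT x|lebesgue_on {a..b}. g x) = (LINT x|lebesgue_on {a..b}. f x)"
    unfolding LINT_eq_integral[OF f] LINT_eq_integral[OF g] .
qed

lemma rotation_matrix_2:
  fixes Q :: "real^2^2"
  assumes "rotation_matrix Q"
  shows "(Q $ 1 $ 1)\<^sup>2 + (Q $ 2 $ 1)\<^sup>2 = 1" "Q $ 2 $ 2 = Q $ 1 $ 1" "Q $ 1 $ 2 = - Q $ 2 $ 1"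
    "Q *v x = (Q $ 1 $ 1) *\<^sub>R x + (Q $ 2 $ 1) *\<^sub>R (J *v x)"
proof -
  let ?a = "Q $ 1 $ 1" and ?b = "Q $ 1 $ 2" and ?c = "Q $ 2 $ 1" and ?d = "Q $ 2 $ 2"
  have "transpose Q ** Q = mat 1" and det: "?a * ?d - ?b * ?c = 1"
    using assms by (auto simp: rotation_matrix_def orthogonal_matrix det_2)
  then have "(transpose Q ** Q) $ 1 $ 1 = 1" "(transpose Q ** Q) $ 2 $ 2 = 1"
    by (simp_all add: mat_def)
  then have 1: "?a * ?a + ?c * ?c = 1" and 2: "?b * ?b + ?d * ?d = 1"
    by (simp_all add: matrix_matrix_mult_def transpose_def sum_2)
  show "?a\<^sup>2 + ?c\<^sup>2 = 1" using 1 by (simp add: power2_eq_square)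
  have "(?a - ?d)\<^sup>2 + (?b + ?c)\<^sup>2 = 0"
    using 1 2 det by (simp add: power2_eq_square algebra_simps)
  then have "?a - ?d = 0 \<and> ?b + ?c = 0" by (simp add: sum_power2_eq_zero_iff)
  then show d: "?d = ?a" and b: "?b = - ?c" by auto
  show "Q *v x = ?a *\<^sub>R x + ?c *\<^sub>R (J *v x)"
    by (simp add: vec_eq_iff forall_2 matrix_vector_mult_def[of Q] sum_2 d b)
qed

lemma rot_nth: "rot \<theta> $ 1 $ 1 = cos \<theta>" "rot \<theta> $ 1 $ 2 = - sin \<theta>" "rot \<theta> $ 2 $ 1 = sin \<theta>" "rot \<theta> $ 2 $ 2 = cos \<theta>"
  by (simp_all add: rot_def)

lemma rotation_matrix_rot: "rotation_matrix (rot \<theta>)"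
proof -
  have "transpose (rot \<theta>) ** rot \<theta> = mat 1"
    by (simp add: vec_eq_iff forall_2 matrix_matrix_mult_def transpose_def sum_2 rot_nth mat_def power2_eq_square[symmetric])
  then show ?thesis
    by (simp add: rotation_matrix_def orthogonal_matrix det_2 rot_nth power2_eq_square[symmetric])
qed

lemma rot_apply: "rot \<theta> *v x = cos \<theta> *\<^sub>R x + sin \<theta> *\<^sub>R (J *v x)"
  using rotation_matrix_2(4)[OF rotation_matrix_rot, of \<theta> x] by (simp add: rot_nth)

lemma rotation_matrix_inner:
  fixes Q :: "real^2^2"
  assumes "rotation_matrix Q"
  shows "(Q *v x) \<bullet> (Q *v y) = x \<bullet> y"
proof -
  have "(Q *v x) \<bullet> (Q *v y) = ((Q $ 1 $ 1)\<^sup>2 + (Q $ 2 $ 1)\<^sup>2) * (x \<bullet> y)"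
    unfolding rotation_matrix_2(4)[OF assms] by (simp add: inner_2 power2_eq_square algebra_simps)
  then show ?thesis using rotation_matrix_2(1)[OF assms] by simp
qed

lemma rotation_matrix_J:
  fixes Q :: "real^2^2"
  assumes "rotation_matrix Q"
  shows "J *v (Q *v x) = Q *v (J *v x)"
  unfolding rotation_matrix_2(4)[OF assms] by (simp add: matrix_vector_right_distrib matrix_vector_mult_scaleR)

lemma rotation_matrix_norm:
  fixes Q :: "real^2^2"
  assumes "rotation_matrix Q"
  shows "norm (Q *v x) = norm x"
  by (simp add: norm_eq_sqrt_inner rotation_matrix_inner[OF assms])

lemma drag_rotation:
  assumes Q: "rotation_matrix Q"
  shows "drag C\<^sub>\<tau> C\<^sub>\<nu> (Q *v p) *v (Q *v x) = Q *v (drag C\<^sub>\<tau> C\<^sub>\<nu> p *v x)"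
  unfolding drag_apply rotation_matrix_J[OF Q] rotation_matrix_inner[OF Q]
  by (simp add: matrix_vector_right_distrib matrix_vector_mult_scaleR)

lemma space_derivative_rigid:
  assumes L: "L > 0" and s: "s \<in> {0..L}"
    and d: "((\<lambda>\<sigma>. \<xi> \<sigma> t) has_vector_derivative p) (at s within {0..L})"
  shows "space_derivative L (\<lambda>s t. y t + Q t *v \<xi> s t) s t = Q t *v p"
  unfolding space_derivative_def
proof (rule vector_derivative_within_closed_interval[OF L s])
  have "((\<lambda>\<sigma>. y t + Q t *v \<xi> \<sigma> t) has_vector_derivative 0 + Q t *v p) (at s within {0..L})"
    by (intro has_vector_derivative_add has_vector_derivative_const
        bounded_linear.has_vector_derivative[OF matrix_vector_mul_bounded_linear] d)
  then show "((\<lambda>\<sigma>. y t + Q t *v \<xi> \<sigma> t) has_vector_derivative Q t *v p) (at s within {0..L})" by simp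
qed

context swimmer begin

lemma space_derivative_rigid_tng:
  assumes "s \<in> {0..L}" "t \<in> {0..T}"
  shows "space_derivative L (\<lambda>s t. y t + Q t *v \<xi> s t) s t = Q t *v tng s t"
  by (rule space_derivative_rigid[where y=y and Q=Q and \<xi>=\<xi> and t=t, OF L assms(1) has_derivative_tng[OF assms]])

lemma balance_rigid:
  fixes y :: "real \<Rightarrow> real^2" and Q :: "real \<Rightarrow> real^2^2"
  assumes t: "t \<in> {0..T}" and g: "(\<lambda>s. \<xi>dot s t) absolutely_integrable_on {0..L}"
    and Q: "rotation_matrix (Q t)"
    and td: "AE s in lebesgue_on {0..L}. td s = Q t *v (v + \<omega> *\<^sub>R (J *v \<xi> s t) + \<xi>dot s t)"
  defines "\<zeta> \<equiv> \<lambda>s t. y t + Q t *v \<xi> s t"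
  shows "(LINT s|lebesgue_on {0..L}. K C\<^sub>\<tau> C\<^sub>\<nu> L \<zeta> s t *v td s) = 0 \<and>
      (LINT s|lebesgue_on {0..L}. (K C\<^sub>\<tau> C\<^sub>\<nu> L \<zeta> s t *v td s) \<bullet> (J *v \<zeta> s t)) = 0
    \<longleftrightarrow> v = vel C\<^sub>\<tau> C\<^sub>\<nu> L T \<xi> t \<and> \<omega> = ang_vel C\<^sub>\<tau> C\<^sub>\<nu> L T \<xi> t"
proof -
  define w where "w s = v + \<omega> *\<^sub>R (J *v \<xi> s t) + \<xi>dot s t" for s
  define W where "W s = KK s t *v w s" for s
  have w: "w absolutely_integrable_on {0..L}"
    unfolding w_def
    by (intro set_integral_add(1) g absolutely_integrable_continuous_real continuous_intros cont_J slice_\<xi> t)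
  have W: "integrable (lebesgue_on {0..L}) W" "integrable (lebesgue_on {0..L}) (\<lambda>s. (J *v \<xi> s t) \<bullet> W s)"
    unfolding W_def using integrable_KK[OF t w] by auto
  have ai: "f absolutely_integrable_on {0..L}" if "integrable (lebesgue_on {0..L}) f" for f :: "real \<Rightarrow> 'b::euclidean_space"
    using that unfolding set_integrable_def by (subst (asm) integrable_restrict_space) auto
  have QW: "integrable (lebesgue_on {0..L}) (\<lambda>s. Q t *v W s)"
    by (rule integrable_bounded_linear[OF matrix_vector_mul_bounded_linear W(1)])
  have QWJ: "integrable (lebesgue_on {0..L}) (\<lambda>s. (Q t *v W s) \<bullet> (J *v y t) + (J *v \<xi> s t) \<bullet> W s)"
    using QW W(2) by simp
  have AE0: "AE s in lebesgue_on {0..L}. s \<in> {0..L}" by (rule AE_I2) simp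
  have K: "K C\<^sub>\<tau> C\<^sub>\<nu> L \<zeta> s t *v (Q t *v w s) = Q t *v W s" if "s \<in> {0..L}" for s
    unfolding \<zeta>_def K_eq_drag space_derivative_rigid_tng[OF that t] drag_rotation[OF Q] W_def ..
  have ae1: "AE s in lebesgue_on {0..L}. K C\<^sub>\<tau> C\<^sub>\<nu> L \<zeta> s t *v td s = Q t *v W s"
    using td AE0 by eventually_elim (simp add: K w_def[symmetric])
  have e: "(Q t *v W s) \<bullet> (J *v \<zeta> s t) = (Q t *v W s) \<bullet> (J *v y t) + (J *v \<xi> s t) \<bullet> W s" for s
    unfolding \<zeta>_def matrix_vector_right_distrib inner_add_right rotation_matrix_J[OF Q] rotation_matrix_inner[OF Q]
    by (simp add: inner_commute)
  have ae2: "AE s in lebesgue_on {0..L}. (K C\<^sub>\<tau> C\<^sub>\<nu> L \<zeta> s t *v td s) \<bullet> (J *v \<zeta> s t) = (Q t *v W s) \<bullet> (J *v y t) + (J *v \<xi> s t) \<bullet> W s"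
    using ae1 by eventually_elim (simp add: e)
  have 1: "(LINT s|lebesgue_on {0..L}. K C\<^sub>\<tau> C\<^sub>\<nu> L \<zeta> s t *v td s) = Q t *v (LINT s|lebesgue_on {0..L}. W s)"
    unfolding LINT_spike(1)[OF ai[OF QW] ae1]
    by (rule integral_bounded_linear[OF matrix_vector_mul_bounded_linear W(1)])
  have 2: "(LINT s|lebesgue_on {0..L}. (K C\<^sub>\<tau> C\<^sub>\<nu> L \<zeta> s t *v td s) \<bullet> (J *v \<zeta> s t)) =
      (Q t *v (LINT s|lebesgue_on {0..L}. W s)) \<bullet> (J *v y t) + (LINT s|lebesgue_on {0..L}. (J *v \<xi> s t) \<bullet> W s)"
    unfolding LINT_spike(1)[OF ai[OF QWJ] ae2] integral_bounded_linear[OF matrix_vector_mul_bounded_linear W(1), symmetric]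
    using QW W(2) by simp
  have z: "Q t *v x = 0 \<longleftrightarrow> x = 0" for x
    using rotation_matrix_norm[OF Q, of x] by (metis norm_eq_zero)
  show ?thesis
    unfolding 1 2 z balance_iff[OF t g, of v \<omega>, folded w_def, folded W_def, symmetric] by auto
qed

lemma velocity_borel_version:
  obtains zB :: "real \<Rightarrow> real^3"
  where "zB \<in> borel_measurable borel" "integrable lborel (\<lambda>t. (norm (zB t))\<^sup>2)"
    "AE t in lebesgue_on {0..T}. vec3 (vel C\<^sub>\<tau> C\<^sub>\<nu> L T \<xi> t) (ang_vel C\<^sub>\<tau> C\<^sub>\<nu> L T \<xi> t) = zB t"
    "AE t in lebesgue_on {0..T}. (\<lambda>s. \<xi>dot s t) absolutely_integrable_on {0..L}"
proof -
  obtain g0 where tp: "time_prim L T \<xi> g0"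
    and ae: "AE t in lebesgue_on {0..T}. AE s in lebesgue_on {0..L}.
       \<xi>dot s t = g0 (s, t) \<and> (\<xi> s has_vector_derivative \<xi>dot s t) (at t within {0..T})"
    by (rule time_prim_X[OF L T \<xi>_X])
  have g0: "g0 \<in> borel_measurable borel" "\<forall>z. z \<notin> rect L T \<longrightarrow> g0 z = 0" "integrable lborel (\<lambda>z. (norm (g0 z))\<^sup>2)"
    using tp by (auto simp: time_prim_def)
  obtain P where P: "continuous_on UNIV P" "\<And>s t. s \<in> {0..L} \<Longrightarrow> t \<in> {0..T} \<Longrightarrow> P (s, t) = tng s t" "bounded (range P)"
    using continuous_extension_rectangle[OF less_imp_le[OF L] less_imp_le[OF T] cont_tng] by metis
  obtain Y where Y: "continuous_on UNIV Y" "\<And>s t. s \<in> {0..L} \<Longrightarrow> t \<in> {0..T} \<Longrightarrow> Y (s, t) = \<xi> s t" "bounded (range Y)"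
    using continuous_extension_rectangle[OF less_imp_le[OF L] less_imp_le[OF T] cont_\<xi>] by metis
  obtain CY where CY: "CY > 0" "\<And>z. norm (Y z) \<le> CY" using Y(3) unfolding bounded_pos by auto
  define hF where "hF z = drag C\<^sub>\<tau> C\<^sub>\<nu> (P z) *v g0 z" for z
  define hM where "hM z = (J *v Y z) \<bullet> hF z" for z
  have Pm: "P \<in> borel_measurable borel" "(\<lambda>z. J *v P z) \<in> borel_measurable borel" "(\<lambda>z. J *v Y z) \<in> borel_measurable borel"
    using P(1) Y(1) by (auto intro: borel_measurable_continuous_onI cont_J)
  have hFm: "hF \<in> borel_measurable borel"
    unfolding hF_def drag_apply
    by (intro borel_measurable_add borel_measurable_scaleR borel_measurable_times borel_measurable_inner Pm g0 borel_measurable_const)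
  have hMm: "hM \<in> borel_measurable borel"
    unfolding hM_def by (intro borel_measurable_inner Pm hFm)
  have hFz: "\<forall>z. z \<notin> rect L T \<longrightarrow> hF z = 0" and hMz: "\<forall>z. z \<notin> rect L T \<longrightarrow> hM z = 0"
    using g0(2) by (auto simp: hF_def hM_def)
  have hFb: "norm (hF z) \<le> (C\<^sub>\<tau> + C\<^sub>\<nu>) * norm (g0 z)" for z
  proof (cases "z \<in> rect L T")
    case True
    then obtain s t where st: "z = (s, t)" "s \<in> {0..L}" "t \<in> {0..T}" by (auto simp: rect_def)
    then have "norm (P z) = 1" using P(2) norm_tng by simp
    then show ?thesis unfolding hF_def by (intro drag_bounded C\<tau> C\<nu>)
  next
    case False
    then have "hF z = 0" using hFz by blast
    then show ?thesis using C\<tau> C\<nu> by simp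
  qed
  have hMb: "norm (hM z) \<le> CY * ((C\<^sub>\<tau> + C\<^sub>\<nu>) * norm (g0 z))" for z
  proof -
    have "norm (hM z) \<le> norm (J *v Y z) * norm (hF z)" unfolding hM_def real_norm_def by (rule Cauchy_Schwarz_ineq2)
    also have "\<dots> \<le> CY * ((C\<^sub>\<tau> + C\<^sub>\<nu>) * norm (g0 z))" using CY hFb by (intro mult_mono) auto
    finally show ?thesis .
  qed
  have sq: "integrable lborel (\<lambda>z. (norm (h z))\<^sup>2)"
    if h: "h \<in> borel_measurable borel" and b: "\<And>z. norm (h z) \<le> c * norm (g0 z)"
    for h :: "real \<times> real \<Rightarrow> 'b::euclidean_space" and c
  proof (rule Bochner_Integration.integrable_bound)
    show "integrable lborel (\<lambda>z. c\<^sup>2 * (norm (g0 z))\<^sup>2)" using g0(3) by simp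
    show "(\<lambda>z. (norm (h z))\<^sup>2) \<in> borel_measurable lborel" using h by simp
    have "(norm (h z))\<^sup>2 \<le> c\<^sup>2 * (norm (g0 z))\<^sup>2" for z
      using power_mono[OF b[of z], of 2] by (simp add: power_mult_distrib)
    then show "AE z in lborel. norm ((norm (h z))\<^sup>2) \<le> norm (c\<^sup>2 * (norm (g0 z))\<^sup>2)" by simp
  qed
  have hFi: "integrable lborel (\<lambda>z. (norm (hF z))\<^sup>2)" by (rule sq[OF hFm hFb])
  have hMi: "integrable lborel (\<lambda>z. (norm (hM z))\<^sup>2)" by (rule sq[OF hMm, of "CY * (C\<^sub>\<tau> + C\<^sub>\<nu>)"]) (use hMb in \<open>simp add: mult.assoc\<close>)
  define F where "F t = - (LINT s|lborel. hF (s, t))" for t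
  define M where "M t = - (LINT s|lborel. hM (s, t))" for t
  have F: "F \<in> borel_measurable borel" "integrable lborel (\<lambda>t. (norm (F t))\<^sup>2)"
    using fiber_integral_L2(1,2)[OF L hFm hFz hFi] by (simp_all add: F_def[abs_def])
  have M: "M \<in> borel_measurable borel" "integrable lborel (\<lambda>t. (norm (M t))\<^sup>2)"
    using fiber_integral_L2(1,2)[OF L hMm hMz hMi] by (simp_all add: M_def[abs_def])
  have AE0: "AE t in lebesgue_on {0..T}. t \<in> {0..T}" by (rule AE_I2) simp
  have "AE t in lborel. (\<lambda>s. g0 (s, t)) absolutely_integrable_on {0..L}"
    using fiber_integral_L2(3)[OF L g0]
  proof eventually_elim
    case (elim t)
    have "(\<lambda>s. g0 (s, t)) \<in> borel_measurable borel" using g0(1) by measurable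
    then show ?case using elim by (rule square_integrable_imp_absolutely_integrable)
  qed
  then have "AE t in lebesgue_on {0..T}. (\<lambda>s. g0 (s, t)) absolutely_integrable_on {0..L}"
    by (subst AE_lebesgue_on_iff_lborel) auto
  with ae AE0 have main: "AE t in lebesgue_on {0..T}. (\<lambda>s. \<xi>dot s t) absolutely_integrable_on {0..L} \<and>
      F_sh C\<^sub>\<tau> C\<^sub>\<nu> L T \<xi> t = F t \<and> M_sh C\<^sub>\<tau> C\<^sub>\<nu> L T \<xi> t = M t"
  proof eventually_elim
    case (elim t)
    have t: "t \<in> {0..T}" by (rule elim(2))
    have ae0: "AE s in lebesgue_on {0..L}. \<xi>dot s t = g0 (s, t)"
      using elim(1) by (rule eventually_mono) blast
    have d: "(\<lambda>s. \<xi>dot s t) absolutely_integrable_on {0..L}" by (rule LINT_spike(2)[OF elim(3) ae0])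
    have AEs: "AE s in lebesgue_on {0..L}. s \<in> {0..L}" by (rule AE_I2) simp
    have f1: "(LINT s|lebesgue_on {0..L}. KK s t *v \<xi>dot s t) = (LINT s|lborel. hF (s, t))"
    proof (rule LINT_lebesgue_on_eq_lborel)
      show "(\<lambda>s. KK s t *v \<xi>dot s t) \<in> borel_measurable (lebesgue_on {0..L})"
        using integrable_KK(1)[OF t d] by auto
      show "(\<lambda>s. hF (s, t)) \<in> borel_measurable borel" using hFm by measurable
      show "AE s in lebesgue_on {0..L}. KK s t *v \<xi>dot s t = hF (s, t)"
        using ae0 AEs by eventually_elim (simp add: hF_def K_eq_drag P(2)[OF _ t])
      show "hF (s, t) = 0" if "s \<notin> {0..L}" for s using hFz[rule_format, of "(s, t)"] that by (auto simp: rect_def)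
    qed simp
    have f2: "(LINT s|lebesgue_on {0..L}. (J *v \<xi> s t) \<bullet> (KK s t *v \<xi>dot s t)) = (LINT s|lborel. hM (s, t))"
    proof (rule LINT_lebesgue_on_eq_lborel)
      show "(\<lambda>s. (J *v \<xi> s t) \<bullet> (KK s t *v \<xi>dot s t)) \<in> borel_measurable (lebesgue_on {0..L})"
        using integrable_KK(2)[OF t d] by auto
      show "(\<lambda>s. hM (s, t)) \<in> borel_measurable borel" using hMm by measurable
      show "AE s in lebesgue_on {0..L}. (J *v \<xi> s t) \<bullet> (KK s t *v \<xi>dot s t) = hM (s, t)"
        using ae0 AEs by eventually_elim (simp add: hF_def hM_def K_eq_drag P(2)[OF _ t] Y(2)[OF _ t])
      show "hM (s, t) = 0" if "s \<notin> {0..L}" for s using hMz[rule_format, of "(s, t)"] that by (auto simp: rect_def)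
    qed simp
    show ?case using d by (simp add: F_sh_def M_sh_def F_def M_def f1 f2)
  qed
  define n where "n k l t = indicat_real {0..T} t *\<^sub>R (matrix_inv (grand_resistance C\<^sub>\<tau> C\<^sub>\<nu> L \<xi> t) $ k $ l)" for k l t
  have nm: "n k l \<in> borel_measurable borel" for k l
    unfolding n_def by (rule borel_measurable_continuous_on_indicator[OF _ continuous_matrix_inv]) simp
  have "\<exists>B>0. \<forall>t. \<bar>n k l t\<bar> \<le> B" for k l
  proof -
    have "bounded ((\<lambda>t. matrix_inv (grand_resistance C\<^sub>\<tau> C\<^sub>\<nu> L \<xi> t) $ k $ l) ` {0..T})"
      by (intro compact_imp_bounded compact_continuous_image continuous_matrix_inv) auto
    then obtain B where B: "B > 0" "\<forall>t\<in>{0..T}. \<bar>matrix_inv (grand_resistance C\<^sub>\<tau> C\<^sub>\<nu> L \<xi> t) $ k $ l\<bar> \<le> B"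
      unfolding bounded_pos by auto
    then have "\<bar>n k l t\<bar> \<le> B" for t by (cases "t \<in> {0..T}") (auto simp: n_def)
    then show ?thesis using B(1) by blast
  qed
  then obtain B where B: "\<And>k l. B k l > 0" "\<And>k l t. \<bar>n k l t\<bar> \<le> B k l" by metis
  define D where "D = (\<Sum>k\<in>UNIV. \<Sum>l\<in>UNIV. B k l)"
  have S0: "0 \<le> (\<Sum>l\<in>UNIV. B k l)" for k by (intro sum_nonneg less_imp_le B)
  have nD: "\<bar>n k l t\<bar> \<le> D" for k l t
  proof -
    have "B k l \<le> (\<Sum>l\<in>UNIV. B k l)" by (rule member_le_sum) (auto intro: less_imp_le B)
    also have "\<dots> \<le> D" unfolding D_def
      by (rule member_le_sum[where f="\<lambda>k. \<Sum>l\<in>UNIV. B k l"]) (auto intro: S0)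
    finally show ?thesis using B(2)[of k l t] by linarith
  qed
  have D0: "D \<ge> 0" using nD[of 1 1 0] by linarith
  define c where "c k t = n k 1 t * F t $ 1 + n k 2 t * F t $ 2 + n k 3 t * M t" for k t
  define zB where "zB t = (\<Sum>k\<in>UNIV. c k t *\<^sub>R (axis k 1 :: real^3))" for t
  have znth: "zB t $ k = c k t" for t k
    unfolding zB_def by (simp add: axis_def if_distrib cong: if_cong)
  have Fn: "(\<lambda>t. F t $ i) \<in> borel_measurable borel" for i
  proof (rule measurable_compose[OF F(1)])
    show "(\<lambda>v::real^2. v $ i) \<in> borel_measurable borel"
      by (rule borel_measurable_continuous_onI[OF linear_continuous_on[OF bounded_linear_vec_nth]])
  qed
  have cm: "c k \<in> borel_measurable borel" for k
    unfolding c_def[abs_def] by (intro borel_measurable_add borel_measurable_times nm Fn M)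
  have zm: "zB \<in> borel_measurable borel"
    unfolding zB_def[abs_def] by (intro borel_measurable_sum borel_measurable_scaleR cm borel_measurable_const)
  have zb: "(norm (zB t))\<^sup>2 \<le> 9 * D\<^sup>2 * (8 * (norm (F t))\<^sup>2 + 2 * (norm (M t))\<^sup>2)" for t
  proof -
    have ck: "\<bar>c k t\<bar> \<le> D * (2 * norm (F t) + norm (M t))" for k
    proof -
      have 1: "\<bar>n k l t * x\<bar> \<le> D * y" if "\<bar>x\<bar> \<le> y" for l x y
        unfolding abs_mult using nD D0 that by (intro mult_mono) auto
      have "\<bar>F t $ i\<bar> \<le> norm (F t)" for i by (rule component_le_norm_cart)
      then have "\<bar>n k 1 t * F t $ 1\<bar> \<le> D * norm (F t)" "\<bar>n k 2 t * F t $ 2\<bar> \<le> D * norm (F t)" "\<bar>n k 3 t * M t\<bar> \<le> D * norm (M t)"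
        by (auto intro: 1)
      then show ?thesis unfolding c_def by (simp add: distrib_left)
    qed
    have "norm (zB t) \<le> (\<Sum>k\<in>(UNIV :: 3 set). \<bar>c k t\<bar>)"
      unfolding zB_def by (rule order_trans[OF norm_sum]) simp
    also have "\<dots> \<le> (\<Sum>k\<in>(UNIV :: 3 set). D * (2 * norm (F t) + norm (M t)))" by (intro sum_mono ck)
    also have "\<dots> = 3 * D * (2 * norm (F t) + norm (M t))" by simp
    finally have "(norm (zB t))\<^sup>2 \<le> (3 * D * (2 * norm (F t) + norm (M t)))\<^sup>2" by (intro power_mono) auto
    also have "\<dots> = 9 * D\<^sup>2 * (2 * norm (F t) + norm (M t))\<^sup>2" by (simp add: power_mult_distrib)
    also have "\<dots> \<le> 9 * D\<^sup>2 * (8 * (norm (F t))\<^sup>2 + 2 * (norm (M t))\<^sup>2)"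
    proof (rule mult_left_mono)
      have "0 \<le> (2 * norm (F t) - norm (M t))\<^sup>2" by simp
      then show "(2 * norm (F t) + norm (M t))\<^sup>2 \<le> 8 * (norm (F t))\<^sup>2 + 2 * (norm (M t))\<^sup>2"
        by (simp add: power2_eq_square algebra_simps)
    qed simp
    finally show ?thesis .
  qed
  have zi: "integrable lborel (\<lambda>t. (norm (zB t))\<^sup>2)"
  proof (rule Bochner_Integration.integrable_bound)
    show "integrable lborel (\<lambda>t. 9 * D\<^sup>2 * (8 * (norm (F t))\<^sup>2 + 2 * (norm (M t))\<^sup>2))"
      using F(2) M(2) by (intro integrable_mult_right Bochner_Integration.integrable_add) auto
    show "(\<lambda>t. (norm (zB t))\<^sup>2) \<in> borel_measurable lborel" using zm by simp
    show "AE t in lborel. norm ((norm (zB t))\<^sup>2) \<le> norm (9 * D\<^sup>2 * (8 * (norm (F t))\<^sup>2 + 2 * (norm (M t))\<^sup>2))"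
      using zb by (intro AE_I2) (auto intro: order_trans)
  qed
  have "AE t in lebesgue_on {0..T}. vec3 (vel C\<^sub>\<tau> C\<^sub>\<nu> L T \<xi> t) (ang_vel C\<^sub>\<tau> C\<^sub>\<nu> L T \<xi> t) = zB t"
    using main AE0
  proof eventually_elim
    case (elim t)
    have FM: "F_sh C\<^sub>\<tau> C\<^sub>\<nu> L T \<xi> t = F t" "M_sh C\<^sub>\<tau> C\<^sub>\<nu> L T \<xi> t = M t" using elim by auto
    show ?case
      unfolding vec3_vel[OF elim(2)] FM vec_eq_iff znth
      using elim(2) by (simp add: c_def n_def matrix_vector_mult_def sum_3)
  qed
  moreover have "AE t in lebesgue_on {0..T}. (\<lambda>s. \<xi>dot s t) absolutely_integrable_on {0..L}"
    using main by (rule eventually_mono) blast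
  ultimately show ?thesis using zm zi by (intro that)
qed

end

lemma derivative_unique_Icc:
  fixes f :: "real \<Rightarrow> 'a::euclidean_space"
  assumes "a < b" "x \<in> {a..b}" "(f has_vector_derivative d) (at x within {a..b})"
    "(f has_vector_derivative d') (at x within {a..b})"
  shows "d = d'"
  using vector_derivative_within_closed_interval[OF assms(1,2,3)] vector_derivative_within_closed_interval[OF assms(1,2,4)]
  by simp

lemma rot_has_vector_derivative:
  assumes \<theta>: "(\<theta> has_real_derivative w) (at t within S)" and f: "(f has_vector_derivative f') (at t within S)"
  shows "((\<lambda>t. rot (\<theta> t) *v f t) has_vector_derivative
    (w *\<^sub>R (J *v (rot (\<theta> t) *v f t)) + rot (\<theta> t) *v f')) (at t within S)"
proof -
  have c: "((\<lambda>t. cos (\<theta> t)) has_real_derivative - sin (\<theta> t) * w) (at t within S)"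
    and s: "((\<lambda>t. sin (\<theta> t)) has_real_derivative cos (\<theta> t) * w) (at t within S)"
    by (auto intro!: derivative_eq_intros \<theta>)
  have "((\<lambda>t. cos (\<theta> t) *\<^sub>R f t + sin (\<theta> t) *\<^sub>R (J *v f t)) has_vector_derivative
      (cos (\<theta> t) *\<^sub>R f' + (- sin (\<theta> t) * w) *\<^sub>R f t) + (sin (\<theta> t) *\<^sub>R (J *v f') + (cos (\<theta> t) * w) *\<^sub>R (J *v f t))) (at t within S)"
    by (intro has_vector_derivative_add has_vector_derivative_scaleR c s f
        bounded_linear.has_vector_derivative[OF matrix_vector_mul_bounded_linear])
  moreover have "(cos (\<theta> t) *\<^sub>R f' + (- sin (\<theta> t) * w) *\<^sub>R f t) + (sin (\<theta> t) *\<^sub>R (J *v f') + (cos (\<theta> t) * w) *\<^sub>R (J *v f t))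
      = w *\<^sub>R (J *v (rot (\<theta> t) *v f t)) + rot (\<theta> t) *v f'"
    unfolding rot_apply by (simp add: vec_eq_iff forall_2 algebra_simps)
  moreover have "(\<lambda>t. rot (\<theta> t) *v f t) = (\<lambda>t. cos (\<theta> t) *\<^sub>R f t + sin (\<theta> t) *\<^sub>R (J *v f t))"
    by (simp add: rot_apply)
  ultimately show ?thesis by (simp only:)
qed

lemma abs_cos_diff_le: "\<bar>cos x - cos y\<bar> \<le> \<bar>x - y\<bar>" for x y :: real
  using field_differentiable_bound[of UNIV cos "\<lambda>x. - sin x" 1 y x] by (auto intro: DERIV_cos)

lemma abs_sin_diff_le: "\<bar>sin x - sin y\<bar> \<le> \<bar>x - y\<bar>" for x y :: real
  using field_differentiable_bound[of UNIV sin cos 1 y x] by (auto intro: DERIV_sin)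

lemma abs_continuous_linear:
  assumes "bounded_linear h" "abs_continuous a b f"
  shows "abs_continuous a b (\<lambda>t. h (f t))"
proof -
  interpret bounded_linear h by (rule assms(1))
  obtain B where B: "\<And>x. norm (h x) \<le> norm x * B" using bounded by blast
  show ?thesis
    by (rule abs_continuous_Lipschitz[OF assms(2), of _ B]) (metis B diff mult.commute)
qed

lemma abs_continuous_rot:
  assumes \<theta>: "abs_continuous a b \<theta>" and f: "abs_continuous a b f"
  shows "abs_continuous a b (\<lambda>t. rot (\<theta> t) *v f t)"
proof -
  have "abs_continuous a b (\<lambda>t. cos (\<theta> t))"
    by (rule abs_continuous_Lipschitz[OF \<theta>, of _ 1]) (simp add: abs_cos_diff_le)
  moreover have "abs_continuous a b (\<lambda>t. sin (\<theta> t))"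
    by (rule abs_continuous_Lipschitz[OF \<theta>, of _ 1]) (simp add: abs_sin_diff_le)
  ultimately show ?thesis unfolding rot_apply
    by (intro abs_continuous_add abs_continuous_bilinear[OF bounded_bilinear_scaleR] f
        abs_continuous_linear[OF matrix_vector_mul_bounded_linear])
qed

lemma continuous_on_rot:
  fixes S :: "'a::t2_space set"
  assumes "continuous_on S \<theta>" "continuous_on S f"
  shows "continuous_on S (\<lambda>t. rot (\<theta> t) *v f t)"
  unfolding rot_apply
  by (intro continuous_on_add continuous_on_scaleR continuous_on_cos continuous_on_sin assms
      bounded_linear.continuous_on[OF matrix_vector_mul_bounded_linear])

lemma borel_measurable_J: "f \<in> borel_measurable M \<Longrightarrow> (\<lambda>x. J *v f x) \<in> borel_measurable M"
  by (rule measurable_compose[OF _ borel_measurable_continuous_onI[OF linear_continuous_on[OF matrix_vector_mul_bounded_linear]]])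

lemma borel_measurable_rot:
  assumes "\<theta> \<in> borel_measurable M" "f \<in> borel_measurable M"
  shows "(\<lambda>x. rot (\<theta> x) *v f x) \<in> borel_measurable M"
proof -
  have "(\<lambda>x. cos (\<theta> x)) \<in> borel_measurable M" "(\<lambda>x. sin (\<theta> x)) \<in> borel_measurable M"
    by (rule measurable_compose[OF assms(1)], rule borel_measurable_continuous_onI, intro continuous_intros)+
  then show ?thesis unfolding rot_apply
    by (intro borel_measurable_add borel_measurable_scaleR borel_measurable_J assms)
qed

lemma absolutely_integrable_rot:
  fixes f :: "real \<Rightarrow> real^2"
  assumes \<theta>: "continuous_on {a..b} \<theta>" and f: "f absolutely_integrable_on {a..b}"
  shows "(\<lambda>t. rot (\<theta> t) *v f t) absolutely_integrable_on {a..b}"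
proof -
  have "(\<lambda>t. J *v f t) absolutely_integrable_on {a..b}"
    by (rule absolutely_integrable_linear[OF f matrix_vector_mul_bounded_linear, unfolded o_def])
  with f show ?thesis unfolding rot_apply
    by (intro set_integral_add(1) absolutely_integrable_continuous_scaleR continuous_on_cos continuous_on_sin \<theta>)
qed

lemma has_weak_derivative_affine:
  fixes u g :: "real \<Rightarrow> real^2" and Q :: "real^2^2"
  assumes u: "L2_on {a..b} u" and g: "L2_on {a..b} g" and w: "has_weak_derivative a b u g"
  shows "has_weak_derivative a b (\<lambda>s. c + Q *v u s) (\<lambda>s. Q *v g s)"
  unfolding has_weak_derivative_def
proof (intro allI impI)
  fix \<phi> assume \<phi>: "test_function a b \<phi>"
  have i1: "integrable (lebesgue_on {a..b}) (\<lambda>s. deriv \<phi> s *\<^sub>R u s)"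
    by (intro absolutely_integrable_imp_integrable absolutely_integrable_continuous_scaleR
        absolutely_integrable_if_L2_on u test_functionD(3)[OF \<phi>]) simp
  have i2: "integrable (lebesgue_on {a..b}) (\<lambda>s. \<phi> s *\<^sub>R g s)"
    by (intro absolutely_integrable_imp_integrable absolutely_integrable_continuous_scaleR
        absolutely_integrable_if_L2_on g test_functionD(2)[OF \<phi>]) simp
  have i3: "integrable (lebesgue_on {a..b}) (\<lambda>s. deriv \<phi> s *\<^sub>R c)"
    by (intro integrable_continuous_lebesgue_on continuous_intros test_functionD(3)[OF \<phi>])
  have "has_weak_derivative a b (\<lambda>s. c) (\<lambda>s. 0)"
    by (rule has_weak_derivative_indefinite_integral) auto
  then have c: "(LINT s|lebesgue_on {a..b}. deriv \<phi> s *\<^sub>R c) = 0"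
    using \<phi> unfolding has_weak_derivative_def by fastforce
  have "(LINT s|lebesgue_on {a..b}. deriv \<phi> s *\<^sub>R (c + Q *v u s)) =
      (LINT s|lebesgue_on {a..b}. deriv \<phi> s *\<^sub>R c + Q *v (deriv \<phi> s *\<^sub>R u s))"
    by (simp add: scaleR_add_right matrix_vector_mult_scaleR)
  also have "\<dots> = Q *v (LINT s|lebesgue_on {a..b}. deriv \<phi> s *\<^sub>R u s)"
    using i3 integrable_bounded_linear[OF matrix_vector_mul_bounded_linear[of Q] i1] c
      integral_bounded_linear[OF matrix_vector_mul_bounded_linear[of Q] i1] by simp
  also have "(LINT s|lebesgue_on {a..b}. deriv \<phi> s *\<^sub>R u s) = - (LINT s|lebesgue_on {a..b}. \<phi> s *\<^sub>R g s)"
    using w \<phi> unfolding has_weak_derivative_def by blast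
  also have "Q *v (- (LINT s|lebesgue_on {a..b}. \<phi> s *\<^sub>R g s)) = - (LINT s|lebesgue_on {a..b}. Q *v (\<phi> s *\<^sub>R g s))"
    unfolding integral_bounded_linear[OF matrix_vector_mul_bounded_linear i2]
    by (rule linear_neg[OF matrix_vector_mul_linear])
  finally show "(LINT s|lebesgue_on {a..b}. deriv \<phi> s *\<^sub>R (c + Q *v u s)) = - (LINT s|lebesgue_on {a..b}. \<phi> s *\<^sub>R (Q *v g s))"
    by (simp add: matrix_vector_mult_scaleR)
qed

lemma L2_on_continuous:
  fixes f :: "real \<Rightarrow> 'a::euclidean_space"
  assumes "continuous_on {a..b} f" shows "L2_on {a..b} f"
  unfolding L2_on_def
  by (intro conjI continuous_imp_measurable_on_sets_lebesgue integrable_continuous_lebesgue_on continuous_intros assms) simp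

lemma L2_on_rotation:
  fixes u :: "real \<Rightarrow> real^2"
  assumes "L2_on {a..b} u" "rotation_matrix Q"
  shows "L2_on {a..b} (\<lambda>s. Q *v u s)"
proof -
  have "(\<lambda>s. Q *v u s) \<in> borel_measurable (lebesgue_on {a..b})"
    by (rule measurable_compose[where g="(*v) Q" and f=u,
          OF _ borel_measurable_continuous_onI[OF linear_continuous_on[OF matrix_vector_mul_bounded_linear]]])
      (use assms(1) in \<open>simp add: L2_on_def\<close>)
  then show ?thesis using assms by (simp add: L2_on_def rotation_matrix_norm)
qed

lemma Linf_H2_rigid:
  assumes L: "L > 0" and T: "T > 0" and \<xi>: "Linf_H2 L T \<xi>"
    and c\<xi>: "continuous_on ({0..L} \<times> {0..T}) (\<lambda>(s, t). \<xi> s t)"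
    and x: "continuous_on {0..T} x" and \<theta>: "continuous_on {0..T} \<theta>"
  shows "Linf_H2 L T (\<lambda>s t. x t + rot (\<theta> t) *v \<xi> s t)"
proof -
  let ?R = "{0..L} \<times> {0..T}"
  obtain \<xi>1 \<xi>2 M where m: "(\<lambda>(s, t). \<xi> s t) \<in> borel_measurable (lebesgue_on ?R)"
     "(\<lambda>(s, t). \<xi>1 s t) \<in> borel_measurable (lebesgue_on ?R)"
     "(\<lambda>(s, t). \<xi>2 s t) \<in> borel_measurable (lebesgue_on ?R)"
    and ae: "AE t in lebesgue_on {0..T}.
        L2_on {0..L} (\<lambda>s. \<xi> s t) \<and> L2_on {0..L} (\<lambda>s. \<xi>1 s t) \<and> L2_on {0..L} (\<lambda>s. \<xi>2 s t) \<and>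
        has_weak_derivative 0 L (\<lambda>s. \<xi> s t) (\<lambda>s. \<xi>1 s t) \<and>
        has_weak_derivative 0 L (\<lambda>s. \<xi>1 s t) (\<lambda>s. \<xi>2 s t) \<and>
        (LINT s|lebesgue_on {0..L}. (norm (\<xi> s t))\<^sup>2)
          + (LINT s|lebesgue_on {0..L}. (norm (\<xi>1 s t))\<^sup>2)
          + (LINT s|lebesgue_on {0..L}. (norm (\<xi>2 s t))\<^sup>2) \<le> M"
    using \<xi> unfolding Linf_H2_def by blast
  have R: "?R \<in> sets lebesgue" using rect_borel[of L T] by (simp add: rect_def)
  have \<theta>m: "(\<lambda>z. \<theta> (snd z)) \<in> borel_measurable (lebesgue_on ?R)" and xm: "(\<lambda>z. x (snd z)) \<in> borel_measurable (lebesgue_on ?R)"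
    by (auto intro!: continuous_imp_measurable_on_sets_lebesgue R continuous_on_compose2[OF \<theta>] continuous_on_compose2[OF x] continuous_intros)
  obtain X where "\<forall>t\<in>{0..T}. norm (x t) \<le> X"
    using compact_imp_bounded[OF compact_continuous_image[OF x]] by (auto simp: bounded_iff)
  then have X: "norm (x t) \<le> X" if "t \<in> {0..T}" for t using that by blast
  let ?\<chi> = "\<lambda>s t. x t + rot (\<theta> t) *v \<xi> s t"
  have AE0: "AE t in lebesgue_on {0..T}. t \<in> {0..T}" by (rule AE_I2) simp
  have "AE t in lebesgue_on {0..T}.
        L2_on {0..L} (\<lambda>s. ?\<chi> s t) \<and> L2_on {0..L} (\<lambda>s. rot (\<theta> t) *v \<xi>1 s t) \<and> L2_on {0..L} (\<lambda>s. rot (\<theta> t) *v \<xi>2 s t) \<and>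
        has_weak_derivative 0 L (\<lambda>s. ?\<chi> s t) (\<lambda>s. rot (\<theta> t) *v \<xi>1 s t) \<and>
        has_weak_derivative 0 L (\<lambda>s. rot (\<theta> t) *v \<xi>1 s t) (\<lambda>s. rot (\<theta> t) *v \<xi>2 s t) \<and>
        (LINT s|lebesgue_on {0..L}. (norm (?\<chi> s t))\<^sup>2)
          + (LINT s|lebesgue_on {0..L}. (norm (rot (\<theta> t) *v \<xi>1 s t))\<^sup>2)
          + (LINT s|lebesgue_on {0..L}. (norm (rot (\<theta> t) *v \<xi>2 s t))\<^sup>2) \<le> 2 * L * X\<^sup>2 + 2 * M"
    using ae AE0
  proof eventually_elim
    case (elim t)
    have t: "t \<in> {0..T}" by (rule elim(2))
    have L2: "L2_on {0..L} (\<lambda>s. \<xi> s t)" "L2_on {0..L} (\<lambda>s. \<xi>1 s t)" "L2_on {0..L} (\<lambda>s. \<xi>2 s t)"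
      and w: "has_weak_derivative 0 L (\<lambda>s. \<xi> s t) (\<lambda>s. \<xi>1 s t)" "has_weak_derivative 0 L (\<lambda>s. \<xi>1 s t) (\<lambda>s. \<xi>2 s t)"
      and M: "(LINT s|lebesgue_on {0..L}. (norm (\<xi> s t))\<^sup>2) + (LINT s|lebesgue_on {0..L}. (norm (\<xi>1 s t))\<^sup>2)
          + (LINT s|lebesgue_on {0..L}. (norm (\<xi>2 s t))\<^sup>2) \<le> M"
      using elim(1) by blast+
    note rot = rotation_matrix_rot[of "\<theta> t"]
    have c\<xi>t: "continuous_on {0..L} (\<lambda>s. \<xi> s t)" by (rule continuous_on_slices(1)[OF c\<xi> t])
    have c\<chi>: "continuous_on {0..L} (\<lambda>s. ?\<chi> s t)"
      by (intro continuous_intros c\<xi>t bounded_linear.continuous_on[OF matrix_vector_mul_bounded_linear])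
    have i: "integrable (lebesgue_on {0..L}) (\<lambda>s. (norm (\<xi> s t))\<^sup>2)" "integrable (lebesgue_on {0..L}) (\<lambda>s. (norm (?\<chi> s t))\<^sup>2)"
      by (intro integrable_continuous_lebesgue_on continuous_intros c\<xi>t c\<chi>)+
    have "(LINT s|lebesgue_on {0..L}. (norm (?\<chi> s t))\<^sup>2) \<le> (LINT s|lebesgue_on {0..L}. 2 * X\<^sup>2 + 2 * (norm (\<xi> s t))\<^sup>2)"
    proof (rule integral_mono)
      show "integrable (lebesgue_on {0..L}) (\<lambda>s. 2 * X\<^sup>2 + 2 * (norm (\<xi> s t))\<^sup>2)"
        by (intro integrable_continuous_lebesgue_on continuous_intros c\<xi>t)
      fix s
      have "norm (?\<chi> s t) \<le> X + norm (\<xi> s t)"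
        using norm_triangle_ineq[of "x t" "rot (\<theta> t) *v \<xi> s t"] X[OF t] by (simp add: rotation_matrix_norm[OF rot])
      then have "(norm (?\<chi> s t))\<^sup>2 \<le> (X + norm (\<xi> s t))\<^sup>2" by (intro power_mono) auto
      also have "\<dots> \<le> 2 * X\<^sup>2 + 2 * (norm (\<xi> s t))\<^sup>2"
        using sum_squares_bound[of X "norm (\<xi> s t)"] by (simp add: power2_sum)
      finally show "(norm (?\<chi> s t))\<^sup>2 \<le> 2 * X\<^sup>2 + 2 * (norm (\<xi> s t))\<^sup>2" .
    qed (rule i)
    also have "\<dots> = 2 * L * X\<^sup>2 + 2 * (LINT s|lebesgue_on {0..L}. (norm (\<xi> s t))\<^sup>2)"
      using i(1) L by (simp add: measure_restrict_space)
    finally have b: "(LINT s|lebesgue_on {0..L}. (norm (?\<chi> s t))\<^sup>2) \<le> 2 * L * X\<^sup>2 + 2 * (LINT s|lebesgue_on {0..L}. (norm (\<xi> s t))\<^sup>2)" .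
    have nn: "0 \<le> (LINT s|lebesgue_on {0..L}. (norm (\<xi>1 s t))\<^sup>2)" "0 \<le> (LINT s|lebesgue_on {0..L}. (norm (\<xi>2 s t))\<^sup>2)"
      by (rule integral_nonneg_AE; simp)+
    have w2: "has_weak_derivative 0 L (\<lambda>s. rot (\<theta> t) *v \<xi>1 s t) (\<lambda>s. rot (\<theta> t) *v \<xi>2 s t)"
      using has_weak_derivative_affine[OF L2(2,3) w(2), of 0 "rot (\<theta> t)"] by simp
    show ?case
    proof (intro conjI w2 has_weak_derivative_affine L2 w L2_on_rotation rot L2_on_continuous c\<chi>)
      show "(LINT s|lebesgue_on {0..L}. (norm (?\<chi> s t))\<^sup>2)
          + (LINT s|lebesgue_on {0..L}. (norm (rot (\<theta> t) *v \<xi>1 s t))\<^sup>2)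
          + (LINT s|lebesgue_on {0..L}. (norm (rot (\<theta> t) *v \<xi>2 s t))\<^sup>2) \<le> 2 * L * X\<^sup>2 + 2 * M"
        unfolding rotation_matrix_norm[OF rot] using b nn M by linarith
    qed
  qed
  moreover have "(\<lambda>(s, t). ?\<chi> s t) \<in> borel_measurable (lebesgue_on ?R)"
    "(\<lambda>(s, t). rot (\<theta> t) *v \<xi>1 s t) \<in> borel_measurable (lebesgue_on ?R)"
    "(\<lambda>(s, t). rot (\<theta> t) *v \<xi>2 s t) \<in> borel_measurable (lebesgue_on ?R)"
    unfolding split_def by (intro borel_measurable_add borel_measurable_rot \<theta>m xm m[unfolded split_def])+
  ultimately show ?thesis
    unfolding Linf_H2_def
    by (intro exI[of _ "\<lambda>s t. rot (\<theta> t) *v \<xi>1 s t"] exI[of _ "\<lambda>s t. rot (\<theta> t) *v \<xi>2 s t"] conjI exI[of _ "2 * L * X\<^sup>2 + 2 * M"])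
qed

lemma integrable_lborel_rect_fst_const:
  fixes f :: "real \<Rightarrow> real"
  assumes L: "L > 0" and f: "integrable lborel f"
  shows "integrable lborel (\<lambda>z :: real \<times> real. indicat_real {0..L} (fst z) * f (snd z))"
proof -
  have fm: "f \<in> borel_measurable borel" using f by auto
  have m: "(\<lambda>z :: real \<times> real. indicat_real {0..L} (fst z) * f (snd z)) \<in> borel_measurable (borel :: (real \<times> real) measure)"
  proof (intro borel_measurable_times)
    show "(\<lambda>z. indicat_real {0..L} (fst z)) \<in> borel_measurable (borel :: (real \<times> real) measure)"
      by (rule measurable_compose[OF borel_measurable_continuous_onI[OF continuous_on_fst[OF continuous_on_id]]]) simp
    show "(\<lambda>z. f (snd z)) \<in> borel_measurable (borel :: (real \<times> real) measure)"
      by (rule measurable_compose[OF borel_measurable_continuous_onI[OF continuous_on_snd[OF continuous_on_id]] fm])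
  qed
  have "integrable (lborel \<Otimes>\<^sub>M lborel) (\<lambda>z. indicat_real {0..L} (fst z) * f (snd z))"
  proof (rule lborel_pair.Fubini_integrable)
    show "(\<lambda>z. indicat_real {0..L} (fst z) * f (snd z)) \<in> borel_measurable (lborel \<Otimes>\<^sub>M lborel)"
      using m by (simp add: lborel_prod)
    show "integrable lborel (\<lambda>x. LINT y|lborel. norm (indicat_real {0..L} (fst (x, y)) * f (snd (x, y))))"
      using L by (simp add: abs_mult)
    show "AE x in lborel. integrable lborel (\<lambda>y. indicat_real {0..L} (fst (x, y)) * f (snd (x, y)))"
      using f by simp
  qed
  then show ?thesis by (simp add: lborel_prod)
qed

lemma is_time_derivative_rigid:
  fixes \<xi> :: "real \<Rightarrow> real \<Rightarrow> real^2"
  assumes L: "L > 0" and T: "T > 0" and tp: "time_prim L T \<xi> g0"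
    and vB: "vB \<in> borel_measurable borel" "integrable lborel (\<lambda>t. (norm (vB t))\<^sup>2)"
    and wB: "wB \<in> borel_measurable borel" "integrable lborel (\<lambda>t. (wB t)\<^sup>2)"
    and acx: "abs_continuous 0 T x" and ac\<theta>: "abs_continuous 0 T \<theta>"
    and dx: "AE t in lebesgue_on {0..T}. (x has_vector_derivative rot (\<theta> t) *v vB t) (at t within {0..T})"
    and d\<theta>: "AE t in lebesgue_on {0..T}. (\<theta> has_real_derivative wB t) (at t within {0..T})"
  shows "is_time_derivative L T (\<lambda>s t. x t + rot (\<theta> t) *v \<xi> s t)
    (\<lambda>s t. rot (\<theta> t) *v vB t + (wB t *\<^sub>R (J *v (rot (\<theta> t) *v \<xi> s t)) + rot (\<theta> t) *v g0 (s, t)))"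
proof -
  let ?R = "{0..L} \<times> {0..T}"
  have R: "?R \<in> sets lebesgue" using rect_borel[of L T] by (simp add: rect_def)
  have g0: "g0 \<in> borel_measurable borel" "\<forall>z. z \<notin> rect L T \<longrightarrow> g0 z = 0" "integrable lborel (\<lambda>z. (norm (g0 z))\<^sup>2)"
    and c\<xi>: "continuous_on ?R (\<lambda>(s, t). \<xi> s t)"
    and ae: "AE s in lebesgue_on {0..L}. (\<lambda>t. g0 (s, t)) absolutely_integrable_on {0..T} \<and>
       (\<forall>t\<in>{0..T}. \<xi> s t = \<xi> s 0 + integral {0..t} (\<lambda>t. g0 (s, t)))"
    using tp unfolding time_prim_def by blast+
  note c\<theta> = abs_continuous_imp_continuous_on[OF ac\<theta>]
  let ?g = "\<lambda>s t. rot (\<theta> t) *v vB t + (wB t *\<^sub>R (J *v (rot (\<theta> t) *v \<xi> s t)) + rot (\<theta> t) *v g0 (s, t))"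
  let ?\<chi> = "\<lambda>s t. x t + rot (\<theta> t) *v \<xi> s t"
  have bm: "f \<in> borel_measurable (lebesgue_on ?R)" if "f \<in> borel_measurable borel" for f :: "real \<times> real \<Rightarrow> 'b::euclidean_space"
    using that by (intro measurable_restrict_space1 measurable_completion) auto
  have snd_m: "(\<lambda>z. f (snd z)) \<in> borel_measurable (borel :: (real \<times> real) measure)" if "f \<in> borel_measurable borel" for f :: "real \<Rightarrow> 'b::euclidean_space"
    by (rule measurable_compose[OF borel_measurable_continuous_onI[OF continuous_on_snd[OF continuous_on_id]] that])
  have \<theta>m: "(\<lambda>z. \<theta> (snd z)) \<in> borel_measurable (lebesgue_on ?R)"
    by (auto intro!: continuous_imp_measurable_on_sets_lebesgue R continuous_on_compose2[OF c\<theta>] continuous_intros)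
  have \<xi>m: "(\<lambda>z. \<xi> (fst z) (snd z)) \<in> borel_measurable (lebesgue_on ?R)"
    by (intro continuous_imp_measurable_on_sets_lebesgue R) (use c\<xi> in \<open>simp add: split_def\<close>)
  have gm: "(\<lambda>z. ?g (fst z) (snd z)) \<in> borel_measurable (lebesgue_on ?R)"
    unfolding prod.collapse
    by (intro borel_measurable_add borel_measurable_scaleR borel_measurable_J borel_measurable_rot \<theta>m \<xi>m bm snd_m vB wB g0)
  have "bounded ((\<lambda>(s, t). \<xi> s t) ` ?R)"
    by (intro compact_imp_bounded compact_continuous_image c\<xi> compact_Times) auto
  then obtain X where X0: "X > 0" and "\<forall>z\<in>?R. norm (case z of (s, t) \<Rightarrow> \<xi> s t) \<le> X" unfolding bounded_pos by auto
  then have X: "norm (\<xi> s t) \<le> X" if "s \<in> {0..L}" "t \<in> {0..T}" for s t using that by fastforce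
  define b where "b z = 3 * (indicat_real {0..L} (fst z) * (norm (vB (snd z)))\<^sup>2) + 3 * X\<^sup>2 * (indicat_real {0..L} (fst z) * (wB (snd z))\<^sup>2)
    + 3 * (norm (g0 z))\<^sup>2" for z
  have bi: "integrable lborel b"
    unfolding b_def[abs_def]
    by (intro Bochner_Integration.integrable_add integrable_mult_right integrable_lborel_rect_fst_const L vB wB g0)
  have gb: "(norm (?g s t))\<^sup>2 \<le> b (s, t)" if st: "s \<in> {0..L}" "t \<in> {0..T}" for s t
  proof -
    note rn = rotation_matrix_norm[OF rotation_matrix_rot]
    have "norm (?g s t) \<le> norm (vB t) + (\<bar>wB t\<bar> * norm (\<xi> s t) + norm (g0 (s, t)))"
      using norm_triangle_ineq[of "rot (\<theta> t) *v vB t" "wB t *\<^sub>R (J *v (rot (\<theta> t) *v \<xi> s t)) + rot (\<theta> t) *v g0 (s, t)"]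
        norm_triangle_ineq[of "wB t *\<^sub>R (J *v (rot (\<theta> t) *v \<xi> s t))" "rot (\<theta> t) *v g0 (s, t)"]
      by (simp add: rn)
    also have "\<dots> \<le> norm (vB t) + (\<bar>wB t\<bar> * X + norm (g0 (s, t)))"
      using X[OF st] by (intro add_mono mult_left_mono) auto
    finally have "(norm (?g s t))\<^sup>2 \<le> (norm (vB t) + (\<bar>wB t\<bar> * X + norm (g0 (s, t))))\<^sup>2" by (intro power_mono) auto
    also have "\<dots> \<le> 3 * (norm (vB t))\<^sup>2 + 3 * (\<bar>wB t\<bar> * X)\<^sup>2 + 3 * (norm (g0 (s, t)))\<^sup>2"
    proof -
      have "(p + (q + r))\<^sup>2 \<le> 3 * p\<^sup>2 + 3 * q\<^sup>2 + 3 * r\<^sup>2" for p q r :: real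
      proof -
        have "0 \<le> (p - q)\<^sup>2 + (q - r)\<^sup>2 + (p - r)\<^sup>2" by simp
        then show ?thesis by (simp add: power2_eq_square algebra_simps)
      qed
      then show ?thesis .
    qed
    also have "\<dots> = b (s, t)" using st by (simp add: b_def power_mult_distrib)
    finally show ?thesis .
  qed
  have L2: "L2_on ?R (\<lambda>(s, t). ?g s t)"
    unfolding L2_on_def
  proof
    show "(\<lambda>(s, t). ?g s t) \<in> borel_measurable (lebesgue_on ?R)" using gm by (simp add: split_def)
    show "integrable (lebesgue_on ?R) (\<lambda>z. (norm (case z of (s, t) \<Rightarrow> ?g s t))\<^sup>2)"
    proof (rule Bochner_Integration.integrable_bound)
      have "integrable lebesgue b" using bi integrable_completion[of b lborel] by auto
      then show "integrable (lebesgue_on ?R) b" using R integrable_restrict_space[of ?R lebesgue b]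
        integrable_mult_indicator[of ?R lebesgue b] by simp
      show "(\<lambda>z. (norm (case z of (s, t) \<Rightarrow> ?g s t))\<^sup>2) \<in> borel_measurable (lebesgue_on ?R)"
        using gm by (simp add: split_def)
      show "AE z in lebesgue_on ?R. norm ((norm (case z of (s, t) \<Rightarrow> ?g s t))\<^sup>2) \<le> norm (b z)"
      proof (rule AE_I2)
        fix z assume "z \<in> space (lebesgue_on ?R)"
        then obtain s t where "z = (s, t)" "s \<in> {0..L}" "t \<in> {0..T}" by auto
        then show "norm ((norm (case z of (s, t) \<Rightarrow> ?g s t))\<^sup>2) \<le> norm (b z)" using gb[of s t] by simp
      qed
    qed
  qed
  have wB2: "integrable lborel (\<lambda>t. (norm (wB t))\<^sup>2)" using wB(2) by simp
  have wai: "wB absolutely_integrable_on {0..T}" by (rule square_integrable_imp_absolutely_integrable[OF wB(1) wB2])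
  have vai: "vB absolutely_integrable_on {0..T}" by (rule square_integrable_imp_absolutely_integrable[OF vB])
  have AEs: "AE s in lebesgue_on {0..L}. s \<in> {0..L}" by (rule AE_I2) simp
  have weak: "AE s in lebesgue_on {0..L}. has_weak_derivative 0 T (?\<chi> s) (?g s)"
    using ae AEs
  proof eventually_elim
    case (elim s)
    then have s: "s \<in> {0..L}" by blast
    have gs: "(\<lambda>t. g0 (s, t)) absolutely_integrable_on {0..T}"
      and us: "\<And>t. t \<in> {0..T} \<Longrightarrow> \<xi> s t = \<xi> s 0 + integral {0..t} (\<lambda>t. g0 (s, t))"
      using elim(1) by blast+
    have ac\<xi>: "abs_continuous 0 T (\<xi> s)" by (rule abs_continuous_if_indefinite_integral[OF gs us])
    have d\<xi>: "AE t in lebesgue_on {0..T}. (\<xi> s has_vector_derivative g0 (s, t)) (at t within {0..T})"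
      by (rule AE_derivative_if_indefinite_integral[OF gs us])
    have ac\<chi>: "abs_continuous 0 T (?\<chi> s)" by (intro abs_continuous_add acx abs_continuous_rot ac\<theta> ac\<xi>)
    have cJ: "continuous_on {0..T} (\<lambda>t. J *v (rot (\<theta> t) *v \<xi> s t))"
      by (intro bounded_linear.continuous_on[OF matrix_vector_mul_bounded_linear] continuous_on_rot c\<theta> continuous_on_slices(2)[OF c\<xi> s])
    have wJ: "(\<lambda>t. wB t *\<^sub>R (J *v (rot (\<theta> t) *v \<xi> s t))) absolutely_integrable_on {0..T}"
    proof (rule absolutely_integrable_bounded_measurable_product[where h="\<lambda>x (c::real). c *\<^sub>R x", OF _ _ _ _ wai])
      show "bilinear (\<lambda>x c. c *\<^sub>R x :: real^2)"
        unfolding bilinear_def by (intro conjI allI linearI) (simp_all add: scaleR_add_right scaleR_add_left)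
      show "(\<lambda>t. J *v (rot (\<theta> t) *v \<xi> s t)) \<in> borel_measurable (lebesgue_on {0..T})"
        by (intro continuous_imp_measurable_on_sets_lebesgue cJ) simp
      show "bounded ((\<lambda>t. J *v (rot (\<theta> t) *v \<xi> s t)) ` {0..T})"
        by (intro compact_imp_bounded compact_continuous_image cJ) simp
    qed simp
    have gai: "?g s absolutely_integrable_on {0..T}"
      by (intro set_integral_add(1) absolutely_integrable_rot c\<theta> vai wJ gs)
    have d\<chi>: "AE t in lebesgue_on {0..T}. (?\<chi> s has_vector_derivative ?g s t) (at t within {0..T})"
      using dx d\<theta> d\<xi>
    proof eventually_elim
      case (elim t)
      show ?case by (intro has_vector_derivative_add elim(1) rot_has_vector_derivative elim)
    qed
    show ?case
    proof (rule has_weak_derivative_indefinite_integral[OF gai])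
      show "?\<chi> s t = ?\<chi> s 0 + integral {0..t} (?g s)" if "t \<in> {0..T}" for t
        by (rule indefinite_integral_if_AE_derivative[OF ac\<chi> gai d\<chi> that])
    qed
  qed
  show ?thesis
    unfolding is_time_derivative_def
  proof (intro conjI L2 allI impI)
    fix \<phi> assume \<phi>: "test_function 0 T \<phi>"
    show "AE s in lebesgue_on {0..L}. (LINT t|lebesgue_on {0..T}. deriv \<phi> t *\<^sub>R ?\<chi> s t) = - (LINT t|lebesgue_on {0..T}. \<phi> t *\<^sub>R ?g s t)"
      using weak by (rule eventually_mono) (use \<phi> in \<open>simp add: has_weak_derivative_def\<close>)
  qed
qed

text \<open>Absolutely continuous functions are differentiable almost everywhere; carrying this along
  avoids having to prove it.\<close>

definition ac_diff :: "real \<Rightarrow> (real \<Rightarrow> 'a::euclidean_space) \<Rightarrow> bool" where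
  "ac_diff T u \<longleftrightarrow> abs_continuous 0 T u \<and> (AE t in lebesgue_on {0..T}. u differentiable (at t within {0..T}))"

lemma ac_diff_bilinear:
  fixes f :: "real \<Rightarrow> 'a::euclidean_space" and g :: "real \<Rightarrow> 'b::euclidean_space"
    and h :: "'a \<Rightarrow> 'b \<Rightarrow> 'c::euclidean_space"
  assumes h: "bounded_bilinear h" and f: "ac_diff T f" and g: "ac_diff T g"
  shows "ac_diff T (\<lambda>t. h (f t) (g t))"
proof -
  have "AE t in lebesgue_on {0..T}. (\<lambda>t. h (f t) (g t)) differentiable (at t within {0..T})"
    using f[unfolded ac_diff_def, THEN conjunct2] g[unfolded ac_diff_def, THEN conjunct2]
  proof eventually_elim
    case (elim t)
    then show ?case unfolding differentiable_def using bounded_bilinear.FDERIV[OF h] by blast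
  qed
  then show ?thesis using f g abs_continuous_bilinear[OF h] unfolding ac_diff_def by blast
qed

lemma ac_diff_add:
  assumes "ac_diff T f" "ac_diff T g" shows "ac_diff T (\<lambda>t. f t + g t)"
proof -
  have "AE t in lebesgue_on {0..T}. (\<lambda>t. f t + g t) differentiable (at t within {0..T})"
    using assms[unfolded ac_diff_def, THEN conjunct2] by eventually_elim (rule differentiable_add)
  then show ?thesis using assms abs_continuous_add unfolding ac_diff_def by blast
qed

lemma ac_diff_diff:
  assumes "ac_diff T f" "ac_diff T g" shows "ac_diff T (\<lambda>t. f t - g t)"
proof -
  have "AE t in lebesgue_on {0..T}. (\<lambda>t. f t - g t) differentiable (at t within {0..T})"
    using assms[unfolded ac_diff_def, THEN conjunct2] by eventually_elim (rule differentiable_diff)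
  then show ?thesis using assms abs_continuous_diff unfolding ac_diff_def by blast
qed

lemma ac_diff_linear:
  assumes h: "bounded_linear h" and f: "ac_diff T f" shows "ac_diff T (\<lambda>t. h (f t))"
proof -
  have "AE t in lebesgue_on {0..T}. (\<lambda>t. h (f t)) differentiable (at t within {0..T})"
    using f[unfolded ac_diff_def, THEN conjunct2]
    by eventually_elim (use bounded_linear.has_derivative[OF h] in \<open>unfold differentiable_def, blast\<close>)
  then show ?thesis using f abs_continuous_linear[OF h] unfolding ac_diff_def by blast
qed

lemma ac_diff_inverse:
  fixes f :: "real \<Rightarrow> real"
  assumes f: "ac_diff T f" and nz: "\<And>t. t \<in> {0..T} \<Longrightarrow> f t \<noteq> 0"
  shows "ac_diff T (\<lambda>t. inverse (f t))"
proof -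
  have AE0: "AE t in lebesgue_on {0..T}. t \<in> {0..T}" by (rule AE_I2) simp
  have "AE t in lebesgue_on {0..T}. (\<lambda>t. inverse (f t)) differentiable (at t within {0..T})"
    using f[unfolded ac_diff_def, THEN conjunct2] AE0 by eventually_elim (intro differentiable_inverse nz)
  then show ?thesis using f abs_continuous_inverse[of 0 T f, OF _ nz] unfolding ac_diff_def by blast
qed

lemma ac_diff_cong:
  assumes f: "ac_diff T f" and eq: "\<And>t. t \<in> {0..T} \<Longrightarrow> g t = f t"
  shows "ac_diff T g"
proof -
  have AE0: "AE t in lebesgue_on {0..T}. t \<in> {0..T}" by (rule AE_I2) simp
  have "AE t in lebesgue_on {0..T}. g differentiable (at t within {0..T})"
    using f[unfolded ac_diff_def, THEN conjunct2] AE0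
  proof eventually_elim
    case (elim t)
    then obtain D where "(f has_derivative D) (at t within {0..T})" unfolding differentiable_def by blast
    from has_derivative_transform[where g=g and f=f, OF elim(2) eq this] show ?case unfolding differentiable_def by blast
  qed
  moreover have "abs_continuous 0 T g"
    by (rule abs_continuous_Lipschitz[of _ _ f _ 1]) (use f eq in \<open>simp_all add: ac_diff_def\<close>)
  ultimately show ?thesis unfolding ac_diff_def by blast
qed

lemma ac_diff_fiber_integral:
  assumes "L > 0" "T > 0" "time_prim L T u h"
  shows "ac_diff T (\<lambda>t. LINT s|lebesgue_on {0..L}. u s t)"
  unfolding ac_diff_def using time_prim_fiber_integral[OF assms] by blast

lemma abs_continuous_constant:
  fixes u :: "real \<Rightarrow> 'a::euclidean_space"
  assumes "abs_continuous a b u" "AE t in lebesgue_on {a..b}. (u has_vector_derivative 0) (at t within {a..b})" "t \<in> {a..b}"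
  shows "u t = u a"
  using indefinite_integral_if_AE_derivative[OF assms(1) _ assms(2,3)] by simp

context swimmer begin

lemma rigid_motion_ac_diff:
  fixes y :: "real \<Rightarrow> real^2" and Q :: "real \<Rightarrow> real^2^2"
  assumes Q: "\<And>t. t \<in> {0..T} \<Longrightarrow> rotation_matrix (Q t)"
    and X: "(\<lambda>s t. y t + Q t *v \<xi> s t) \<in> space_X L T"
  shows "ac_diff T (\<lambda>t. Q t $ 1 $ 1)" "ac_diff T (\<lambda>t. Q t $ 2 $ 1)" "ac_diff T y"
proof -
  let ?z = "\<lambda>s t. y t + Q t *v \<xi> s t"
  let ?I = "\<lambda>f. LINT s|lebesgue_on {0..L}. f s"
  obtain g0 where g0: "time_prim L T \<xi> g0" by (rule time_prim_X[OF L T \<xi>_X], erule that)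
  obtain h0 where h0: "time_prim L T ?z h0" by (rule time_prim_X[OF L T X], erule that)
  have bJ: "bounded_bilinear (\<lambda>(x :: real^2) y. x \<bullet> (J *v y))"
    by (rule bounded_bilinear.comp[OF bounded_bilinear_inner bounded_linear_ident matrix_vector_mul_bounded_linear])
  define X1 where "X1 t = ?I (\<lambda>s. \<xi> s t)" for t
  define Y1 where "Y1 t = ?I (\<lambda>s. ?z s t)" for t
  define S where "S t = ?I (\<lambda>s. \<xi> s t \<bullet> \<xi> s t)" for t
  define P where "P t = ?I (\<lambda>s. ?z s t \<bullet> \<xi> s t)" for t
  define R where "R t = ?I (\<lambda>s. ?z s t \<bullet> (J *v \<xi> s t))" for t
  have aX: "ac_diff T X1" unfolding X1_def[abs_def] by (rule ac_diff_fiber_integral[OF L T g0])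
  have aY: "ac_diff T Y1" unfolding Y1_def[abs_def] by (rule ac_diff_fiber_integral[OF L T h0])
  have aS: "ac_diff T S" unfolding S_def[abs_def]
    by (rule time_prim_bilinear[OF L T bounded_bilinear_inner g0 g0]) (rule ac_diff_fiber_integral[OF L T])
  have aP: "ac_diff T P" unfolding P_def[abs_def]
    by (rule time_prim_bilinear[OF L T bounded_bilinear_inner h0 g0]) (rule ac_diff_fiber_integral[OF L T])
  have aR: "ac_diff T R" unfolding R_def[abs_def]
    by (rule time_prim_bilinear[OF L T bJ h0 g0]) (rule ac_diff_fiber_integral[OF L T])
  define D where "D t = L * S t - X1 t \<bullet> X1 t" for t
  have aJ: "ac_diff T (\<lambda>t. J *v X1 t)" by (rule ac_diff_linear[OF matrix_vector_mul_bounded_linear aX])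
  have scale: "ac_diff T (\<lambda>t. c * f t)" if "ac_diff T f" for c :: real and f :: "real \<Rightarrow> real"
    by (rule ac_diff_linear[OF bounded_linear_mult_right that])
  have aD: "ac_diff T D" unfolding D_def[abs_def]
    by (intro ac_diff_diff scale aS ac_diff_bilinear[OF bounded_bilinear_inner aX aX])
  have ints: "integrable (lebesgue_on {0..L}) (\<lambda>s. \<xi> s t)" "integrable (lebesgue_on {0..L}) (\<lambda>s. \<xi> s t \<bullet> \<xi> s t)"
      "\<And>v. integrable (lebesgue_on {0..L}) (\<lambda>s. v \<bullet> \<xi> s t)" "\<And>v. integrable (lebesgue_on {0..L}) (\<lambda>s. v \<bullet> (J *v \<xi> s t))"
      "integrable (lebesgue_on {0..L}) (\<lambda>s. J *v \<xi> s t)"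
    if "t \<in> {0..T}" for t
    by (intro integrable_continuous_lebesgue_on continuous_intros cont_J slice_\<xi> that)+
  have mL: "measure (lebesgue_on {0..L}) (space (lebesgue_on {0..L})) = L"
    using L by (simp add: measure_restrict_space)
  have Dpos: "D t > 0" if t: "t \<in> {0..T}" for t
  proof -
    let ?m = "X1 t /\<^sub>R L"
    have c: "continuous_on {0..L} (\<lambda>s. (\<xi> s t - ?m) \<bullet> (\<xi> s t - ?m))" by (intro continuous_intros slice_\<xi> t)
    have "?I (\<lambda>s. (\<xi> s t - ?m) \<bullet> (\<xi> s t - ?m)) = ?I (\<lambda>s. \<xi> s t \<bullet> \<xi> s t - 2 * (?m \<bullet> \<xi> s t) + ?m \<bullet> ?m)"
      by (simp add: inner_diff_left inner_diff_right inner_commute algebra_simps)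
    also have "\<dots> = S t - 2 * (?m \<bullet> X1 t) + L * (?m \<bullet> ?m)"
      unfolding S_def X1_def using ints[OF t] mL by simp
    also have "\<dots> = D t / L" unfolding D_def using L by (simp add: field_simps)
    finally have e: "integral {0..L} (\<lambda>s. (\<xi> s t - ?m) \<bullet> (\<xi> s t - ?m)) = D t / L"
      using LINT_eq_integral[OF absolutely_integrable_continuous_real[OF c]] by simp
    have nn: "0 \<le> integral {0..L} (\<lambda>s. (\<xi> s t - ?m) \<bullet> (\<xi> s t - ?m))"
      by (rule integral_nonneg[OF integrable_continuous_real[OF c]]) simp
    have "D t \<noteq> 0"
    proof
      assume "D t = 0"
      then have "\<forall>s\<in>{0..L}. (\<xi> s t - ?m) \<bullet> (\<xi> s t - ?m) = 0"
        using integral_eq_0_iff[OF c L] e by auto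
      then have const: "\<xi> s t = ?m" if "s \<in> {0..L}" for s using that by auto
      have s0: "(0::real) \<in> {0..L}" using L by simp
      have "((\<lambda>s. \<xi> s t) has_vector_derivative 0) (at 0 within {0..L})"
        by (rule has_vector_derivative_transform[OF s0 const has_vector_derivative_const[of ?m]])
      then have "tng 0 t = 0" using derivative_unique_Icc[OF L s0 has_derivative_tng[OF s0 t]] by blast
      then show False using norm_tng[OF s0 t] by simp
    qed
    moreover have "0 \<le> D t" using nn e L by (simp add: zero_le_divide_iff)
    ultimately show ?thesis by simp
  qed
  have ab: "Q t $ 1 $ 1 = (L * P t - Y1 t \<bullet> X1 t) * inverse (D t) \<and>
      Q t $ 2 $ 1 = (L * R t - Y1 t \<bullet> (J *v X1 t)) * inverse (D t) \<and>
      y t = (1 / L) *\<^sub>R (Y1 t - ((Q t $ 1 $ 1) *\<^sub>R X1 t + (Q t $ 2 $ 1) *\<^sub>R (J *v X1 t)))" if t: "t \<in> {0..T}" for t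
  proof -
    let ?a = "Q t $ 1 $ 1" and ?b = "Q t $ 2 $ 1"
    have z: "?z s t = y t + (?a *\<^sub>R \<xi> s t + ?b *\<^sub>R (J *v \<xi> s t))" for s
      using rotation_matrix_2(4)[OF Q[OF t]] by simp
    have JX: "J *v X1 t = ?I (\<lambda>s. J *v \<xi> s t)"
      unfolding X1_def by (rule integral_bounded_linear[OF matrix_vector_mul_bounded_linear ints(1)[OF t], symmetric])
    have Y: "Y1 t = L *\<^sub>R y t + (?a *\<^sub>R X1 t + ?b *\<^sub>R (J *v X1 t))"
      unfolding Y1_def z X1_def using ints[OF t] mL JX[unfolded X1_def] by simp
    have zx: "?z s t \<bullet> \<xi> s t = y t \<bullet> \<xi> s t + ?a * (\<xi> s t \<bullet> \<xi> s t)" for s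
      unfolding z by (simp add: inner_2 algebra_simps)
    have P: "P t = y t \<bullet> X1 t + ?a * S t"
      unfolding P_def zx X1_def S_def using ints[OF t] by simp
    have zj: "?z s t \<bullet> (J *v \<xi> s t) = y t \<bullet> (J *v \<xi> s t) + ?b * (\<xi> s t \<bullet> \<xi> s t)" for s
      unfolding z by (simp add: inner_2 algebra_simps)
    have R: "R t = y t \<bullet> (J *v X1 t) + ?b * S t"
      unfolding R_def zj JX S_def using ints[OF t] by simp
    have "L * P t - Y1 t \<bullet> X1 t = ?a * D t"
      unfolding P Y D_def by (simp add: inner_2 algebra_simps)
    moreover have "L * R t - Y1 t \<bullet> (J *v X1 t) = ?b * D t"
      unfolding R Y D_def by (simp add: inner_2 algebra_simps)
    moreover have "Y1 t - (?a *\<^sub>R X1 t + ?b *\<^sub>R (J *v X1 t)) = L *\<^sub>R y t" unfolding Y by simp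
    ultimately show ?thesis using Dpos[OF t] L by simp
  qed
  have iD: "ac_diff T (\<lambda>t. inverse (D t))" by (rule ac_diff_inverse[OF aD]) (use Dpos in fastforce)
  have "ac_diff T (\<lambda>t. (L * P t - Y1 t \<bullet> X1 t) * inverse (D t))"
    by (intro ac_diff_bilinear[OF bounded_bilinear_mult] ac_diff_diff scale aP iD ac_diff_bilinear[OF bounded_bilinear_inner aY aX])
  then show a: "ac_diff T (\<lambda>t. Q t $ 1 $ 1)" by (rule ac_diff_cong) (use ab in blast)
  have "ac_diff T (\<lambda>t. (L * R t - Y1 t \<bullet> (J *v X1 t)) * inverse (D t))"
    by (intro ac_diff_bilinear[OF bounded_bilinear_mult] ac_diff_diff scale aR iD ac_diff_bilinear[OF bounded_bilinear_inner aY aJ])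
  then show b: "ac_diff T (\<lambda>t. Q t $ 2 $ 1)" by (rule ac_diff_cong) (use ab in blast)
  have "ac_diff T (\<lambda>t. (1 / L) *\<^sub>R (Y1 t - ((Q t $ 1 $ 1) *\<^sub>R X1 t + (Q t $ 2 $ 1) *\<^sub>R (J *v X1 t))))"
    by (intro ac_diff_linear[OF bounded_linear_scaleR_right] ac_diff_diff ac_diff_add aY
        ac_diff_bilinear[OF bounded_bilinear_scaleR] a b aX aJ)
  then show "ac_diff T y" by (rule ac_diff_cong) (use ab in blast)
qed

lemma AE_time_derivative_rigid:
  fixes y :: "real \<Rightarrow> real^2" and Q :: "real \<Rightarrow> real^2^2"
  defines "\<zeta> \<equiv> \<lambda>s t. y t + Q t *v \<xi> s t"
  assumes \<zeta>: "\<zeta> \<in> space_X L T"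
    and d: "AE t in lebesgue_on {0..T}. \<forall>s\<in>{0..L}. (\<xi> s has_vector_derivative \<xi>dot s t) (at t within {0..T}) \<longrightarrow>
      (\<zeta> s has_vector_derivative Q t *v (v t + \<omega> t *\<^sub>R (J *v \<xi> s t) + \<xi>dot s t)) (at t within {0..T})"
  shows "AE t in lebesgue_on {0..T}. AE s in lebesgue_on {0..L}.
      time_derivative L T \<zeta> s t = Q t *v (v t + \<omega> t *\<^sub>R (J *v \<xi> s t) + \<xi>dot s t)"
proof -
  obtain g0 where "time_prim L T \<xi> g0" and ae\<xi>: "AE t in lebesgue_on {0..T}. AE s in lebesgue_on {0..L}.
       \<xi>dot s t = g0 (s, t) \<and> (\<xi> s has_vector_derivative \<xi>dot s t) (at t within {0..T})"
    by (rule time_prim_X[OF L T \<xi>_X])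
  obtain h0 where "time_prim L T \<zeta> h0" and ae\<zeta>: "AE t in lebesgue_on {0..T}. AE s in lebesgue_on {0..L}.
       time_derivative L T \<zeta> s t = h0 (s, t) \<and> (\<zeta> s has_vector_derivative time_derivative L T \<zeta> s t) (at t within {0..T})"
    by (rule time_prim_X[OF L T \<zeta>])
  have AEt: "AE t in lebesgue_on {0..T}. t \<in> {0..T}" by (rule AE_I2) simp
  have AEs: "AE s in lebesgue_on {0..L}. s \<in> {0..L}" by (rule AE_I2) simp
  show ?thesis
    using ae\<xi> ae\<zeta> d AEt
  proof eventually_elim
    case (elim t)
    show ?case
      using elim(1,2) AEs
    proof eventually_elim
      case (elim s)
      show ?case
        by (rule derivative_unique_Icc[OF T \<open>t \<in> {0..T}\<close>]) (use elim \<open>\<forall>s\<in>{0..L}. _\<close> in blast)+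
    qed
  qed
qed

lemma force_torque_balance_rigid_iff:
  fixes y :: "real \<Rightarrow> real^2" and Q :: "real \<Rightarrow> real^2^2"
  defines "\<zeta> \<equiv> \<lambda>s t. y t + Q t *v \<xi> s t"
  assumes Q: "\<And>t. t \<in> {0..T} \<Longrightarrow> rotation_matrix (Q t)"
    and td: "AE t in lebesgue_on {0..T}. AE s in lebesgue_on {0..L}.
      time_derivative L T \<zeta> s t = Q t *v (v t + \<omega> t *\<^sub>R (J *v \<xi> s t) + \<xi>dot s t)"
  shows "force_torque_balance C\<^sub>\<tau> C\<^sub>\<nu> L T \<zeta> \<longleftrightarrow>
    (AE t in lebesgue_on {0..T}. v t = vel C\<^sub>\<tau> C\<^sub>\<nu> L T \<xi> t \<and> \<omega> t = ang_vel C\<^sub>\<tau> C\<^sub>\<nu> L T \<xi> t)"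
proof -
  obtain zB where "zB \<in> borel_measurable borel" "integrable lborel (\<lambda>t. (norm (zB t))\<^sup>2)"
    "AE t in lebesgue_on {0..T}. vec3 (vel C\<^sub>\<tau> C\<^sub>\<nu> L T \<xi> t) (ang_vel C\<^sub>\<tau> C\<^sub>\<nu> L T \<xi> t) = zB t"
    and ai: "AE t in lebesgue_on {0..T}. (\<lambda>s. \<xi>dot s t) absolutely_integrable_on {0..L}"
    by (rule velocity_borel_version)
  have AEt: "AE t in lebesgue_on {0..T}. t \<in> {0..T}" by (rule AE_I2) simp
  have "AE t in lebesgue_on {0..T}.
     ((LINT s|lebesgue_on {0..L}. K C\<^sub>\<tau> C\<^sub>\<nu> L \<zeta> s t *v time_derivative L T \<zeta> s t) = 0 \<and>
     (LINT s|lebesgue_on {0..L}. (K C\<^sub>\<tau> C\<^sub>\<nu> L \<zeta> s t *v time_derivative L T \<zeta> s t) \<bullet> (J *v \<zeta> s t)) = 0)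
     \<longleftrightarrow> (v t = vel C\<^sub>\<tau> C\<^sub>\<nu> L T \<xi> t \<and> \<omega> t = ang_vel C\<^sub>\<tau> C\<^sub>\<nu> L T \<xi> t)"
    using td ai AEt
  proof eventually_elim
    case (elim t)
    show ?case unfolding \<zeta>_def
      by (rule balance_rigid[where y=y and Q=Q, OF elim(3,2) Q[OF elim(3)] elim(1)[unfolded \<zeta>_def]])
  qed
  then show ?thesis unfolding force_torque_balance_def
    by (intro iffI) (erule eventually_elim2, assumption, blast)+
qed

end

section \<open>Equations of motion\<close>

lemma unit_vector_derivative:
  fixes a b :: "real \<Rightarrow> real"
  assumes T: "0 < T" "t \<in> {0..T}" and unit: "\<And>t. t \<in> {0..T} \<Longrightarrow> (a t)\<^sup>2 + (b t)\<^sup>2 = 1"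
    and a: "(a has_real_derivative a') (at t within {0..T})"
    and b: "(b has_real_derivative b') (at t within {0..T})"
  shows "a' = - (a t * b' - b t * a') * b t" "b' = (a t * b' - b t * a') * a t"
proof -
  have "((\<lambda>t. (a t)\<^sup>2 + (b t)\<^sup>2) has_real_derivative 2 * (a t * a') + 2 * (b t * b')) (at t within {0..T})"
    by (auto intro!: derivative_eq_intros a b)
  then have "((\<lambda>t. (a t)\<^sup>2 + (b t)\<^sup>2) has_vector_derivative 2 * (a t * a') + 2 * (b t * b')) (at t within {0..T})"
    by (simp add: has_real_derivative_iff_has_vector_derivative)
  moreover have "((\<lambda>t. (a t)\<^sup>2 + (b t)\<^sup>2) has_vector_derivative 0) (at t within {0..T})"
    by (rule has_vector_derivative_transform[OF T(2) unit has_vector_derivative_const])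
  ultimately have "2 * (a t * a') + 2 * (b t * b') = 0" by (rule derivative_unique_Icc[OF T])
  then have 0: "a t * a' + b t * b' = 0" by simp
  have "a' = a' * ((a t)\<^sup>2 + (b t)\<^sup>2) - a t * (a t * a' + b t * b')" using 0 unit[OF T(2)] by simp
  then show "a' = - (a t * b' - b t * a') * b t" by (simp add: power2_eq_square algebra_simps)
  have "b' = b' * ((a t)\<^sup>2 + (b t)\<^sup>2) - b t * (a t * a' + b t * b')" using 0 unit[OF T(2)] by simp
  then show "b' = (a t * b' - b t * a') * a t" by (simp add: power2_eq_square algebra_simps)
qed

context swimmer begin

lemma velocity_L2:
  obtains vB wB where "vB \<in> borel_measurable borel" "integrable lborel (\<lambda>t. (norm (vB t))\<^sup>2)"
    "wB \<in> borel_measurable borel" "integrable lborel (\<lambda>t. (wB t)\<^sup>2)"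
    "AE t in lebesgue_on {0..T}. vel C\<^sub>\<tau> C\<^sub>\<nu> L T \<xi> t = vB t \<and> ang_vel C\<^sub>\<tau> C\<^sub>\<nu> L T \<xi> t = wB t"
proof -
  obtain zB :: "real \<Rightarrow> real^3" where m: "zB \<in> borel_measurable borel" and i: "integrable lborel (\<lambda>t. (norm (zB t))\<^sup>2)"
    and ae: "AE t in lebesgue_on {0..T}. vec3 (vel C\<^sub>\<tau> C\<^sub>\<nu> L T \<xi> t) (ang_vel C\<^sub>\<tau> C\<^sub>\<nu> L T \<xi> t) = zB t"
    by (rule velocity_borel_version)
  define p :: "real^3 \<Rightarrow> real^2" where "p z = (\<chi> i. if i = 1 then z $ 1 else z $ 2)" for z
  have p: "p z $ 1 = z $ 1" "p z $ 2 = z $ 2" for z by (simp_all add: p_def)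
  have np: "(norm (p z))\<^sup>2 \<le> (norm z)\<^sup>2" "(z $ 3)\<^sup>2 \<le> (norm z)\<^sup>2" for z
    unfolding power2_norm_eq_inner by (simp_all add: inner_vec_def sum_2 sum_3 p power2_eq_square)
  have cp: "continuous_on UNIV p"
    unfolding p_def by (intro continuous_on_vec_lambda) (rename_tac i, case_tac "i = 1", auto intro!: continuous_intros)
  have mp: "(\<lambda>t. p (zB t)) \<in> borel_measurable borel"
    by (rule measurable_compose[OF m borel_measurable_continuous_onI[OF cp]])
  have mw: "(\<lambda>t. zB t $ 3) \<in> borel_measurable borel"
    by (rule measurable_compose[OF m borel_measurable_continuous_onI]) (intro continuous_intros)
  have "integrable lborel (\<lambda>t. (norm (p (zB t)))\<^sup>2)"
    by (rule Bochner_Integration.integrable_bound[OF i]) (use mp np in auto)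
  moreover have "integrable lborel (\<lambda>t. (zB t $ 3)\<^sup>2)"
    by (rule Bochner_Integration.integrable_bound[OF i]) (use mw np in auto)
  moreover have "AE t in lebesgue_on {0..T}. vel C\<^sub>\<tau> C\<^sub>\<nu> L T \<xi> t = p (zB t) \<and> ang_vel C\<^sub>\<tau> C\<^sub>\<nu> L T \<xi> t = zB t $ 3"
    using ae
  proof eventually_elim
    case (elim t)
    from elim[symmetric] show ?case by (simp add: vec_eq_iff forall_2 p)
  qed
  ultimately show thesis using that mp mw by blast
qed

lemma balanced_rigid_motion_if_velocity:
  assumes vB: "vB \<in> borel_measurable borel" "integrable lborel (\<lambda>t. (norm (vB t))\<^sup>2)"
    and wB: "wB \<in> borel_measurable borel" "integrable lborel (\<lambda>t. (wB t)\<^sup>2)"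
    and ae: "AE t in lebesgue_on {0..T}. vel C\<^sub>\<tau> C\<^sub>\<nu> L T \<xi> t = vB t \<and> ang_vel C\<^sub>\<tau> C\<^sub>\<nu> L T \<xi> t = wB t"
    and acx: "abs_continuous 0 T x" and ac\<theta>: "abs_continuous 0 T \<theta>"
    and dx: "AE t in lebesgue_on {0..T}. (x has_vector_derivative rot (\<theta> t) *v vB t) (at t within {0..T})"
    and d\<theta>: "AE t in lebesgue_on {0..T}. (\<theta> has_real_derivative wB t) (at t within {0..T})"
    and init: "x 0 = x\<^sub>0" "\<theta> 0 = \<theta>\<^sub>0"
  shows "balanced_rigid_motion C\<^sub>\<tau> C\<^sub>\<nu> L T \<xi> x\<^sub>0 \<theta>\<^sub>0 x (\<lambda>t. rot (\<theta> t))"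
proof -
  let ?\<zeta> = "\<lambda>s t. x t + rot (\<theta> t) *v \<xi> s t"
  note cx = abs_continuous_imp_continuous_on[OF acx] and c\<theta> = abs_continuous_imp_continuous_on[OF ac\<theta>]
  have "Linf_H2 L T \<xi>" using \<xi>_X by (simp add: space_X_def)
  then have lin: "Linf_H2 L T ?\<zeta>" by (rule Linf_H2_rigid[OF L T _ cont_\<xi> cx c\<theta>])
  obtain g0 where tp: "time_prim L T \<xi> g0" by (rule time_prim_X[OF L T \<xi>_X], erule that)
  have td: "\<exists>g. is_time_derivative L T ?\<zeta> g"
    by (rule exI, rule is_time_derivative_rigid[OF L T tp vB wB acx ac\<theta> dx d\<theta>])
  have cz: "continuous_on ({0..L} \<times> {0..T}) (\<lambda>(s, t). ?\<zeta> s t)"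
  proof -
    have "continuous_on ({0..L} \<times> {0..T}) (\<lambda>z. x (snd z) + rot (\<theta> (snd z)) *v \<xi> (fst z) (snd z))"
      by (intro continuous_on_add continuous_on_rot continuous_on_compose2[OF cx] continuous_on_compose2[OF c\<theta>]
          continuous_on_snd continuous_on_id) (use cont_\<xi> in \<open>auto simp: split_def\<close>)
    then show ?thesis by (simp add: split_def)
  qed
  have X: "?\<zeta> \<in> space_X L T" using lin td cz by (simp add: space_X_def)
  have X1: "?\<zeta> \<in> space_X1 L T" unfolding space_X1_def
    using X by (auto simp: space_derivative_rigid_tng rotation_matrix_norm[OF rotation_matrix_rot] norm_tng)
  have AEt: "AE t in lebesgue_on {0..T}. vel C\<^sub>\<tau> C\<^sub>\<nu> L T \<xi> t = vel C\<^sub>\<tau> C\<^sub>\<nu> L T \<xi> t \<and> ang_vel C\<^sub>\<tau> C\<^sub>\<nu> L T \<xi> t = ang_vel C\<^sub>\<tau> C\<^sub>\<nu> L T \<xi> t"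
    by simp
  have d: "AE t in lebesgue_on {0..T}. \<forall>s\<in>{0..L}. (\<xi> s has_vector_derivative \<xi>dot s t) (at t within {0..T}) \<longrightarrow>
      (?\<zeta> s has_vector_derivative rot (\<theta> t) *v (vel C\<^sub>\<tau> C\<^sub>\<nu> L T \<xi> t + ang_vel C\<^sub>\<tau> C\<^sub>\<nu> L T \<xi> t *\<^sub>R (J *v \<xi> s t) + \<xi>dot s t)) (at t within {0..T})"
    using dx d\<theta> ae
  proof eventually_elim
    case (elim t)
    show ?case
    proof (intro ballI impI)
      fix s assume "(\<xi> s has_vector_derivative \<xi>dot s t) (at t within {0..T})"
      from has_vector_derivative_add[OF elim(1) rot_has_vector_derivative[OF elim(2) this]]
      show "(?\<zeta> s has_vector_derivative rot (\<theta> t) *v (vel C\<^sub>\<tau> C\<^sub>\<nu> L T \<xi> t + ang_vel C\<^sub>\<tau> C\<^sub>\<nu> L T \<xi> t *\<^sub>R (J *v \<xi> s t) + \<xi>dot s t)) (at t within {0..T})"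
        using elim(3) by (simp add: rotation_matrix_J[OF rotation_matrix_rot] matrix_vector_right_distrib matrix_vector_mult_scaleR add.assoc)
    qed
  qed
  have "force_torque_balance C\<^sub>\<tau> C\<^sub>\<nu> L T ?\<zeta>"
    by (rule iffD2[OF force_torque_balance_rigid_iff[OF rotation_matrix_rot AE_time_derivative_rigid[OF X d]] AEt])
  with X1 init show ?thesis unfolding balanced_rigid_motion_def by (simp add: rotation_matrix_rot)
qed

lemma balanced_rigid_motion_velocity:
  assumes brm: "balanced_rigid_motion C\<^sub>\<tau> C\<^sub>\<nu> L T \<xi> x\<^sub>0 \<theta>\<^sub>0 y Q"
  defines "a \<equiv> \<lambda>t. Q t $ 1 $ 1" and "b \<equiv> \<lambda>t. Q t $ 2 $ 1"
  shows "abs_continuous 0 T a" "abs_continuous 0 T b" "abs_continuous 0 T y"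
    "AE t in lebesgue_on {0..T}.
       (a has_real_derivative - ang_vel C\<^sub>\<tau> C\<^sub>\<nu> L T \<xi> t * b t) (at t within {0..T}) \<and>
       (b has_real_derivative ang_vel C\<^sub>\<tau> C\<^sub>\<nu> L T \<xi> t * a t) (at t within {0..T}) \<and>
       (y has_vector_derivative Q t *v vel C\<^sub>\<tau> C\<^sub>\<nu> L T \<xi> t) (at t within {0..T})"
proof -
  let ?\<zeta> = "\<lambda>s t. y t + Q t *v \<xi> s t"
  have Q: "\<And>t. t \<in> {0..T} \<Longrightarrow> rotation_matrix (Q t)" and X: "?\<zeta> \<in> space_X L T"
    and bal: "force_torque_balance C\<^sub>\<tau> C\<^sub>\<nu> L T ?\<zeta>"
    using brm unfolding balanced_rigid_motion_def space_X1_def by blast+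
  have "ac_diff T a" unfolding a_def by (rule rigid_motion_ac_diff(1)[OF Q X])
  moreover have "ac_diff T b" unfolding b_def by (rule rigid_motion_ac_diff(2)[OF Q X])
  moreover have "ac_diff T y" by (rule rigid_motion_ac_diff(3)[OF Q X])
  ultimately have ad: "abs_continuous 0 T a \<and> (AE t in lebesgue_on {0..T}. a differentiable (at t within {0..T}))"
    "abs_continuous 0 T b \<and> (AE t in lebesgue_on {0..T}. b differentiable (at t within {0..T}))"
    "abs_continuous 0 T y \<and> (AE t in lebesgue_on {0..T}. y differentiable (at t within {0..T}))"
    by (simp_all only: ac_diff_def)
  show "abs_continuous 0 T a" "abs_continuous 0 T b" "abs_continuous 0 T y"
    using ad unfolding a_def b_def by blast+
  have AEt: "AE t in lebesgue_on {0..T}. t \<in> {0..T}" by (rule AE_I2) simp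
  let ?D = "\<lambda>f t. vector_derivative f (at t within {0..T})"
  define \<omega> where "\<omega> t = a t * ?D b t - b t * ?D a t" for t
  define v where "v t = a t *\<^sub>R ?D y t - b t *\<^sub>R (J *v ?D y t)" for t
  have der: "AE t in lebesgue_on {0..T}. t \<in> {0..T} \<and>
       (a has_real_derivative - \<omega> t * b t) (at t within {0..T}) \<and>
       (b has_real_derivative \<omega> t * a t) (at t within {0..T}) \<and>
       (y has_vector_derivative Q t *v v t) (at t within {0..T})"
    using ad(1)[THEN conjunct2] ad(2)[THEN conjunct2] ad(3)[THEN conjunct2] AEt
  proof eventually_elim
    case (elim t)
    have a: "(a has_vector_derivative ?D a t) (at t within {0..T})"
      and b: "(b has_vector_derivative ?D b t) (at t within {0..T})"
      and y: "(y has_vector_derivative ?D y t) (at t within {0..T})"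
      using elim unfolding a_def b_def by (blast intro: vector_derivative_works[THEN iffD1])+
    have unit: "(a t)\<^sup>2 + (b t)\<^sup>2 = 1" if "t \<in> {0..T}" for t
      using rotation_matrix_2(1)[OF Q[OF that]] by (simp add: a_def b_def)
    note ab = a[folded has_real_derivative_iff_has_vector_derivative] b[folded has_real_derivative_iff_has_vector_derivative]
    note u = unit_vector_derivative[OF T elim(4) unit ab]
    have "Q t *v v t = ((a t)\<^sup>2 + (b t)\<^sup>2) *\<^sub>R ?D y t"
      unfolding rotation_matrix_2(4)[OF Q[OF elim(4)]] v_def a_def b_def
      by (simp add: vec_eq_iff forall_2 power2_eq_square algebra_simps)
    then have "Q t *v v t = ?D y t" using unit[OF elim(4)] by simp
    moreover have "- \<omega> t * b t = ?D a t" unfolding \<omega>_def by (rule u(1)[symmetric])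
    moreover have "\<omega> t * a t = ?D b t" unfolding \<omega>_def by (rule u(2)[symmetric])
    ultimately show ?case using elim(4) ab y by simp
  qed
  have d: "AE t in lebesgue_on {0..T}. \<forall>s\<in>{0..L}. (\<xi> s has_vector_derivative \<xi>dot s t) (at t within {0..T}) \<longrightarrow>
      (?\<zeta> s has_vector_derivative Q t *v (v t + \<omega> t *\<^sub>R (J *v \<xi> s t) + \<xi>dot s t)) (at t within {0..T})"
    using der
  proof eventually_elim
    case (elim t)
    show ?case
    proof (intro ballI impI)
      fix s assume s: "s \<in> {0..L}" and \<xi>': "(\<xi> s has_vector_derivative \<xi>dot s t) (at t within {0..T})"
      have 1: "((\<lambda>t. y t + (a t *\<^sub>R \<xi> s t + b t *\<^sub>R (J *v \<xi> s t))) has_vector_derivative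
         Q t *v v t + ((a t *\<^sub>R \<xi>dot s t + (- \<omega> t * b t) *\<^sub>R \<xi> s t)
           + (b t *\<^sub>R (J *v \<xi>dot s t) + (\<omega> t * a t) *\<^sub>R (J *v \<xi> s t)))) (at t within {0..T})"
        using elim by (intro has_vector_derivative_add has_vector_derivative_scaleR \<xi>'
            bounded_linear.has_vector_derivative[OF matrix_vector_mul_bounded_linear]) blast+
      have 2: "Q t *v v t + ((a t *\<^sub>R \<xi>dot s t + (- \<omega> t * b t) *\<^sub>R \<xi> s t)
           + (b t *\<^sub>R (J *v \<xi>dot s t) + (\<omega> t * a t) *\<^sub>R (J *v \<xi> s t)))
         = Q t *v (v t + \<omega> t *\<^sub>R (J *v \<xi> s t) + \<xi>dot s t)"
        using elim unfolding rotation_matrix_2(4)[OF Q] a_def b_def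
        by (simp add: vec_eq_iff forall_2 rotation_matrix_2(4)[OF Q] algebra_simps)
      have 3: "?\<zeta> s t = y t + (a t *\<^sub>R \<xi> s t + b t *\<^sub>R (J *v \<xi> s t))" if "t \<in> {0..T}" for t
        using rotation_matrix_2(4)[OF Q[OF that]] by (simp add: a_def b_def)
      have "t \<in> {0..T}" using elim by blast
      then show "(?\<zeta> s has_vector_derivative Q t *v (v t + \<omega> t *\<^sub>R (J *v \<xi> s t) + \<xi>dot s t)) (at t within {0..T})"
        by (rule has_vector_derivative_transform[OF _ 3 1[unfolded 2]])
    qed
  qed
  have "AE t in lebesgue_on {0..T}. v t = vel C\<^sub>\<tau> C\<^sub>\<nu> L T \<xi> t \<and> \<omega> t = ang_vel C\<^sub>\<tau> C\<^sub>\<nu> L T \<xi> t"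
    by (rule iffD1[OF force_torque_balance_rigid_iff[OF Q AE_time_derivative_rigid[OF X d]] bal])
  then show "AE t in lebesgue_on {0..T}.
       (a has_real_derivative - ang_vel C\<^sub>\<tau> C\<^sub>\<nu> L T \<xi> t * b t) (at t within {0..T}) \<and>
       (b has_real_derivative ang_vel C\<^sub>\<tau> C\<^sub>\<nu> L T \<xi> t * a t) (at t within {0..T}) \<and>
       (y has_vector_derivative Q t *v vel C\<^sub>\<tau> C\<^sub>\<nu> L T \<xi> t) (at t within {0..T})"
    using der by eventually_elim metis
qed

lemma equations_of_motion:
  obtains x \<theta> where "solves_eom C\<^sub>\<tau> C\<^sub>\<nu> L T \<xi> x\<^sub>0 \<theta>\<^sub>0 x \<theta>"
    "\<And>y \<phi> t. solves_eom C\<^sub>\<tau> C\<^sub>\<nu> L T \<xi> x\<^sub>0 \<theta>\<^sub>0 y \<phi> \<Longrightarrow> t \<in> {0..T} \<Longrightarrow> y t = x t \<and> \<phi> t = \<theta> t"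
    "H1_on 0 T (\<lambda>t. (x t, \<theta> t))"
    "balanced_rigid_motion C\<^sub>\<tau> C\<^sub>\<nu> L T \<xi> x\<^sub>0 \<theta>\<^sub>0 x (\<lambda>t. rot (\<theta> t))"
    "\<And>y Q t. balanced_rigid_motion C\<^sub>\<tau> C\<^sub>\<nu> L T \<xi> x\<^sub>0 \<theta>\<^sub>0 y Q \<Longrightarrow> t \<in> {0..T} \<Longrightarrow> y t = x t \<and> Q t = rot (\<theta> t)"
proof -
  obtain vB wB where vB: "vB \<in> borel_measurable borel" "integrable lborel (\<lambda>t. (norm (vB t))\<^sup>2)"
    and wB: "wB \<in> borel_measurable borel" "integrable lborel (\<lambda>t. (wB t)\<^sup>2)"
    and ae: "AE t in lebesgue_on {0..T}. vel C\<^sub>\<tau> C\<^sub>\<nu> L T \<xi> t = vB t \<and> ang_vel C\<^sub>\<tau> C\<^sub>\<nu> L T \<xi> t = wB t"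
    by (rule velocity_L2)
  have AEt: "AE t in lebesgue_on {0..T}. t \<in> {0..T}" by (rule AE_I2) simp
  have wB2: "integrable lborel (\<lambda>t. (norm (wB t))\<^sup>2)" using wB(2) by simp
  have wai: "wB absolutely_integrable_on {0..T}" by (rule square_integrable_imp_absolutely_integrable[OF wB(1) wB2])
  have vai: "vB absolutely_integrable_on {0..T}" by (rule square_integrable_imp_absolutely_integrable[OF vB])
  define \<theta> where "\<theta> t = \<theta>\<^sub>0 + integral {0..t} wB" for t
  have \<theta>0: "\<theta> 0 = \<theta>\<^sub>0" by (simp add: \<theta>_def)
  have \<theta>i: "\<theta> t = \<theta> 0 + integral {0..t} wB" for t unfolding \<theta>0 by (rule \<theta>_def)
  have ac\<theta>: "abs_continuous 0 T \<theta>" by (rule abs_continuous_if_indefinite_integral[OF wai \<theta>i])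
  have d\<theta>: "AE t in lebesgue_on {0..T}. (\<theta> has_real_derivative wB t) (at t within {0..T})"
    unfolding has_real_derivative_iff_has_vector_derivative
    by (rule AE_derivative_if_indefinite_integral[OF wai \<theta>i])
  let ?r = "\<lambda>t. rot (\<theta> t) *v vB t"
  have rai: "?r absolutely_integrable_on {0..T}"
    by (rule absolutely_integrable_rot[OF abs_continuous_imp_continuous_on[OF ac\<theta>] vai])
  define x where "x t = x\<^sub>0 + integral {0..t} ?r" for t
  have x0: "x 0 = x\<^sub>0" by (simp add: x_def)
  have xi: "x t = x 0 + integral {0..t} ?r" for t unfolding x0 by (rule x_def)
  have acx: "abs_continuous 0 T x" by (rule abs_continuous_if_indefinite_integral[OF rai xi])
  have dx: "AE t in lebesgue_on {0..T}. (x has_vector_derivative ?r t) (at t within {0..T})"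
    by (rule AE_derivative_if_indefinite_integral[OF rai xi])
  have x_unique: "y t = x t" if "abs_continuous 0 T y" "y 0 = x\<^sub>0" "t \<in> {0..T}"
    "AE t in lebesgue_on {0..T}. (y has_vector_derivative ?r t) (at t within {0..T})" for y t
    using indefinite_integral_if_AE_derivative[OF that(1) rai that(4,3)] that(2) by (simp add: x_def)

  show thesis
  proof
    show "solves_eom C\<^sub>\<tau> C\<^sub>\<nu> L T \<xi> x\<^sub>0 \<theta>\<^sub>0 x \<theta>"
      unfolding solves_eom_def
    proof (intro conjI x0 \<theta>0 abs_continuous_Pair acx ac\<theta>)
      show "AE t in lebesgue_on {0..T}.
        (x has_vector_derivative rot (\<theta> t) *v vel C\<^sub>\<tau> C\<^sub>\<nu> L T \<xi> t) (at t within {0..T}) \<and>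
        (\<theta> has_real_derivative ang_vel C\<^sub>\<tau> C\<^sub>\<nu> L T \<xi> t) (at t within {0..T})"
        using ae dx d\<theta> by eventually_elim simp
    qed
    show "balanced_rigid_motion C\<^sub>\<tau> C\<^sub>\<nu> L T \<xi> x\<^sub>0 \<theta>\<^sub>0 x (\<lambda>t. rot (\<theta> t))"
      by (rule balanced_rigid_motion_if_velocity[OF vB wB ae acx ac\<theta> dx d\<theta> x0 \<theta>0])
  next
    fix y \<phi> t assume s: "solves_eom C\<^sub>\<tau> C\<^sub>\<nu> L T \<xi> x\<^sub>0 \<theta>\<^sub>0 y \<phi>" and t: "t \<in> {0..T}"
    have ac: "abs_continuous 0 T (\<lambda>t. (y t, \<phi> t))"
      and de: "AE t in lebesgue_on {0..T}.
        (y has_vector_derivative rot (\<phi> t) *v vel C\<^sub>\<tau> C\<^sub>\<nu> L T \<xi> t) (at t within {0..T}) \<and>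
        (\<phi> has_real_derivative ang_vel C\<^sub>\<tau> C\<^sub>\<nu> L T \<xi> t) (at t within {0..T})"
      and init: "y 0 = x\<^sub>0" "\<phi> 0 = \<theta>\<^sub>0"
      using s unfolding solves_eom_def by blast+
    have acy: "abs_continuous 0 T y" and ac\<phi>: "abs_continuous 0 T \<phi>"
      using abs_continuous_linear[OF bounded_linear_fst ac] abs_continuous_linear[OF bounded_linear_snd ac] by simp_all
    have d\<phi>: "AE t in lebesgue_on {0..T}. (\<phi> has_vector_derivative wB t) (at t within {0..T})"
      using de ae by eventually_elim (simp add: has_real_derivative_iff_has_vector_derivative)
    have \<phi>: "\<phi> t = \<theta> t" if "t \<in> {0..T}" for t
      using indefinite_integral_if_AE_derivative[OF ac\<phi> wai d\<phi> that] init by (simp add: \<theta>_def)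
    have "AE t in lebesgue_on {0..T}. (y has_vector_derivative ?r t) (at t within {0..T})"
      using de ae AEt by eventually_elim (simp add: \<phi>)
    from x_unique[OF acy init(1) t this] \<phi>[OF t] show "y t = x t \<and> \<phi> t = \<theta> t" ..
  next
    have c: "continuous_on {0..T} (\<lambda>t. (x t, \<theta> t))"
      by (intro abs_continuous_imp_continuous_on abs_continuous_Pair acx ac\<theta>)
    have vL2: "L2_on {0..T} vB" and wL2: "L2_on {0..T} wB"
      by (rule L2_on_if_square_integrable[OF vB], rule L2_on_if_square_integrable[OF wB(1) wB2])
    have rm: "?r \<in> borel_measurable (lebesgue_on {0..T})"
      by (rule absolutely_integrable_measurable[THEN iffD1, THEN conjunct1, OF _ rai]) simp
    have "L2_on {0..T} (\<lambda>t. (?r t, wB t))" unfolding L2_on_def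
    proof
      have "wB \<in> borel_measurable (lebesgue_on {0..T})" using wL2 by (simp add: L2_on_def)
      then show "(\<lambda>t. (?r t, wB t)) \<in> borel_measurable (lebesgue_on {0..T})"
        by (rule borel_measurable_Pair[OF rm])
      have "integrable (lebesgue_on {0..T}) (\<lambda>t. (norm (vB t))\<^sup>2 + (wB t)\<^sup>2)"
        using vL2 wL2 by (simp add: L2_on_def)
      then show "integrable (lebesgue_on {0..T}) (\<lambda>t. (norm (?r t, wB t))\<^sup>2)"
        by (simp add: norm_Pair rotation_matrix_norm[OF rotation_matrix_rot])
    qed
    moreover have "has_weak_derivative 0 T (\<lambda>t. (x t, \<theta> t)) (\<lambda>t. (?r t, wB t))"
    proof (rule has_weak_derivative_indefinite_integral)
      show ai: "(\<lambda>t. (?r t, wB t)) absolutely_integrable_on {0..T}"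
        by (rule absolutely_integrable_if_L2_on) fact
      have "AE t in lebesgue_on {0..T}. ((\<lambda>t. (x t, \<theta> t)) has_vector_derivative (?r t, wB t)) (at t within {0..T})"
        using dx d\<theta> by eventually_elim
          (simp add: has_vector_derivative_Pair has_real_derivative_iff_has_vector_derivative)
      then show "(x t, \<theta> t) = (x 0, \<theta> 0) + integral {0..t} (\<lambda>t. (?r t, wB t))" if "t \<in> {0..T}" for t
        by (rule indefinite_integral_if_AE_derivative[OF abs_continuous_Pair[OF acx ac\<theta>] ai _ that])
    qed
    ultimately show "H1_on 0 T (\<lambda>t. (x t, \<theta> t))"
      unfolding H1_on_def using L2_on_continuous[OF c] by blast
  next
    fix y Q t assume brm: "balanced_rigid_motion C\<^sub>\<tau> C\<^sub>\<nu> L T \<xi> x\<^sub>0 \<theta>\<^sub>0 y Q" and t: "t \<in> {0..T}"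
    have Q: "\<And>t. t \<in> {0..T} \<Longrightarrow> rotation_matrix (Q t)" and init: "y 0 = x\<^sub>0" "Q 0 = rot \<theta>\<^sub>0"
      using brm unfolding balanced_rigid_motion_def by blast+
    let ?a = "\<lambda>t. Q t $ 1 $ 1" and ?b = "\<lambda>t. Q t $ 2 $ 1"
    note v = balanced_rigid_motion_velocity[OF brm]
    have acc: "abs_continuous 0 T (\<lambda>t. cos (\<theta> t))" "abs_continuous 0 T (\<lambda>t. sin (\<theta> t))"
      by (rule abs_continuous_Lipschitz[OF ac\<theta>, of _ 1], simp add: abs_cos_diff_le abs_sin_diff_le)+
    let ?p = "\<lambda>t. ?a t * cos (\<theta> t) + ?b t * sin (\<theta> t)" and ?q = "\<lambda>t. ?b t * cos (\<theta> t) - ?a t * sin (\<theta> t)"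
    have acpq: "abs_continuous 0 T ?p" "abs_continuous 0 T ?q"
      by (intro abs_continuous_add abs_continuous_diff abs_continuous_bilinear[OF bounded_bilinear_mult] v acc)+
    have d: "AE t in lebesgue_on {0..T}. (?p has_vector_derivative 0) (at t within {0..T}) \<and>
        (?q has_vector_derivative 0) (at t within {0..T})"
      using v(4) d\<theta> ae
    proof eventually_elim
      case (elim t)
      then have a: "(?a has_real_derivative - wB t * ?b t) (at t within {0..T})"
        and b: "(?b has_real_derivative wB t * ?a t) (at t within {0..T})"
        and th: "(\<theta> has_real_derivative wB t) (at t within {0..T})" by simp_all
      have "(?p has_real_derivative 0) (at t within {0..T})" "(?q has_real_derivative 0) (at t within {0..T})"
        by (auto intro!: derivative_eq_intros a b th simp: algebra_simps)
      then show ?case by (simp add: has_real_derivative_iff_has_vector_derivative)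
    qed
    have Qrot: "Q t = rot (\<theta> t)" if t: "t \<in> {0..T}" for t
    proof -
      have "?p t = ?p 0" by (rule abs_continuous_constant[OF acpq(1) _ t]) (use d in eventually_elim, blast)
      then have p: "?p t = 1" by (simp add: init \<theta>0 rot_nth power2_eq_square[symmetric])
      have "?q t = ?q 0" by (rule abs_continuous_constant[OF acpq(2) _ t]) (use d in eventually_elim, blast)
      then have q: "?q t = 0" by (simp add: init \<theta>0 rot_nth)
      have cs: "(cos (\<theta> t))\<^sup>2 + (sin (\<theta> t))\<^sup>2 = 1" by simp
      have "?a t * ((cos (\<theta> t))\<^sup>2 + (sin (\<theta> t))\<^sup>2) = ?p t * cos (\<theta> t) - ?q t * sin (\<theta> t)"
        by algebra
      then have a: "?a t = cos (\<theta> t)" unfolding cs p q by simp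
      have "?b t * ((cos (\<theta> t))\<^sup>2 + (sin (\<theta> t))\<^sup>2) = ?p t * sin (\<theta> t) + ?q t * cos (\<theta> t)"
        by algebra
      then have b: "?b t = sin (\<theta> t)" unfolding cs p q by simp
      show ?thesis
        using a b rotation_matrix_2(2,3)[OF Q[OF t]] by (simp add: vec_eq_iff forall_2 rot_nth)
    qed
    have "AE t in lebesgue_on {0..T}. (y has_vector_derivative ?r t) (at t within {0..T})"
      using v(4) ae AEt by eventually_elim (simp add: Qrot)
    from x_unique[OF v(3) init(1) t this] Qrot[OF t] show "y t = x t \<and> Q t = rot (\<theta> t)" ..
  qed
qed

end

theorem theorem3p3:
  fixes L T C\<^sub>\<tau> C\<^sub>\<nu> :: real and \<xi> :: "real \<Rightarrow> real \<Rightarrow> real^2" and x\<^sub>0 :: "real^2" and \<theta>\<^sub>0 :: real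
  assumes "L > 0" and "T > 0" and "C\<^sub>\<tau> > 0" and "C\<^sub>\<nu> > 0"
    and "\<xi> \<in> space_X1 L T"
  shows "\<exists>x \<theta>.
    solves_eom C\<^sub>\<tau> C\<^sub>\<nu> L T \<xi> x\<^sub>0 \<theta>\<^sub>0 x \<theta> \<and>
    (\<forall>y \<phi>. solves_eom C\<^sub>\<tau> C\<^sub>\<nu> L T \<xi> x\<^sub>0 \<theta>\<^sub>0 y \<phi> \<longrightarrow> (\<forall>t\<in>{0..T}. y t = x t \<and> \<phi> t = \<theta> t)) \<and>
    H1_on 0 T (\<lambda>t. (x t, \<theta> t)) \<and>
    balanced_rigid_motion C\<^sub>\<tau> C\<^sub>\<nu> L T \<xi> x\<^sub>0 \<theta>\<^sub>0 x (\<lambda>t. rot (\<theta> t)) \<and>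
    (\<forall>y Q. balanced_rigid_motion C\<^sub>\<tau> C\<^sub>\<nu> L T \<xi> x\<^sub>0 \<theta>\<^sub>0 y Q \<longrightarrow>
       (\<forall>t\<in>{0..T}. y t = x t \<and> Q t = rot (\<theta> t)))"
proof -
  interpret swimmer L T C\<^sub>\<tau> C\<^sub>\<nu> \<xi> by unfold_locales (rule assms)+
  obtain x \<theta> where "solves_eom C\<^sub>\<tau> C\<^sub>\<nu> L T \<xi> x\<^sub>0 \<theta>\<^sub>0 x \<theta>"
    "\<And>y \<phi> t. solves_eom C\<^sub>\<tau> C\<^sub>\<nu> L T \<xi> x\<^sub>0 \<theta>\<^sub>0 y \<phi> \<Longrightarrow> t \<in> {0..T} \<Longrightarrow> y t = x t \<and> \<phi> t = \<theta> t"
    "H1_on 0 T (\<lambda>t. (x t, \<theta> t))"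
    "balanced_rigid_motion C\<^sub>\<tau> C\<^sub>\<nu> L T \<xi> x\<^sub>0 \<theta>\<^sub>0 x (\<lambda>t. rot (\<theta> t))"
    "\<And>y Q t. balanced_rigid_motion C\<^sub>\<tau> C\<^sub>\<nu> L T \<xi> x\<^sub>0 \<theta>\<^sub>0 y Q \<Longrightarrow> t \<in> {0..T} \<Longrightarrow> y t = x t \<and> Q t = rot (\<theta> t)"
    by (rule equations_of_motion[where x\<^sub>0=x\<^sub>0 and \<theta>\<^sub>0=\<theta>\<^sub>0], rule that)
  then show ?thesis by blast
qed

end
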